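(* Let $n\ge 2$ be a fixed integer and let $\Omega\subset\mathbb{C}$ be a region with $\Omega\cap\mathbb{R}=\emptyset$ whose boundary consists of a finite number of algebraic curves. Then $$ \Psi(Q;\Omega)=\frac{Q^{n+1}}{2\zeta(n+1)}\int_\Omega\psi(z)\,\nu(dz)+O\left(Q^n\right),\qquad Q\to\infty, $$ where $\nu$ is Lebesgue measure on $\mathbb{C}$, $\zeta$ is the Riemann zeta function, and the implicit constant in $O(\cdot)$ depends only on $n$, the number of algebraic curves forming $\partial\Omega$, and their maximal degree.
   Context: For an integral polynomial $p(x)=a_nx^n+\dots+a_1x+a_0$ with $a_n\neq 0$, its height is $H(p)=\max_{0\le i\le n}|a_i|$. The minimal polynomial of an algebraic number $\alpha$ is the nonzero integral polynomial of minimal degree with coprime coefficients vanishing at $\alpha$; the degree and height of $\alpha$ are the degree and height of its minimal polynomial. $\Psi(Q;\Omega)$ denotes the number of algebraic numbers in $\Omega$ of degree at most $n$ and height at most $Q$. For $z\in\mathbb{C}\setminus\mathbb{R}$, let $D_z$ be the set of $(t_1,\dots,t_{n-1})\in\mathbb{R}^{n-1}$ with $\max_{1\le k\le n-1}|t_k|\le 1$, $\left|z\sum_{k=1}^{n-1}t_k\left(z^k-\frac{\Im z^{k+1}}{\Im z}\right)\right|\le 1$ and $\left|\frac{1}{\Im z}\sum_{k=1}^{n-1}t_k\Im z^{k+1}\right|\le 1$, and define $$\psi(z)=\frac{1}{|\Im z|}\int_{D_z}\left|\sum_{k=1}^{n-1}t_k\left((k+1)z^{k}-\frac{\Im z^{k+1}}{\Im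 z}\right)\right|^2dt_1\dots dt_{n-1}.$$ *)

theory Defs
  imports "HOL-Analysis.Analysis" "HOL-Computational_Algebra.Polynomial"
begin

definition poly_height :: "int poly \<Rightarrow> int" where
  "poly_height p = Max ((\<lambda>i. \<bar>coeff p i\<bar>) ` {..degree p})"

definition is_min_poly :: "complex \<Rightarrow> int poly \<Rightarrow> bool" where
  "is_min_poly \<alpha> p \<longleftrightarrow> p \<noteq> 0 \<and> poly (map_poly of_int p) \<alpha> = 0 \<and> content p = 1 \<and>
     (\<forall>q. q \<noteq> 0 \<and> poly (map_poly of_int q) \<alpha> = 0 \<longrightarrow> degree p \<le> degree q)"

definition Psi :: "nat \<Rightarrow> real \<Rightarrow> complex set \<Rightarrow> nat" where
  "Psi n Q \<Omega> = card {\<alpha> \<in> \<Omega>. \<exists>p. is_min_poly \<alpha> p \<and> degree p \<le> n \<and> real_of_int (poly_height p) \<le> Q}"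

definition D_set :: "nat \<Rightarrow> complex \<Rightarrow> (nat \<Rightarrow> real) set" where
  "D_set n z = {t \<in> PiE {1..n-1} (\<lambda>_. UNIV).
     (\<forall>k\<in>{1..n-1}. \<bar>t k\<bar> \<le> 1) \<and>
     cmod (z * (\<Sum>k=1..n-1. of_real (t k) * (z ^ k - of_real (Im (z ^ (k+1)) / Im z)))) \<le> 1 \<and>
     \<bar>(1 / Im z) * (\<Sum>k=1..n-1. t k * Im (z ^ (k+1)))\<bar> \<le> 1}"

definition psi :: "nat \<Rightarrow> complex \<Rightarrow> real" where
  "psi n z = (1 / \<bar>Im z\<bar>) *
     (LINT t : D_set n z | PiM {1..n-1} (\<lambda>_. lborel).
        (cmod (\<Sum>k=1..n-1. of_real (t k) * (of_nat (k+1) * z ^ k - of_real (Im (z ^ (k+1)) / Im z))))\<^sup>2)"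

definition zeta_nat :: "nat \<Rightarrow> real" where
  "zeta_nat s = (\<Sum>m. 1 / (real m + 1) ^ s)"

definition bipoly_eval :: "(nat \<Rightarrow> nat \<Rightarrow> real) \<Rightarrow> nat \<Rightarrow> real \<Rightarrow> real \<Rightarrow> real" where
  "bipoly_eval c d x y = (\<Sum>i\<le>d. \<Sum>j\<le>d - i. c i j * x ^ i * y ^ j)"

definition bipoly_nonzero :: "(nat \<Rightarrow> nat \<Rightarrow> real) \<Rightarrow> nat \<Rightarrow> bool" where
  "bipoly_nonzero c d \<longleftrightarrow> (\<exists>i j. i + j \<le> d \<and> c i j \<noteq> 0)"

definition alg_curve :: "(nat \<Rightarrow> nat \<Rightarrow> real) \<Rightarrow> nat \<Rightarrow> complex set" where
  "alg_curve c d = {z. bipoly_eval c d (Re z) (Im z) = 0}"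

end

theory Submission
  imports Defs "HOL-Computational_Algebra.Polynomial_Factorial" "HOL-Computational_Algebra.Fundamental_Theorem_Algebra"
begin

text \<open>
  Count the roots in \<open>\<Omega>\<close> of all integer polynomials with coefficients in \<open>{-M..M}\<close>.
  For fixed upper coefficients \<open>t\<close>, a nonreal \<open>z\<close> is a root for exactly one real pair
  \<open>(a\<^sub>0, a\<^sub>1)\<close>, and the map \<open>z \<mapsto> (a\<^sub>0, a\<^sub>1)\<close> has Jacobian \<open>\<bar>p'(z)\<bar>\<^sup>2 / \<bar>Im z\<bar>\<close>.  By the area
  formula the integral of the root count over the box \<open>[-T, T]\<^sup>n\<^sup>+\<^sup>1\<close> is \<open>T\<^sup>n\<^sup>+\<^sup>1\<close> times the integral of
  \<open>psi\<close> over \<open>\<Omega>\<close>.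

  Splitting the box, with \<open>T = M + 1/2\<close>, into unit cubes around the integer points, the error is
  controlled by the change of the lattice sum under a shift \<open>u\<close> with \<open>\<bar>u\<^sub>i\<bar> \<le> 1/2\<close>, made one
  coordinate at a time.  Fix all coefficients except two adjacent ones, \<open>s\<close> and \<open>r\<close>.  As \<open>r\<close>
  varies, the root count changes only at double roots or when a root crosses a boundary curve.
  Crossings satisfy a nonzero polynomial equation \<open>R(s, r) = 0\<close> of bounded degree, which a
  dimension count on the coordinate ring of the curve provides.  So for all but boundedly many
  \<open>s\<close> there are boundedly many jumps in \<open>r\<close>, and the error is \<open>O(M\<^sup>n)\<close>.

  Sorting polynomials by content passes to primitive ones, where \<open>\<zeta>(n+1)\<close> enters.
  Every nonreal algebraic number has two primitive minimal polynomials \<open>\<plusminus>p\<close>, and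
  the polynomials with a factor of degree at least 2 and a nonconstant cofactor number \<open>O(M\<^sup>n)\<close>,
  because heights are multiplicative up to a constant.
\<close>

section \<open>Elimination on an algebraic curve\<close>

text \<open>Adjacent coefficients are used because the two real unknowns at \<open>z ^ m\<close> and
  \<open>z ^ (m+1)\<close> can be solved for at every nonreal \<open>z\<close>: the determinant is
  \<open>|z|^(2m) * Im z\<close>. For exponents further apart the quotient of the two powers can be
  real off the real axis.

  The elimination has to produce a degree that depends only on \<open>n\<close> and the degree of
  the curve, never on its coefficients, because this degree ends up in the implied constant.

  The half in \<open>T = M + 1/2\<close> lets unit cubes about the integer points tile the box. For
  \<open>M = 0\<close> the only integer point is the zero polynomial, and this case alone bounds the
  integral of \<open>psi\<close> over \<Omega> by a constant in \<open>n\<close>, \<open>k\<close>,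
  \<open>d\<close>.

  Requiring a factor of degree at least 2 keeps a logarithm away. Products of two linear polynomials
  of height at most \<open>M\<close> number about \<open>M^2 log M\<close>, too many for
  \<open>n = 2\<close>, but all their roots are real. A nonreal root forces a factor of degree at
  least 2, and then the sum over the cofactors converges.\<close>

lemma homogeneous_system_nontrivial:
  fixes M :: "'e \<Rightarrow> 'i \<Rightarrow> real"
  assumes "finite I" "finite E" "card I < card E"
  shows "\<exists>r. (\<exists>e\<in>E. r e \<noteq> 0) \<and> (\<forall>i\<in>I. (\<Sum>e\<in>E. r e * M e i) = 0)"
  using assms
proof (induction I arbitrary: E M rule: finite_induct)
  case empty
  then have "E \<noteq> {}" by auto
  then show ?case by (intro exI[of _ "\<lambda>_. 1"]) auto
next
  case (insert i I)
  show ?case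
  proof (cases "\<forall>e\<in>E. M e i = 0")
    case True
    have "card I < card E" using insert by auto
    from insert.IH[OF insert.prems(1) this, of M] True show ?thesis by auto
  next
    case False
    then obtain e0 where e0: "e0 \<in> E" "M e0 i \<noteq> 0" by auto
    \<comment> \<open>Equation \<open>i\<close> is used to eliminate the unknown \<open>e0\<close>:
      one equation and one unknown go, so the strict inequality of cardinalities survives. The value
      \<open>r' e0\<close> below is the back substitution.\<close>
    define E' where "E' = E - {e0}"
    have E': "finite E'" "E = insert e0 E'" "e0 \<notin> E'" using e0 insert.prems by (auto simp: E'_def)
    have "card I < card E'" using insert.prems insert.hyps E' by auto
    from insert.IH[OF E'(1) this, of "\<lambda>e k. M e k - M e i / M e0 i * M e0 k"]
    obtain r where r: "\<exists>e\<in>E'. r e \<noteq> 0"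
      "\<And>k. k \<in> I \<Longrightarrow> (\<Sum>e\<in>E'. r e * (M e k - M e i / M e0 i * M e0 k)) = 0" by blast
    define r' where "r' = r(e0 := - (\<Sum>e\<in>E'. r e * M e i) / M e0 i)"
    have split: "(\<Sum>e\<in>E. r' e * M e k) = (\<Sum>e\<in>E'. r e * M e k) - (\<Sum>e\<in>E'. r e * M e i) / M e0 i * M e0 k" for k
    proof -
      have "(\<Sum>e\<in>E. r' e * M e k) = r' e0 * M e0 k + (\<Sum>e\<in>E'. r' e * M e k)"
        using E' by simp
      also have "(\<Sum>e\<in>E'. r' e * M e k) = (\<Sum>e\<in>E'. r e * M e k)"
        using E' by (intro sum.cong) (auto simp: r'_def)
      finally show ?thesis by (simp add: r'_def)
    qed
    have "(\<Sum>e\<in>E. r' e * M e k) = 0" if "k \<in> insert i I" for k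
    proof (cases "k = i")
      case True
      then show ?thesis unfolding split using e0 by simp
    next
      case False
      have "(\<Sum>e\<in>E'. r e * (M e k - M e i / M e0 i * M e0 k)) =
        (\<Sum>e\<in>E'. r e * M e k) - (\<Sum>e\<in>E'. r e * M e i) / M e0 i * M e0 k"
        by (simp add: algebra_simps sum_subtractf sum_distrib_left sum_divide_distrib)
      then show ?thesis unfolding split using r(2)[of k] that False by auto
    qed
    moreover have "\<exists>e\<in>E. r' e \<noteq> 0" using r(1) E' by (auto simp: r'_def)
    ultimately show ?thesis by blast
  qed
qed

text \<open>These are the real polynomial functions of total degree at most \<open>M\<close>,
  generated as sums of monomials. No coefficient array is kept: the dimension count only needs to
  treat the two rules.\<close>

inductive bideg :: "nat \<Rightarrow> (real \<Rightarrow> real \<Rightarrow> real) \<Rightarrow> bool" for M where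
  mono: "a + b \<le> M \<Longrightarrow> bideg M (\<lambda>x y. c * x ^ a * y ^ b)"
| add: "bideg M f \<Longrightarrow> bideg M g \<Longrightarrow> bideg M (\<lambda>x y. f x y + g x y)"

lemma bideg_const: "bideg M (\<lambda>x y. c)"
  using bideg.mono[of 0 0 M c] by simp

lemma bideg_sum: "(\<And>i. i \<in> A \<Longrightarrow> bideg M (f i)) \<Longrightarrow> bideg M (\<lambda>x y. \<Sum>i\<in>A. f i x y)"
  by (induction A rule: infinite_finite_induct) (auto intro: bideg_const bideg.add)

lemma bideg_le: "bideg M f \<Longrightarrow> M \<le> M' \<Longrightarrow> bideg M' f"
  by (induction rule: bideg.induct) (auto intro: bideg.intros)

lemma bideg_mult_mono: "bideg M f \<Longrightarrow> a + b \<le> M' \<Longrightarrow> bideg (M + M') (\<lambda>x y. f x y * (c * x ^ a * y ^ b))"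
proof (induction rule: bideg.induct)
  case (mono a' b' c')
  have "bideg (M + M') (\<lambda>x y. (c' * c) * x ^ (a' + a) * y ^ (b' + b))"
    using mono by (intro bideg.mono) auto
  then show ?case by (simp add: power_add mult_ac)
qed (auto simp: distrib_right intro: bideg.add)

lemma bideg_mult:
  assumes "bideg M f" "bideg M' g"
  shows "bideg (M + M') (\<lambda>x y. f x y * g x y)"
  using assms(2)
proof (induction rule: bideg.induct)
  case (mono a b c) with assms(1) show ?case by (rule bideg_mult_mono)
qed (auto simp: distrib_left intro: bideg.add)

lemma bideg_minus: "bideg M f \<Longrightarrow> bideg M (\<lambda>x y. - f x y)"
  using bideg_mult[OF bideg_const[of 0 "-1"]] by simp

lemma bideg_power: "bideg M f \<Longrightarrow> bideg (M * k) (\<lambda>x y. f x y ^ k)"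
proof (induction k)
  case (Suc k)
  then show ?case using bideg_mult[of M f "M * k" "\<lambda>x y. f x y ^ k"] by (simp add: add.commute)
qed (auto intro: bideg_const)

definition cdeg :: "nat \<Rightarrow> (real \<Rightarrow> real \<Rightarrow> complex) \<Rightarrow> bool" where
  "cdeg M F \<longleftrightarrow> bideg M (\<lambda>x y. Re (F x y)) \<and> bideg M (\<lambda>x y. Im (F x y))"

lemma cdeg_mult: "cdeg M F \<Longrightarrow> cdeg M' G \<Longrightarrow> cdeg (M + M') (\<lambda>x y. F x y * G x y)"
  using bideg.add[OF bideg_mult bideg_minus[OF bideg_mult]] bideg.add[OF bideg_mult bideg_mult]
  unfolding cdeg_def by fastforce

lemma cdeg_const: "cdeg M (\<lambda>x y. c)"
  unfolding cdeg_def by (auto intro: bideg_const)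

lemma cdeg_sum: "(\<And>i. i \<in> A \<Longrightarrow> cdeg M (F i)) \<Longrightarrow> cdeg M (\<lambda>x y. \<Sum>i\<in>A. F i x y)"
  unfolding cdeg_def by (auto intro: bideg_sum)

lemma cdeg_power: "cdeg M F \<Longrightarrow> cdeg (M * k) (\<lambda>x y. F x y ^ k)"
proof (induction k)
  case (Suc k)
  then show ?case using cdeg_mult[of M F "M * k" "\<lambda>x y. F x y ^ k"] by (simp add: add.commute)
qed (auto intro: cdeg_const)

lemma cdeg_le: "cdeg M F \<Longrightarrow> M \<le> M' \<Longrightarrow> cdeg M' F"
  unfolding cdeg_def by (auto intro: bideg_le)

lemma bideg_x: "bideg 1 (\<lambda>x y. x)" and bideg_y: "bideg 1 (\<lambda>x y. y)"
  using bideg.mono[of 1 0 1 1] bideg.mono[of 0 1 1 1] by simp_all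

lemma cdeg_Complex: "cdeg 1 Complex" and cdeg_cnj: "cdeg 1 (\<lambda>x y. cnj (Complex x y))"
  unfolding cdeg_def using bideg_minus[OF bideg_y] by (simp_all add: bideg_x bideg_y del: One_nat_def)

text \<open>Membership in the span of the monomials \<open>S\<close> inside the coordinate ring,
  tested only at the real points of the curve. The coefficients are the same for all points.\<close>

definition combination_on_curve ::
  "(nat \<Rightarrow> nat \<Rightarrow> real) \<Rightarrow> nat \<Rightarrow> (nat \<times> nat) set \<Rightarrow> (real \<Rightarrow> real \<Rightarrow> real) \<Rightarrow> bool" where
  "combination_on_curve c d S f \<longleftrightarrow> (\<exists>\<sigma>. \<forall>x y. bipoly_eval c d x y = 0 \<longrightarrow>
     f x y = (\<Sum>p\<in>S. \<sigma> p * x ^ fst p * y ^ snd p))"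

text \<open>Modulo \<open>c\<close>, every monomial reduces to monomials not divisible by the
  leading monomial of \<open>c\<close> in the graded lexicographic order.\<close>

lemma standard_monomials_span:
  assumes "bipoly_nonzero c d"
  shows "\<exists>S. finite S \<and> card S \<le> d * (M + 1) \<and> (\<forall>f. bideg M f \<longrightarrow> combination_on_curve c d S f)"
proof -
  define T where "T = {p. fst p + snd p \<le> d \<and> c (fst p) (snd p) \<noteq> 0}"
  have "T \<subseteq> {..d} \<times> {..d}" by (auto simp: T_def)
  then have finT: "finite T" by (rule finite_subset) auto
  have neT: "T \<noteq> {}" using assms by (force simp: T_def bipoly_nonzero_def)
  \<comment> \<open>The graded lexicographic order coded as a number: exponents in \<open>T\<close>
    are at most \<open>d\<close>, so the factor \<open>d + 1\<close> makes the total degree dominate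
    the exponent of \<open>x\<close>.\<close>
  define key where "key p = (fst p + snd p) * (d + 1) + fst p" for p :: "nat \<times> nat"
  obtain p0 where p0: "p0 \<in> T" "\<And>p. p \<in> T \<Longrightarrow> key p \<le> key p0"
    using Max_in[of "key ` T"] Max_ge[of "key ` T"] finT neT by fastforce
  define \<alpha> \<beta> where "\<alpha> = fst p0" and "\<beta> = snd p0"
  have ab: "\<alpha> + \<beta> \<le> d" "c \<alpha> \<beta> \<noteq> 0" using p0(1) by (auto simp: T_def \<alpha>_def \<beta>_def)
  have key_le: "i + j < \<alpha> + \<beta> \<or> (i + j = \<alpha> + \<beta> \<and> i < \<alpha>) \<or> (i = \<alpha> \<and> j = \<beta>)" if "i + j \<le> d" "c i j \<noteq> 0" for i j
  proof -
    have k: "(i + j) * (d + 1) + i \<le> (\<alpha> + \<beta>) * (d + 1) + \<alpha>"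
      using p0(2)[of "(i,j)"] that by (auto simp: T_def key_def \<alpha>_def \<beta>_def)
    have "i + j \<le> \<alpha> + \<beta>"
    proof (rule ccontr)
      assume "\<not> ?thesis"
      then have "(\<alpha> + \<beta> + 1) * (d + 1) \<le> (i + j) * (d + 1)" by (intro mult_right_mono) auto
      then show False using k ab(1) by simp
    qed
    then show ?thesis using k by (cases "i + j = \<alpha> + \<beta>") auto
  qed
  \<comment> \<open>The monomials of degree at most \<open>M\<close> not divisible by the leading
    one. They lie in two strips of widths \<alpha> and \<beta>, so their number is linear in
    \<open>M\<close> and not quadratic; this is what the later count of dimensions exploits.\<close>
  define S where "S = {p. fst p + snd p \<le> M \<and> (fst p < \<alpha> \<or> snd p < \<beta>)}"
  have S: "S \<subseteq> {..<\<alpha>} \<times> {..M} \<union> {..M} \<times> {..<\<beta>}" by (auto simp: S_def)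
  have finS: "finite S" by (rule finite_subset[OF S]) auto
  have "card S \<le> card ({..<\<alpha>} \<times> {..M} \<union> {..M} \<times> {..<\<beta>})"
    by (intro card_mono S) auto
  also have "\<dots> \<le> card ({..<\<alpha>} \<times> {..M}) + card ({..M} \<times> {..<\<beta>})" by (rule card_Un_le)
  also have "\<dots> = (\<alpha> + \<beta>) * (M + 1)" by (simp add: algebra_simps)
  also have "\<dots> \<le> d * (M + 1)" using ab by (intro mult_right_mono) auto
  finally have cardS: "card S \<le> d * (M + 1)" .
  define sp where "sp f \<longleftrightarrow> (\<exists>\<sigma>. \<forall>x y. bipoly_eval c d x y = 0 \<longrightarrow>
        f x y = (\<Sum>p\<in>S. \<sigma> p * x ^ fst p * y ^ snd p))" for f :: "real \<Rightarrow> real \<Rightarrow> real"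
  have sp_add: "sp (\<lambda>x y. f x y + g x y)" if "sp f" "sp g" for f g
  proof -
    from that obtain \<sigma> \<tau> where "\<forall>x y. bipoly_eval c d x y = 0 \<longrightarrow> f x y = (\<Sum>p\<in>S. \<sigma> p * x ^ fst p * y ^ snd p)"
      "\<forall>x y. bipoly_eval c d x y = 0 \<longrightarrow> g x y = (\<Sum>p\<in>S. \<tau> p * x ^ fst p * y ^ snd p)"
      unfolding sp_def by blast
    then show ?thesis unfolding sp_def
      by (intro exI[of _ "\<lambda>p. \<sigma> p + \<tau> p"]) (auto simp: distrib_right sum.distrib)
  qed
  have sp_scale: "sp (\<lambda>x y. k * f x y)" if "sp f" for f k
  proof -
    from that obtain \<sigma> where "\<forall>x y. bipoly_eval c d x y = 0 \<longrightarrow> f x y = (\<Sum>p\<in>S. \<sigma> p * x ^ fst p * y ^ snd p)"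
      unfolding sp_def by blast
    then show ?thesis unfolding sp_def
      by (intro exI[of _ "\<lambda>p. k * \<sigma> p"]) (auto simp: sum_distrib_left mult_ac)
  qed
  have sp_sum: "sp (\<lambda>x y. \<Sum>i\<in>A. f i x y)" if "\<And>i. i \<in> A \<Longrightarrow> sp (f i)" "finite A" for A :: "(nat \<times> nat) set" and f
    using that(2,1)
  proof (induction A rule: finite_induct)
    case empty
    show ?case unfolding sp_def by (intro exI[of _ "\<lambda>_. 0"]) auto
  next
    case (insert i A)
    then show ?case using sp_add[of "f i" "\<lambda>x y. \<Sum>i\<in>A. f i x y"] by simp
  qed
  have sp_cong: "sp f" if "sp g" "\<And>x y. bipoly_eval c d x y = 0 \<Longrightarrow> f x y = g x y" for f g
    using that unfolding sp_def by simp
  define P where "P = {p::nat\<times>nat. fst p + snd p \<le> d}"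
  have finP: "finite P" by (rule finite_subset[of _ "{..d} \<times> {..d}"]) (auto simp: P_def)
  have eval: "bipoly_eval c d x y = (\<Sum>p\<in>P. c (fst p) (snd p) * x ^ fst p * y ^ snd p)" for x y
  proof -
    have "P = Sigma {..d} (\<lambda>i. {..d - i})" by (auto simp: P_def)
    then show ?thesis unfolding bipoly_eval_def
      by (subst sum.Sigma) (auto simp: case_prod_beta)
  qed
  \<comment> \<open>Induction on the pair of total degree and exponent of \<open>x\<close>.
    Replacing the leading monomial by the other terms of the curve equation lowers this pair and
    never raises the degree, so the reduction stays below \<open>M\<close>.\<close>
  have spm: "sp (\<lambda>x y. x ^ a * y ^ b)" if "a + b \<le> M" for a b
    using that
  proof (induction "(a + b, a)" arbitrary: a b rule: wf_induct_rule[OF wf_lex_prod[OF wf_less wf_less]])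
    case (1 a b)
    note IH = 1(1)
    show ?case
    proof (cases "a < \<alpha> \<or> b < \<beta>")
      case True
      then have "(a, b) \<in> S" using 1 by (auto simp: S_def)
      then have "x ^ a * y ^ b = (\<Sum>p\<in>S. (if p = (a, b) then 1 else 0) * x ^ fst p * y ^ snd p)" for x y :: real
        using finS by (subst sum.remove[of _ "(a,b)"]) (auto intro!: sum.neutral)
      then show ?thesis unfolding sp_def by (intro exI[of _ "\<lambda>p. if p = (a, b) then 1 else 0"]) simp
    next
      case False
      then have le: "\<alpha> \<le> a" "\<beta> \<le> b" by auto
      \<comment> \<open>The term \<open>p\<close> of the curve equation, divided by minus the
        leading coefficient and multiplied by the monomial that lifts the leading monomial to
        \<open>x ^ a * y ^ b\<close>.\<close>
      define h where "h p = (\<lambda>x y::real. (- c (fst p) (snd p) / c \<alpha> \<beta>) * (x ^ (fst p + (a - \<alpha>)) * y ^ (snd p + (b - \<beta>))))" for p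
      have sph: "sp (h p)" if "p \<in> P - {p0}" for p
      proof (cases "c (fst p) (snd p) = 0")
        case True
        then show ?thesis unfolding sp_def h_def by (intro exI[of _ "\<lambda>_. 0"]) auto
      next
        case False
        obtain i j where p: "p = (i, j)" by force
        have "p \<noteq> (\<alpha>, \<beta>)" using that by (auto simp: \<alpha>_def \<beta>_def)
        then have lt: "i + j < \<alpha> + \<beta> \<or> i + j = \<alpha> + \<beta> \<and> i < \<alpha>"
          using key_le[of i j] that False by (auto simp: P_def p)
        have "sp (\<lambda>x y. x ^ (i + (a - \<alpha>)) * y ^ (j + (b - \<beta>)))"
          by (rule IH) (use lt le 1(2) in auto)
        from sp_scale[OF this, of "- c i j / c \<alpha> \<beta>"] show ?thesis unfolding h_def p by simp
      qed
      have "sp (\<lambda>x y. \<Sum>p\<in>P - {p0}. h p x y)" using finP sph by (intro sp_sum) auto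
      moreover have "x ^ a * y ^ b = (\<Sum>p\<in>P - {p0}. h p x y)" if "bipoly_eval c d x y = 0" for x y
      proof -
        define m where "m = x ^ (a - \<alpha>) * y ^ (b - \<beta>)"
        have "p0 \<in> P" using p0(1) by (auto simp: P_def T_def)
        then have "c \<alpha> \<beta> * x ^ \<alpha> * y ^ \<beta> + (\<Sum>p\<in>P - {p0}. c (fst p) (snd p) * x ^ fst p * y ^ snd p) = 0"
          using that finP unfolding eval by (subst (asm) sum.remove) (auto simp: \<alpha>_def \<beta>_def)
        then have e: "x ^ \<alpha> * y ^ \<beta> = (\<Sum>p\<in>P - {p0}. - c (fst p) (snd p) * x ^ fst p * y ^ snd p) / c \<alpha> \<beta>"
          using ab(2) by (simp add: field_simps sum_negf)
        have "x ^ a * y ^ b = (x ^ \<alpha> * y ^ \<beta>) * m"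
          using le by (simp add: m_def power_add[symmetric] mult_ac)
        also have "\<dots> = (\<Sum>p\<in>P - {p0}. h p x y)"
          unfolding e h_def m_def sum_divide_distrib sum_distrib_right
          by (intro sum.cong refl) (simp add: power_add mult_ac)
        finally show ?thesis .
      qed
      ultimately show ?thesis by (rule sp_cong)
    qed
  qed
  have sp_bideg: "sp f" if "bideg M f" for f
    using that
  proof (induction rule: bideg.induct)
    case (mono a b k)
    from sp_scale[OF spm[OF mono], of k] show ?case by (simp add: mult_ac)
  qed (rule sp_add)
  show ?thesis
    using finS cardS sp_bideg unfolding sp_def combination_on_curve_def[symmetric] by blast
qed

text \<open>These separate the two unknowns in \<open>s * z ^ m + t * z ^ (m+1)\<close>: after
  multiplication by \<open>cnj z ^ m\<close> the imaginary part loses the term with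
  \<open>s\<close>, after multiplication by \<open>cnj z ^ (m+1)\<close> the one with
  \<open>t\<close>. The surviving factor is, up to sign, \<open>|z|^(2m) * Im z\<close>.\<close>

lemma cnj_power_Im_mult:
  "Im (z ^ m * cnj z ^ (m+1)) = - (((Re z)\<^sup>2 + (Im z)\<^sup>2) ^ m * Im z)"
  "Im (z ^ (m+1) * cnj z ^ m) = ((Re z)\<^sup>2 + (Im z)\<^sup>2) ^ m * Im z"
  "Im (z ^ m * cnj z ^ m) = 0"
proof -
  define R where "R = ((Re z)\<^sup>2 + (Im z)\<^sup>2) ^ m"
  have *: "z ^ m * cnj z ^ m = of_real R"
    unfolding R_def power_mult_distrib[symmetric] complex_mult_cnj by simp
  have a: "z ^ m * cnj z ^ (m+1) = of_real R * cnj z" unfolding *[symmetric] by simp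
  have b: "z ^ (m+1) * cnj z ^ m = of_real R * z" unfolding *[symmetric] by simp
  show "Im (z ^ m * cnj z ^ (m+1)) = - (((Re z)\<^sup>2 + (Im z)\<^sup>2) ^ m * Im z)"
    unfolding a R_def[symmetric] by simp
  show "Im (z ^ (m+1) * cnj z ^ m) = ((Re z)\<^sup>2 + (Im z)\<^sup>2) ^ m * Im z"
    unfolding b R_def[symmetric] by simp
  show "Im (z ^ m * cnj z ^ m) = 0" unfolding * by simp
qed

text \<open>At a nonreal root on the curve, \<open>s = G2 / W\<close> and \<open>t = G1 / W\<close>,
  where numerators and denominator are polynomials of degree at most \<open>2 * n + 1\<close> in the
  real coordinates. Cleared of denominators, the \<open>D * D\<close> products
  \<open>s ^ e1 * t ^ e2\<close> live on the curve in degree at most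
  \<open>M = (2 * n + 1) * (2 * D)\<close>, where the span has dimension at most
  \<open>d * (M + 1)\<close>. This is linear in \<open>D\<close>, so for the chosen \<open>D\<close>
  the products outnumber the dimension and satisfy a linear relation, whose coefficients do not
  depend on \<open>z\<close>, \<open>s\<close> or \<open>t\<close>.\<close>

lemma curve_elimination:
  fixes n m d :: nat and c :: "nat \<Rightarrow> nat \<Rightarrow> real" and v :: "nat \<Rightarrow> real"
  assumes "bipoly_nonzero c d" "m + 1 \<le> n"
  defines "D \<equiv> 2 * d * (2 * n + 1) + d + 1"
  shows "\<exists>r :: nat \<Rightarrow> nat \<Rightarrow> real. (\<exists>e1<D. \<exists>e2<D. r e1 e2 \<noteq> 0) \<and>
    (\<forall>z s t. z \<in> alg_curve c d \<longrightarrow> Im z \<noteq> 0 \<longrightarrow>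
       (\<Sum>l\<in>{..n} - {m, m+1}. of_real (v l) * z ^ l) + of_real s * z ^ m + of_real t * z ^ (m+1) = 0 \<longrightarrow>
       (\<Sum>e1<D. \<Sum>e2<D. r e1 e2 * s ^ e1 * t ^ e2) = 0)"
proof -
  define M where "M = (2 * n + 1) * (2 * D)"
  obtain S where S: "finite S" "card S \<le> d * (M + 1)"
    "\<And>f. bideg M f \<Longrightarrow> combination_on_curve c d S f"
    using standard_monomials_span[OF assms(1), of M] by blast
  define g where "g z = (\<Sum>l\<in>{..n} - {m, m+1}. of_real (v l) * z ^ l)" for z :: complex
  define G1 where "G1 x y = - Im (g (Complex x y) * cnj (Complex x y) ^ m)" for x y
  define G2 where "G2 x y = Im (g (Complex x y) * cnj (Complex x y) ^ (m+1))" for x y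
  define W where "W x y = (x\<^sup>2 + y\<^sup>2) ^ m * y" for x y :: real
  \<comment> \<open>Padding with powers of \<open>W\<close> gives every product the same factor
    \<open>W ^ (2 * D)\<close>, which is cancelled at the end: \<open>W\<close> does not vanish off
    the real axis.\<close>
  define F where "F e x y = G2 x y ^ fst e * G1 x y ^ snd e * W x y ^ (2 * D - fst e - snd e)" for e x y
  have deg_g: "cdeg n (\<lambda>x y. g (Complex x y))" unfolding g_def
  proof (rule cdeg_sum)
    fix l assume "l \<in> {..n} - {m, m+1}"
    then show "cdeg n (\<lambda>x y. of_real (v l) * Complex x y ^ l)"
      using cdeg_le[OF cdeg_mult[OF cdeg_const[of 0 "of_real (v l)"] cdeg_power[OF cdeg_Complex, of l]], of n] by simp
  qed
  have deg_gc: "cdeg (2 * n + 1) (\<lambda>x y. g (Complex x y) * cnj (Complex x y) ^ k)" if "k \<le> n" for k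
    by (rule cdeg_le[OF cdeg_mult[OF deg_g cdeg_power[OF cdeg_cnj]]]) (use that in auto)
  have deg_Im: "bideg (2 * n + 1) (\<lambda>x y. Im (g (Complex x y) * cnj (Complex x y) ^ k))" if "k \<le> n" for k
    using deg_gc[OF that] unfolding cdeg_def by (rule conjunct2)
  have deg_G1: "bideg (2 * n + 1) G1"
    unfolding G1_def by (rule bideg_minus[OF deg_Im]) (use assms(2) in simp)
  have deg_G2: "bideg (2 * n + 1) G2"
    unfolding G2_def by (rule deg_Im[OF assms(2)])
  have "bideg 2 (\<lambda>x y. x\<^sup>2 + y\<^sup>2)"
    using bideg.add[OF bideg_power[OF bideg_x, of 2] bideg_power[OF bideg_y, of 2]] by simp
  then have deg_W: "bideg (2 * n + 1) W" unfolding W_def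
    by (rule bideg_le[OF bideg_mult[OF bideg_power[of 2] bideg_y]]) (use assms(2) in auto)
  have "\<exists>\<sigma>. \<forall>x y. bipoly_eval c d x y = 0 \<longrightarrow> F e x y = (\<Sum>p\<in>S. \<sigma> p * x ^ fst p * y ^ snd p)"
    if "e \<in> {..<D} \<times> {..<D}" for e
  proof (rule S(3)[unfolded combination_on_curve_def])
    have "bideg ((2*n+1) * fst e + (2*n+1) * snd e + (2*n+1) * (2 * D - fst e - snd e)) (F e)"
      unfolding F_def by (intro bideg_mult bideg_power deg_G1 deg_G2 deg_W)
    also have "(2*n+1) * fst e + (2*n+1) * snd e + (2*n+1) * (2 * D - fst e - snd e) = M"
    proof -
      have "fst e + snd e + (2 * D - fst e - snd e) = 2 * D" using that by auto
      then show ?thesis unfolding M_def by (metis distrib_left)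
    qed
    finally show "bideg M (F e)" .
  qed
  then have "\<forall>e. \<exists>\<sigma>. e \<in> {..<D} \<times> {..<D} \<longrightarrow> (\<forall>x y. bipoly_eval c d x y = 0 \<longrightarrow>
      F e x y = (\<Sum>p\<in>S. \<sigma> p * x ^ fst p * y ^ snd p))" by blast
  from choice[OF this] obtain \<sigma> where \<sigma>: "\<And>e x y. e \<in> {..<D} \<times> {..<D} \<Longrightarrow> bipoly_eval c d x y = 0 \<Longrightarrow>
      F e x y = (\<Sum>p\<in>S. \<sigma> e p * x ^ fst p * y ^ snd p)" by blast
  have "card S \<le> d * (M + 1)" by (rule S(2))
  also have "\<dots> < D * D" unfolding M_def
  proof -
    have "d * ((2 * n + 1) * (2 * D) + 1) = D * (2 * d * (2 * n + 1)) + d" by (simp add: algebra_simps)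
    also have "\<dots> < D * (2 * d * (2 * n + 1)) + D * (d + 1)" by (simp add: D_def)
    also have "\<dots> = D * D" by (subst (4) D_def) (simp add: algebra_simps)
    finally show "d * ((2 * n + 1) * (2 * D) + 1) < D * D" .
  qed
  finally have "card S < card ({..<D} \<times> {..<D})" by simp
  from homogeneous_system_nontrivial[OF S(1) _ this, of \<sigma>]
  obtain r where r: "\<exists>e\<in>{..<D} \<times> {..<D}. r e \<noteq> 0"
    "\<And>p. p \<in> S \<Longrightarrow> (\<Sum>e\<in>{..<D} \<times> {..<D}. r e * \<sigma> e p) = 0" by auto
  have "(\<Sum>e1<D. \<Sum>e2<D. r (e1, e2) * s ^ e1 * t ^ e2) = 0"
    if z: "z \<in> alg_curve c d" "Im z \<noteq> 0" and
      root: "g z + of_real s * z ^ m + of_real t * z ^ (m+1) = 0" for z s t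
  proof -
    define x y where "x = Re z" and "y = Im z"
    have zxy: "z = Complex x y" by (simp add: x_def y_def)
    have W0: "W x y \<noteq> 0" using z(2) by (auto simp: W_def x_def y_def)
    have gz: "g z = - (of_real s * z ^ m) - of_real t * z ^ (m+1)"
      using eq_neg_iff_add_eq_0[THEN iffD2, OF root[unfolded add.assoc]] by simp
    have gm: "g z * w = - (of_real s * (z ^ m * w)) - of_real t * (z ^ (m+1) * w)" for w
      unfolding gz by (simp add: algebra_simps)
    have Im_lin: "Im (- (of_real s * A) - of_real t * B) = - s * Im A - t * Im B" for A B by simp
    have G1: "G1 x y = t * W x y"
      unfolding G1_def zxy[symmetric] gm Im_lin cnj_power_Im_mult
      unfolding W_def x_def y_def by simp
    have G2: "G2 x y = s * W x y"
      unfolding G2_def zxy[symmetric] gm Im_lin cnj_power_Im_mult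
      unfolding W_def x_def y_def by simp
    have bz: "bipoly_eval c d x y = 0" using z(1) by (simp add: alg_curve_def x_def y_def)
    have "(\<Sum>e\<in>{..<D} \<times> {..<D}. r e * F e x y) =
      (\<Sum>e\<in>{..<D} \<times> {..<D}. \<Sum>p\<in>S. r e * \<sigma> e p * (x ^ fst p * y ^ snd p))"
      by (intro sum.cong refl) (simp add: \<sigma>[OF _ bz] sum_distrib_left mult_ac)
    also have "\<dots> = (\<Sum>p\<in>S. (\<Sum>e\<in>{..<D} \<times> {..<D}. r e * \<sigma> e p) * (x ^ fst p * y ^ snd p))"
      by (subst sum.swap) (simp add: sum_distrib_right)
    also have "\<dots> = 0" using r(2) by simp
    finally have "(\<Sum>e\<in>{..<D} \<times> {..<D}. r e * F e x y) = 0" .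
    moreover have "F e x y = s ^ fst e * t ^ snd e * W x y ^ (2 * D)" if "e \<in> {..<D} \<times> {..<D}" for e
    proof -
      have "fst e + snd e + (2 * D - fst e - snd e) = 2 * D" using that by auto
      then have "W x y ^ (2 * D) = W x y ^ fst e * W x y ^ snd e * W x y ^ (2 * D - fst e - snd e)"
        by (metis power_add)
      then show ?thesis unfolding F_def G1 G2 by (simp add: power_mult_distrib mult_ac)
    qed
    ultimately have "(\<Sum>e\<in>{..<D} \<times> {..<D}. r e * (s ^ fst e * t ^ snd e)) * W x y ^ (2 * D) = 0"
      by (simp add: sum_distrib_right mult.assoc)
    then have "(\<Sum>e\<in>{..<D} \<times> {..<D}. r e * (s ^ fst e * t ^ snd e)) = 0" using W0 by simp
    then show ?thesis by (subst sum.cartesian_product) (simp add: case_prod_beta mult.assoc)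
  qed
  then show ?thesis using r(1) unfolding g_def by (intro exI[of _ "\<lambda>e1 e2. r (e1, e2)"]) auto
qed

lemma power_sum_roots:
  fixes a :: "nat \<Rightarrow> real"
  assumes "e < D" "a e \<noteq> 0"
  shows "finite {s. (\<Sum>i<D. a i * s ^ i) = 0}" "card {s. (\<Sum>i<D. a i * s ^ i) = 0} \<le> D"
proof -
  define p where "p = (\<Sum>i<D. monom (a i) i)"
  have pe: "poly p s = (\<Sum>i<D. a i * s ^ i)" for s by (simp add: p_def poly_sum poly_monom)
  have "coeff p e = a e" using assms(1) by (simp add: p_def coeff_sum)
  then have p0: "p \<noteq> 0" using assms(2) by auto
  have "degree p \<le> D" unfolding p_def by (intro degree_sum_le) (auto intro: order.trans[OF degree_monom_le])
  then show "finite {s. (\<Sum>i<D. a i * s ^ i) = 0}" "card {s. (\<Sum>i<D. a i * s ^ i) = 0} \<le> D"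
    using poly_roots_finite[OF p0] card_poly_roots_bound[OF p0] by (auto simp: pe[symmetric])
qed

text \<open>The exceptional \<open>s\<close> are the zeros of the coefficient of
  \<open>t ^ e2\<close>, a nonzero polynomial in \<open>s\<close>. For every other \<open>s\<close>
  the polynomial in \<open>t\<close> is nonzero.\<close>

lemma bivariate_zeros_bound:
  fixes r :: "nat \<Rightarrow> nat \<Rightarrow> real"
  assumes "e1 < D" "e2 < D" "r e1 e2 \<noteq> 0"
  shows "\<exists>B. finite B \<and> card B \<le> D \<and> (\<forall>s. s \<notin> B \<longrightarrow> (\<exists>B'. finite B' \<and> card B' \<le> D \<and>
    (\<forall>t. (\<Sum>e1<D. \<Sum>e2<D. r e1 e2 * s ^ e1 * t ^ e2) = 0 \<longrightarrow> t \<in> B')))"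
proof (rule exI[of _ "{s. (\<Sum>i<D. r i e2 * s ^ i) = 0}"], intro conjI allI impI)
  fix s assume "s \<notin> {s. (\<Sum>i<D. r i e2 * s ^ i) = 0}"
  then have nz: "(\<Sum>i<D. r i e2 * s ^ i) \<noteq> 0" by simp
  have eq: "(\<Sum>e1<D. \<Sum>e2<D. r e1 e2 * s ^ e1 * t ^ e2) = (\<Sum>j<D. (\<Sum>i<D. r i j * s ^ i) * t ^ j)" for t
    by (subst sum.swap) (simp add: sum_distrib_right)
  show "\<exists>B'. finite B' \<and> card B' \<le> D \<and>
    (\<forall>t. (\<Sum>e1<D. \<Sum>e2<D. r e1 e2 * s ^ e1 * t ^ e2) = 0 \<longrightarrow> t \<in> B')"
    unfolding eq using power_sum_roots[OF assms(2), of "\<lambda>j. \<Sum>i<D. r i j * s ^ i", OF nz]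
    by (intro exI[of _ "{t. (\<Sum>j<D. (\<Sum>i<D. r i j * s ^ i) * t ^ j) = 0}"]) auto
qed (use power_sum_roots[OF assms(1), of "\<lambda>i. r i e2"] assms(3) in auto)

section \<open>Variation of the number of roots\<close>

definition real_cpoly :: "nat \<Rightarrow> (nat \<Rightarrow> real) \<Rightarrow> complex poly" where
  "real_cpoly n a = (\<Sum>i\<le>n. monom (of_real (a i)) i)"

lemma poly_real_cpoly: "poly (real_cpoly n a) z = (\<Sum>i\<le>n. of_real (a i) * z ^ i)"
  by (simp add: real_cpoly_def poly_sum poly_monom)

lemma coeff_real_cpoly: "coeff (real_cpoly n a) i = (if i \<le> n then of_real (a i) else 0)"
  by (simp add: real_cpoly_def coeff_sum)

lemma degree_real_cpoly_le: "degree (real_cpoly n a) \<le> n"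
  by (rule degree_le) (simp add: coeff_real_cpoly)

lemma degree_real_cpoly: "a n \<noteq> 0 \<Longrightarrow> degree (real_cpoly n a) = n"
  by (intro antisym degree_real_cpoly_le le_degree) (simp add: coeff_real_cpoly)

lemma real_cpoly_eq_0_iff: "real_cpoly n a = 0 \<longleftrightarrow> (\<forall>i\<le>n. a i = 0)"
  by (auto simp: poly_eq_iff coeff_real_cpoly)

lemma poly_real_cpoly_cnj: "poly (real_cpoly n a) (cnj z) = cnj (poly (real_cpoly n a) z)"
  by (simp add: poly_real_cpoly)

text \<open>Roots are counted without multiplicity. For the zero polynomial and a nonempty open
  \<Omega> the set is infinite, so \<open>card\<close> yields 0 and this polynomial drops out of
  every sum.\<close>

definition root_count :: "nat \<Rightarrow> complex set \<Rightarrow> (nat \<Rightarrow> real) \<Rightarrow> nat" where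
  "root_count n \<Omega> a = card {z \<in> \<Omega>. poly (real_cpoly n a) z = 0}"

lemma finite_roots: "real_cpoly n a \<noteq> 0 \<Longrightarrow> finite {z \<in> \<Omega>. poly (real_cpoly n a) z = 0}"
  by (rule finite_subset[OF _ poly_roots_finite[of "real_cpoly n a"]]) auto

lemma root_count_le:
  assumes "open \<Omega>"
  shows "root_count n \<Omega> a \<le> n"
proof (cases "real_cpoly n a = 0")
  case True
  have "\<Omega> = {} \<or> infinite \<Omega>" using assms finite_imp_not_open by blast
  then show ?thesis using True by (auto simp: root_count_def)
next
  case False
  then have "root_count n \<Omega> a \<le> card {z. poly (real_cpoly n a) z = 0}"
    unfolding root_count_def by (intro card_mono poly_roots_finite) auto
  also have "\<dots> \<le> n" using card_poly_roots_bound[OF False] degree_real_cpoly_le[of n a] by linarith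
  finally show ?thesis .
qed

text \<open>If all roots were at distance at least \<epsilon> from \<open>z\<close>, the
  factorisation into linear factors would make the value at least
  \<open>cmod (lead_coeff p) * \<epsilon> ^ degree p\<close>.\<close>

lemma root_near_small_value:
  fixes p :: "complex poly"
  assumes "p \<noteq> 0" "\<epsilon> > 0" "cmod (poly p z) < cmod (lead_coeff p) * \<epsilon> ^ degree p"
  shows "\<exists>w. poly p w = 0 \<and> dist z w < \<epsilon>"
proof (rule ccontr)
  assume no: "\<not> ?thesis"
  obtain root where root: "smult (lead_coeff p) (\<Prod>i<degree p. [:-root i, 1:]) = p"
    by (rule complex_poly_decompose')
  have pe: "poly p x = lead_coeff p * (\<Prod>i<degree p. x - root i)" for x
    by (subst root[symmetric]) (simp add: poly_prod del: root)
  have "\<epsilon> \<le> cmod (z - root i)" if "i < degree p" for i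
  proof -
    have "poly p (root i) = 0" using that by (subst pe) (auto simp: prod_zero_iff)
    then show ?thesis using no by (force simp: dist_norm)
  qed
  then have "(\<Prod>i<degree p. \<epsilon>) \<le> (\<Prod>i<degree p. cmod (z - root i))"
    using assms(2) by (intro prod_mono) auto
  then have "cmod (lead_coeff p) * \<epsilon> ^ degree p \<le> cmod (poly p z)"
    by (subst pe) (simp add: norm_mult prod_norm mult_left_mono)
  then show False using assms(3) by simp
qed

text \<open>\<open>root_near_small_value\<close> is applied to the perturbed polynomial at the old
  roots, where its value is of order \<delta>. Keeping half of the leading coefficient makes the
  threshold uniform. The claim follows old roots only; further roots of the perturbed polynomial are
  not controlled.\<close>

lemma roots_persist:
  assumes "a n \<noteq> 0" "\<epsilon> > 0"
  shows "\<exists>\<delta>>0. \<forall>a'. (\<forall>i\<le>n. \<bar>a' i - a i\<bar> < \<delta>) \<longrightarrow> a' n \<noteq> 0 \<and>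
    (\<forall>z. poly (real_cpoly n a) z = 0 \<longrightarrow> (\<exists>w. poly (real_cpoly n a') w = 0 \<and> dist z w < \<epsilon>))"
proof -
  define Z where "Z = {z. poly (real_cpoly n a) z = 0}"
  have "real_cpoly n a \<noteq> 0" using assms(1) by (auto simp: real_cpoly_eq_0_iff)
  then have finZ: "finite Z" unfolding Z_def by (rule poly_roots_finite)
  define B where "B = (\<Sum>z\<in>Z. \<Sum>i\<le>n. cmod z ^ i) + 1"
  have B: "B > 0" "\<And>z. z \<in> Z \<Longrightarrow> (\<Sum>i\<le>n. cmod z ^ i) < B"
  proof -
    show "B > 0" unfolding B_def by (intro add_nonneg_pos sum_nonneg) auto
    fix z assume "z \<in> Z"
    then have "(\<Sum>i\<le>n. cmod z ^ i) \<le> (\<Sum>z\<in>Z. \<Sum>i\<le>n. cmod z ^ i)"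
      using finZ by (intro member_le_sum) (auto intro: sum_nonneg)
    then show "(\<Sum>i\<le>n. cmod z ^ i) < B" by (simp add: B_def)
  qed
  define \<delta> where "\<delta> = min (\<bar>a n\<bar> / 2) (\<bar>a n\<bar> / 2 * \<epsilon> ^ n / B)"
  have \<delta>: "\<delta> > 0" "\<delta> \<le> \<bar>a n\<bar> / 2" "\<delta> * B \<le> \<bar>a n\<bar> / 2 * \<epsilon> ^ n"
    using assms B(1) by (auto simp: \<delta>_def min_def field_simps)
  show ?thesis
  proof (intro exI[of _ \<delta>] conjI allI impI \<delta>(1))
    fix a' assume a': "\<forall>i\<le>n. \<bar>a' i - a i\<bar> < \<delta>"
    then have an: "\<bar>a' n\<bar> \<ge> \<bar>a n\<bar> / 2" using \<delta>(2) by (auto dest!: spec[of _ n])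
    then show an0: "a' n \<noteq> 0" using assms(1) by auto
    fix z assume "poly (real_cpoly n a) z = 0"
    then have z: "z \<in> Z" by (simp add: Z_def)
    have "poly (real_cpoly n a') z = poly (real_cpoly n a') z - poly (real_cpoly n a) z"
      using z by (simp add: Z_def)
    also have "\<dots> = (\<Sum>i\<le>n. of_real (a' i - a i) * z ^ i)"
      by (simp add: poly_real_cpoly sum_subtractf[symmetric] algebra_simps)
    finally have "cmod (poly (real_cpoly n a') z) \<le> (\<Sum>i\<le>n. \<bar>a' i - a i\<bar> * cmod z ^ i)"
      by (simp only:) (rule order.trans[OF norm_sum], simp add: norm_mult norm_power del: of_real_diff)
    also have "\<dots> \<le> (\<Sum>i\<le>n. \<delta> * cmod z ^ i)"
      using a' by (intro sum_mono mult_right_mono) (auto intro: less_imp_le)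
    also have "\<dots> = \<delta> * (\<Sum>i\<le>n. cmod z ^ i)" by (simp add: sum_distrib_left)
    also have "\<dots> < \<delta> * B" using \<delta>(1) B(2)[OF z] by simp
    also have "\<dots> \<le> \<bar>a n\<bar> / 2 * \<epsilon> ^ n" by (rule \<delta>(3))
    also have "\<dots> \<le> \<bar>a' n\<bar> * \<epsilon> ^ n" using an assms(2) by (intro mult_right_mono) auto
    finally show "\<exists>w. poly (real_cpoly n a') w = 0 \<and> dist z w < \<epsilon>"
      using an0 assms(2)
      by (intro root_near_small_value) (auto simp: degree_real_cpoly coeff_real_cpoly real_cpoly_eq_0_iff)
  qed
qed

lemma finite_uniform_radius:
  assumes "finite Z" "\<And>z. z \<in> Z \<Longrightarrow> \<exists>e>0. P z e"
    "\<And>z e e'. P z e \<Longrightarrow> 0 < e' \<Longrightarrow> e' \<le> e \<Longrightarrow> P z e'"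
  shows "\<exists>e::real>0. \<forall>z\<in>Z. P z e"
  using assms(1,2)
proof (induction Z rule: finite_induct)
  case (insert z Z)
  obtain e1 where e1: "e1 > 0" "\<forall>z\<in>Z. P z e1" using insert by auto
  obtain e2 where e2: "e2 > 0" "P z e2" using insert.prems by blast
  show ?case using e1 e2 assms(3) by (intro exI[of _ "min e1 e2"]) auto
qed (auto intro: exI[of _ 1])

lemma finite_separation:
  fixes Z :: "'a :: metric_space set"
  assumes "finite Z"
  shows "\<exists>e>0. \<forall>z\<in>Z. \<forall>z'\<in>Z. z \<noteq> z' \<longrightarrow> 2 * e \<le> dist z z'"
proof (rule finite_uniform_radius[OF assms, of "\<lambda>z e. \<forall>z'\<in>Z. z \<noteq> z' \<longrightarrow> 2 * e \<le> dist z z'"])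
  fix z assume "z \<in> Z"
  obtain d where d: "d > 0" "\<forall>x\<in>Z. x \<noteq> z \<longrightarrow> d \<le> dist z x"
    using finite_set_avoid[OF assms] by blast
  then show "\<exists>e>0. \<forall>z'\<in>Z. z \<noteq> z' \<longrightarrow> 2 * e \<le> dist z z'"
    by (intro exI[of _ "d / 2"]) auto
next
  fix z and e e' :: real
  assume "\<forall>z'\<in>Z. z \<noteq> z' \<longrightarrow> 2 * e \<le> dist z z'" "e' \<le> e"
  then show "\<forall>z'\<in>Z. z \<noteq> z' \<longrightarrow> 2 * e' \<le> dist z z'" by (smt (verit))
qed

text \<open>Distinct roots inside \<Omega> move to distinct roots inside \<Omega>. The count may
  still grow, when a multiple root splits or a root enters through the frontier. This serves the
  measurability of the root count.\<close>

lemma root_count_lower_semicontinuous: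
  assumes "a n \<noteq> 0" "open \<Omega>"
  shows "\<exists>\<delta>>0. \<forall>a'. (\<forall>i\<le>n. \<bar>a' i - a i\<bar> < \<delta>) \<longrightarrow> root_count n \<Omega> a \<le> root_count n \<Omega> a'"
proof -
  define Z where "Z = {z\<in>\<Omega>. poly (real_cpoly n a) z = 0}"
  have "real_cpoly n a \<noteq> 0" using assms(1) by (auto simp: real_cpoly_eq_0_iff)
  then have finZ: "finite Z" unfolding Z_def by (rule finite_roots)
  obtain e1 where e1: "e1 > 0" "\<forall>z\<in>Z. \<forall>z'\<in>Z. z \<noteq> z' \<longrightarrow> 2 * e1 \<le> dist z z'"
    using finite_separation[OF finZ] by blast
  have "\<exists>e>0. \<forall>z\<in>Z. ball z e \<subseteq> \<Omega>"
    using assms(2) by (intro finite_uniform_radius[OF finZ, of "\<lambda>z e. ball z e \<subseteq> \<Omega>"])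
      (auto simp: Z_def open_contains_ball)
  then obtain e2 where e2: "e2 > 0" "\<forall>z\<in>Z. ball z e2 \<subseteq> \<Omega>" by blast
  obtain \<delta> where \<delta>: "\<delta> > 0" "\<And>a'. (\<forall>i\<le>n. \<bar>a' i - a i\<bar> < \<delta>) \<Longrightarrow> a' n \<noteq> 0 \<and>
    (\<forall>z. poly (real_cpoly n a) z = 0 \<longrightarrow> (\<exists>w. poly (real_cpoly n a') w = 0 \<and> dist z w < min e1 e2))"
    using roots_persist[of a n "min e1 e2"] assms(1) e1(1) e2(1) by auto
  show ?thesis
  proof (intro exI[of _ \<delta>] conjI allI impI \<delta>(1))
    fix a' assume a': "\<forall>i\<le>n. \<bar>a' i - a i\<bar> < \<delta>"
    define f where "f z = (SOME w. poly (real_cpoly n a') w = 0 \<and> dist z w < min e1 e2)" for z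
    have f: "poly (real_cpoly n a') (f z) = 0 \<and> dist z (f z) < min e1 e2" if "z \<in> Z" for z
      unfolding f_def by (rule someI_ex) (use \<delta>(2)[OF a'] that in \<open>auto simp: Z_def\<close>)
    have "inj_on f Z"
    proof (rule inj_onI, rule ccontr)
      fix x y assume xy: "x \<in> Z" "y \<in> Z" "f x = f y" "x \<noteq> y"
      have "dist x y \<le> dist x (f x) + dist y (f x)" by (rule dist_triangle2)
      then show False using f[of x] f[of y] xy e1(2) by fastforce
    qed
    moreover have "f ` Z \<subseteq> {z \<in> \<Omega>. poly (real_cpoly n a') z = 0}"
    proof safe
      fix z assume z: "z \<in> Z"
      show "f z \<in> \<Omega>" using f[OF z] e2(2) z by (auto simp: subset_iff)
      show "poly (real_cpoly n a') (f z) = 0" using f[OF z] by simp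
    qed
    moreover have "real_cpoly n a' \<noteq> 0" using \<delta>(2)[OF a'] by (auto simp: real_cpoly_eq_0_iff)
    ultimately show "root_count n \<Omega> a \<le> root_count n \<Omega> a'"
      unfolding root_count_def Z_def[symmetric] by (intro card_inj_on_le finite_roots)
  qed
qed

text \<open>With \<open>n\<close> distinct roots, the nearby roots found by
  \<open>roots_persist\<close> exhaust those of the perturbed polynomial, so there is a bijection. A
  root off the frontier stays on its side. Real roots need their own argument, because the frontier
  of \<Omega> may contain real points.\<close>

lemma root_count_locally_constant:
  assumes "a n \<noteq> 0" "open \<Omega>" "\<Omega> \<inter> \<real> = {}"
    and sqf: "rsquarefree (real_cpoly n a)"
    and front: "\<And>z. poly (real_cpoly n a) z = 0 \<Longrightarrow> z \<in> frontier \<Omega> \<Longrightarrow> z \<in> \<real>"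
  shows "\<exists>\<delta>>0. \<forall>a'. (\<forall>i\<le>n. \<bar>a' i - a i\<bar> < \<delta>) \<longrightarrow> root_count n \<Omega> a' = root_count n \<Omega> a"
proof -
  define Z where "Z = {z. poly (real_cpoly n a) z = 0}"
  have p0: "real_cpoly n a \<noteq> 0" using assms(1) by (auto simp: real_cpoly_eq_0_iff)
  then have finZ: "finite Z" unfolding Z_def by (rule poly_roots_finite)
  have cardZ: "card Z = n"
  proof -
    have "(\<Prod>z\<in>Z. [:-z, 1:] ^ order z (real_cpoly n a)) = (\<Prod>z\<in>Z. [:-z, 1:])"
      using sqf p0 by (intro prod.cong refl) (simp add: Z_def rsquarefree_root_order)
    then have "real_cpoly n a = smult (lead_coeff (real_cpoly n a)) (\<Prod>z\<in>Z. [:-z, 1:])"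
      using complex_poly_decompose[of "real_cpoly n a"] by (simp add: Z_def)
    then have "degree (real_cpoly n a) = degree (smult (lead_coeff (real_cpoly n a)) (\<Prod>z\<in>Z. [:-z, 1:]))"
      by simp
    also have "\<dots> = card Z" using p0 by (simp add: degree_prod_sum_eq)
    finally show ?thesis using degree_real_cpoly[of a n] assms(1) by simp
  qed
  obtain e1 where e1: "e1 > 0" "\<forall>z\<in>Z. \<forall>z'\<in>Z. z \<noteq> z' \<longrightarrow> 2 * e1 \<le> dist z z'"
    using finite_separation[OF finZ] by blast
  have "\<exists>e>0. \<forall>z\<in>Z. z \<notin> \<real> \<longrightarrow> ball z e \<subseteq> \<Omega> \<or> ball z e \<inter> \<Omega> = {}"
  proof (rule finite_uniform_radius[OF finZ])
    fix z assume z: "z \<in> Z"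
    show "\<exists>e>0. z \<notin> \<real> \<longrightarrow> ball z e \<subseteq> \<Omega> \<or> ball z e \<inter> \<Omega> = {}"
    proof (cases "z \<in> \<real>")
      case True
      then show ?thesis by (intro exI[of _ 1]) auto
    next
      case False
      then have nf: "z \<notin> frontier \<Omega>" using front z by (auto simp: Z_def)
      show ?thesis
      proof (cases "z \<in> \<Omega>")
        case True
        then show ?thesis using assms(2) by (auto simp: open_contains_ball)
      next
        case False
        then have "z \<notin> closure \<Omega>" using nf assms(2) by (auto simp: frontier_def interior_open)
        then obtain e where "e > 0" "ball z e \<subseteq> - closure \<Omega>"
          by (meson ComplI closed_closure open_Compl open_contains_ball)
        then show ?thesis using closure_subset by (intro exI[of _ e]) blast
      qed
    qed
  next
    fix z and e e' :: real
    assume h: "z \<notin> \<real> \<longrightarrow> ball z e \<subseteq> \<Omega> \<or> ball z e \<inter> \<Omega> = {}" "e' \<le> e"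
    have "ball z e' \<subseteq> ball z e" using h(2) by (rule subset_ball)
    then show "z \<notin> \<real> \<longrightarrow> ball z e' \<subseteq> \<Omega> \<or> ball z e' \<inter> \<Omega> = {}" using h(1) by blast
  qed
  then obtain e2 where e2: "e2 > 0" "\<And>z. z \<in> Z \<Longrightarrow> z \<notin> \<real> \<Longrightarrow> ball z e2 \<subseteq> \<Omega> \<or> ball z e2 \<inter> \<Omega> = {}" by blast
  obtain \<delta> where \<delta>: "\<delta> > 0" "\<And>a'. (\<forall>i\<le>n. \<bar>a' i - a i\<bar> < \<delta>) \<Longrightarrow> a' n \<noteq> 0 \<and>
    (\<forall>z. poly (real_cpoly n a) z = 0 \<longrightarrow> (\<exists>w. poly (real_cpoly n a') w = 0 \<and> dist z w < min e1 e2))"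
    using roots_persist[of a n "min e1 e2"] assms(1) e1(1) e2(1) by auto
  show ?thesis
  proof (intro exI[of _ \<delta>] conjI allI impI \<delta>(1))
    fix a' assume a': "\<forall>i\<le>n. \<bar>a' i - a i\<bar> < \<delta>"
    define Z' where "Z' = {z. poly (real_cpoly n a') z = 0}"
    have p'0: "real_cpoly n a' \<noteq> 0" using \<delta>(2)[OF a'] by (auto simp: real_cpoly_eq_0_iff)
    then have finZ': "finite Z'" unfolding Z'_def by (rule poly_roots_finite)
    define f where "f z = (SOME w. poly (real_cpoly n a') w = 0 \<and> dist z w < min e1 e2)" for z
    have f: "f z \<in> Z'" "dist z (f z) < e1" "dist z (f z) < e2" if "z \<in> Z" for z
    proof -
      have "poly (real_cpoly n a') (f z) = 0 \<and> dist z (f z) < min e1 e2"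
        unfolding f_def by (rule someI_ex) (use \<delta>(2)[OF a'] that in \<open>auto simp: Z_def\<close>)
      then show "f z \<in> Z'" "dist z (f z) < e1" "dist z (f z) < e2" by (auto simp: Z'_def)
    qed
    have sep: "x = y" if "x \<in> Z" "y \<in> Z" "dist x w < e1" "dist y w < e1" for x y w
      using dist_triangle2[of x y w] that e1(2) by fastforce
    have inj: "inj_on f Z"
      by (rule inj_onI) (metis f(2) sep)
    have "card Z' \<le> n" using card_poly_roots_bound[OF p'0] degree_real_cpoly_le[of n a'] by (simp add: Z'_def)
    then have img: "f ` Z = Z'"
      using card_image[OF inj] f(1) cardZ finZ' by (intro card_seteq) auto
    have uniq: "f z = w" if "z \<in> Z" "w \<in> Z'" "dist z w < e1" for z w
      using img that f(2) sep by (metis imageE)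
    have in_\<Omega>: "f z \<in> \<Omega> \<longleftrightarrow> z \<in> \<Omega>" if z: "z \<in> Z" for z
    proof (cases "z \<in> \<real>")
      case True
      then have cz: "cnj z = z" by (simp add: Reals_cnj_iff)
      \<comment> \<open>The perturbed polynomial has real coefficients, so the conjugate is a root
        close to the same real \<open>z\<close>. Only one root is that close, hence it is real and
        lies outside \<Omega>.\<close>
      have "cnj (f z) \<in> Z'" using f(1)[OF z] by (simp add: Z'_def poly_real_cpoly_cnj)
      moreover have "dist z (cnj (f z)) < e1"
        using f(2)[OF z] cz by (metis complex_cnj_diff complex_mod_cnj dist_norm)
      ultimately have "f z = cnj (f z)" using uniq z by blast
      then have "f z \<in> \<real>" by (simp add: Reals_cnj_iff)
      then show ?thesis using True assms(3) by blast
    next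
      case False
      have "f z \<in> ball z e2" "z \<in> ball z e2" using f(3)[OF z] e2(1) by auto
      then show ?thesis using e2(2)[OF z False] by blast
    qed
    have "f ` {z \<in> \<Omega>. poly (real_cpoly n a) z = 0} = {z \<in> \<Omega>. poly (real_cpoly n a') z = 0}"
    proof -
      have "{z \<in> \<Omega>. poly (real_cpoly n a) z = 0} = {z \<in> Z. f z \<in> \<Omega>}" using in_\<Omega> by (auto simp: Z_def)
      moreover have "{z \<in> \<Omega>. poly (real_cpoly n a') z = 0} = {w \<in> f ` Z. w \<in> \<Omega>}"
        unfolding img by (auto simp: Z'_def)
      ultimately show ?thesis by auto
    qed
    moreover have "inj_on f {z \<in> \<Omega>. poly (real_cpoly n a) z = 0}"
      by (rule inj_on_subset[OF inj]) (auto simp: Z_def)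
    note card_image[OF this]
    ultimately show "root_count n \<Omega> a' = root_count n \<Omega> a"
      unfolding root_count_def by simp
  qed
qed

text \<open>Setting the count to zero on the two coordinate hyperplanes makes it constant on the coordinate
  lines along which the polynomial always has a root at zero or never has full degree.\<close>

definition trunc_count :: "nat \<Rightarrow> complex set \<Rightarrow> (nat \<Rightarrow> real) \<Rightarrow> nat" where
  "trunc_count n \<Omega> a = (if a 0 = 0 \<or> a n = 0 then 0 else root_count n \<Omega> a)"

text \<open>Along the line the count can change only where a multiple root appears, where a nonreal
  root meets the frontier, or where the constant or leading coefficient vanishes. \<open>X\<close>
  covers the second kind; in the bound, \<open>n\<close> values of \<open>r\<close> are allotted to
  the first kind and one to the third.\<close>

lemma trunc_count_line:
  assumes "n \<ge> 1" "j \<le> n" "open \<Omega>" "\<Omega> \<inter> \<real> = {}"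
    and X: "finite X" "card X \<le> K"
      "\<And>r z. poly (real_cpoly n (v(j := r))) z = 0 \<Longrightarrow> z \<in> frontier \<Omega> \<Longrightarrow> z \<notin> \<real> \<Longrightarrow> r \<in> X"
  shows "\<exists>B. finite B \<and> card B \<le> K + n + 1 \<and> (\<forall>r1 r2. r1 \<le> r2 \<longrightarrow> {r1..r2} \<inter> B = {} \<longrightarrow>
     trunc_count n \<Omega> (v(j := r1)) = trunc_count n \<Omega> (v(j := r2)))"
proof (cases "(j \<noteq> 0 \<and> v 0 = 0) \<or> (j \<noteq> n \<and> v n = 0)")
  case True
  then have "trunc_count n \<Omega> (v(j := r)) = 0" for r by (auto simp: trunc_count_def)
  then show ?thesis by (intro exI[of _ "{}"]) auto
next
  case False
  define g where "g = real_cpoly n (v(j := 0))"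
  \<comment> \<open>A nonzero common root of \<open>g + r x^j\<close> and its derivative is a root
    of \<open>x g' - j g\<close>, from which \<open>r\<close> has cancelled; it is recovered as
    \<open>- g(z) / z^j\<close>. The polynomial \<open>h\<close> is nonzero because its coefficient
    at \<open>i\<close> is \<open>i - j\<close> times that of \<open>g\<close>, and \<open>g\<close>
    has a nonzero constant or leading coefficient at an index other than \<open>j\<close>.\<close>
  define h where "h = pCons 0 (pderiv g) - smult (of_nat j) g"
  have split: "real_cpoly n (v(j := r)) = g + monom (of_real r) j" for r
    using assms(2) by (auto simp: poly_eq_iff g_def coeff_real_cpoly)
  have coeff_h: "coeff h i = (of_nat i - of_nat j) * coeff g i" for i
    by (cases i) (simp_all add: h_def coeff_pCons coeff_pderiv algebra_simps)
  have h0: "h \<noteq> 0"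
  proof (cases "j = 0")
    case True
    then have "coeff h n \<noteq> 0" using False assms(1) by (simp add: coeff_h g_def coeff_real_cpoly)
    then show ?thesis by auto
  next
    case j: False
    then have "coeff h 0 \<noteq> 0" using False by (simp add: coeff_h g_def coeff_real_cpoly)
    then show ?thesis by auto
  qed
  have "degree h \<le> n" by (rule degree_le) (simp add: coeff_h g_def coeff_real_cpoly)
  then have H: "finite {z. poly h z = 0}" "card {z. poly h z = 0} \<le> n"
    using poly_roots_finite[OF h0] card_poly_roots_bound[OF h0] by auto
  define Y where "Y = (\<lambda>z. Re (- poly g z / z ^ j)) ` {z. poly h z = 0}"
  have Y: "finite Y" "card Y \<le> n" using H card_image_le[OF H(1)] by (auto simp: Y_def intro: order.trans)
  \<comment> \<open>The point 0 matters when \<open>j\<close> is 0 or \<open>n\<close>: then the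
    varied coefficient is one of the two that must not vanish.\<close>
  define B where "B = insert 0 (X \<union> Y)"
  have "card B \<le> K + n + 1"
    unfolding B_def using X(1,2) Y card_Un_le[of X Y] by (simp add: card_insert_if)
  moreover have "finite B" using X(1) Y(1) by (simp add: B_def)
  moreover have "trunc_count n \<Omega> (v(j := r1)) = trunc_count n \<Omega> (v(j := r2))"
    if r: "r1 \<le> r2" "{r1..r2} \<inter> B = {}" for r1 r2
  proof (rule connected_local_const[of "{r1..r2}" r1 r2 "\<lambda>r. trunc_count n \<Omega> (v(j := r))"])
    show "\<forall>a\<in>{r1..r2}. \<forall>\<^sub>F b in at a within {r1..r2}. trunc_count n \<Omega> (v(j := a)) = trunc_count n \<Omega> (v(j := b))"
    proof
      fix s assume s: "s \<in> {r1..r2}"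
      have nz: "(v(j := s')) 0 \<noteq> 0 \<and> (v(j := s')) n \<noteq> 0" if "s' \<in> {r1..r2}" for s'
        using False r(2) that by (auto simp: B_def)
      have "rsquarefree (real_cpoly n (v(j := s)))"
        unfolding rsquarefree_roots
      proof (intro allI notI)
        fix z assume z: "poly (real_cpoly n (v(j := s))) z = 0 \<and> poly (pderiv (real_cpoly n (v(j := s)))) z = 0"
        have z0: "z \<noteq> 0"
        proof
          assume "z = 0"
          then have "coeff (real_cpoly n (v(j := s))) 0 = 0" using z by (simp add: poly_0_coeff_0)
          then show False using nz[OF s] by (simp add: coeff_real_cpoly)
        qed
        have g1: "poly g z = - of_real s * z ^ j" using z unfolding split
          by (simp add: poly_monom add_eq_0_iff2)
        have "poly (pderiv g) z = - of_real s * of_nat j * z ^ (j - 1)" using z unfolding split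
          by (simp add: pderiv_add pderiv_monom poly_monom add_eq_0_iff2 mult_ac)
        note g2 = this
        have "poly h z = z * poly (pderiv g) z - of_nat j * poly g z" by (simp add: h_def)
        also have "\<dots> = 0" unfolding g1 g2 by (cases j) (simp_all add: algebra_simps)
        finally have "poly h z = 0" .
        moreover have "s = Re (- poly g z / z ^ j)" using z0 by (simp add: g1)
        ultimately have "s \<in> Y" unfolding Y_def by blast
        then show False using s r(2) by (auto simp: B_def)
      qed
      note sqf = this
      have "s \<notin> X" using s r(2) by (auto simp: B_def)
      then have front: "z \<in> \<real>" if "poly (real_cpoly n (v(j := s))) z = 0" "z \<in> frontier \<Omega>" for z
        using X(3)[OF that] by blast
      have "\<exists>\<delta>>0. \<forall>a'. (\<forall>i\<le>n. \<bar>a' i - (v(j := s)) i\<bar> < \<delta>) \<longrightarrow>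
          root_count n \<Omega> a' = root_count n \<Omega> (v(j := s))"
        by (rule root_count_locally_constant[OF conjunct2[OF nz[OF s]] assms(3,4) sqf front])
      then obtain \<delta> where \<delta>: "\<delta> > 0" "\<And>a'. (\<forall>i\<le>n. \<bar>a' i - (v(j := s)) i\<bar> < \<delta>) \<Longrightarrow>
          root_count n \<Omega> a' = root_count n \<Omega> (v(j := s))" by blast
      have "trunc_count n \<Omega> (v(j := s)) = trunc_count n \<Omega> (v(j := s'))" if "s' \<in> {r1..r2}" "dist s' s < \<delta>" for s'
        using \<delta>(2)[of "v(j := s')"] \<delta>(1) that nz[OF s] nz[OF that(1)] by (auto simp: trunc_count_def dist_real_def)
      then show "\<forall>\<^sub>F b in at s within {r1..r2}. trunc_count n \<Omega> (v(j := s)) = trunc_count n \<Omega> (v(j := b))"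
        unfolding eventually_at using \<delta>(1) by blast
    qed
  qed (use r in auto)
  ultimately show ?thesis by blast
qed

text \<open>Each of the \<open>k\<close> curves contributes at most \<open>D\<close> exceptional
  values of \<open>s\<close> and, for every other \<open>s\<close>, at most \<open>D\<close> values
  of \<open>r\<close> at which a nonreal root lies on it. The summand \<open>n + 1\<close> in
  \<open>K\<close> pays for the events of \<open>trunc_count_line\<close> that have nothing to do
  with the frontier.\<close>

lemma trunc_count_plane:
  fixes n k d :: nat and c :: "nat \<Rightarrow> nat \<Rightarrow> nat \<Rightarrow> real"
  assumes n: "n \<ge> 1" "i \<le> n" "j \<le> n" "i = j + 1 \<or> j = i + 1"
    and \<Omega>: "open \<Omega>" "\<Omega> \<inter> \<real> = {}" "frontier \<Omega> \<subseteq> (\<Union>i<k. alg_curve (c i) d)"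
    and c: "\<And>i. i < k \<Longrightarrow> bipoly_nonzero (c i) d"
  defines "D \<equiv> 2 * d * (2 * n + 1) + d + 1"
  defines "K \<equiv> k * D + n + 1"
  shows "\<exists>B. finite B \<and> card B \<le> K \<and> (\<forall>s. s \<notin> B \<longrightarrow> (\<exists>B'. finite B' \<and> card B' \<le> K \<and>
     (\<forall>r1 r2. r1 \<le> r2 \<longrightarrow> {r1..r2} \<inter> B' = {} \<longrightarrow>
     trunc_count n \<Omega> (v(i := s, j := r1)) = trunc_count n \<Omega> (v(i := s, j := r2)))))"
proof -
  define m where "m = min i j"
  have m: "m + 1 \<le> n" "{i, j} = {m, m + 1}" using n by (auto simp: m_def min_def)
  have root_split: "(\<Sum>l\<in>{..n} - {m, m+1}. of_real (v l) * z ^ l) + of_real ((v(i := s, j := r)) m) * z ^ m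
      + of_real ((v(i := s, j := r)) (m+1)) * z ^ (m+1) = poly (real_cpoly n (v(i := s, j := r))) z" for s r z
  proof -
    let ?w = "v(i := s, j := r)"
    have "poly (real_cpoly n ?w) z = (\<Sum>l\<in>{..n} - {m, m+1}. of_real (?w l) * z ^ l) + (\<Sum>l\<in>{m, m+1}. of_real (?w l) * z ^ l)"
      unfolding poly_real_cpoly using m(1) by (intro sum.subset_diff) auto
    moreover have "(\<Sum>l\<in>{..n} - {m, m+1}. of_real (?w l) * z ^ l) = (\<Sum>l\<in>{..n} - {m, m+1}. of_real (v l) * z ^ l)"
      using m(2) by (intro sum.cong refl) auto
    ultimately show ?thesis by (simp add: algebra_simps)
  qed
  define P where "P s l B' \<longleftrightarrow> finite B' \<and> card B' \<le> D \<and>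
      (\<forall>r z. poly (real_cpoly n (v(i := s, j := r))) z = 0 \<longrightarrow> z \<in> alg_curve (c l) d \<longrightarrow> Im z \<noteq> 0 \<longrightarrow> r \<in> B')"
    for s l B'
  have "\<exists>B. finite B \<and> card B \<le> D \<and> (\<forall>s. s \<notin> B \<longrightarrow> (\<exists>B'. P s l B'))"
    if l: "l < k" for l
  proof -
    obtain q e1 e2 where q: "e1 < D" "e2 < D" "q e1 e2 \<noteq> 0"
      "\<And>z s t. z \<in> alg_curve (c l) d \<Longrightarrow> Im z \<noteq> 0 \<Longrightarrow>
        (\<Sum>l\<in>{..n} - {m, m+1}. of_real (v l) * z ^ l) + of_real s * z ^ m + of_real t * z ^ (m+1) = 0 \<Longrightarrow>
       (\<Sum>e1<D. \<Sum>e2<D. q e1 e2 * s ^ e1 * t ^ e2) = 0"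
      using curve_elimination[OF c[OF l] m(1), of v] unfolding D_def by blast
    have vanish: "(\<Sum>e1<D. \<Sum>e2<D. q e1 e2 * (v(i := s, j := r)) m ^ e1 * (v(i := s, j := r)) (m+1) ^ e2) = 0"
      if "poly (real_cpoly n (v(i := s, j := r))) z = 0" "z \<in> alg_curve (c l) d" "Im z \<noteq> 0" for r z s
      using q(4)[OF that(2,3)] that(1) unfolding root_split[symmetric] by blast
    show ?thesis
    proof (cases "i < j")
      case True
      then have ij: "i = m" "j = m + 1" using n(4) by (auto simp: m_def)
      obtain B where B: "finite B" "card B \<le> D" "\<And>s. s \<notin> B \<Longrightarrow> \<exists>B'. finite B' \<and> card B' \<le> D \<and>
          (\<forall>t. (\<Sum>e1<D. \<Sum>e2<D. q e1 e2 * s ^ e1 * t ^ e2) = 0 \<longrightarrow> t \<in> B')"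
        using bivariate_zeros_bound[OF q(1,2), of q] q(3) by blast
      show ?thesis
      proof (rule exI[of _ B], intro conjI allI impI B(1,2))
        fix s assume "s \<notin> B"
        then obtain B' where B': "finite B'" "card B' \<le> D"
          "\<And>t. (\<Sum>e1<D. \<Sum>e2<D. q e1 e2 * s ^ e1 * t ^ e2) = 0 \<Longrightarrow> t \<in> B'" using B(3) by blast
        show "\<exists>B'. P s l B'" unfolding P_def
        proof (rule exI[of _ B'], intro conjI allI impI B'(1,2))
          fix r z assume "poly (real_cpoly n (v(i := s, j := r))) z = 0" "z \<in> alg_curve (c l) d" "Im z \<noteq> 0"
          from vanish[OF this] show "r \<in> B'" using ij by (intro B'(3)) simp
        qed
      qed
    next
      case False
      then have ij: "j = m" "i = m + 1" using n(4) by (auto simp: m_def)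
      \<comment> \<open>The eliminant lists the coefficient at exponent \<open>m\<close> first; here
        the coefficient held fixed sits at \<open>m + 1\<close>, so the variables are
        exchanged.\<close>
      define q' where "q' e1 e2 = q e2 e1" for e1 e2
      have sw: "(\<Sum>e1<D. \<Sum>e2<D. q' e1 e2 * s ^ e1 * t ^ e2) = (\<Sum>e1<D. \<Sum>e2<D. q e1 e2 * t ^ e1 * s ^ e2)" for s t
        by (subst sum.swap) (simp add: q'_def mult_ac)
      obtain B where B: "finite B" "card B \<le> D" "\<And>s. s \<notin> B \<Longrightarrow> \<exists>B'. finite B' \<and> card B' \<le> D \<and>
          (\<forall>t. (\<Sum>e1<D. \<Sum>e2<D. q' e1 e2 * s ^ e1 * t ^ e2) = 0 \<longrightarrow> t \<in> B')"
        using bivariate_zeros_bound[OF q(2,1), of q'] q(3) by (auto simp: q'_def)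
      show ?thesis
      proof (rule exI[of _ B], intro conjI allI impI B(1,2))
        fix s assume "s \<notin> B"
        then obtain B' where B': "finite B'" "card B' \<le> D"
          "\<And>t. (\<Sum>e1<D. \<Sum>e2<D. q' e1 e2 * s ^ e1 * t ^ e2) = 0 \<Longrightarrow> t \<in> B'" using B(3) by blast
        show "\<exists>B'. P s l B'" unfolding P_def
        proof (rule exI[of _ B'], intro conjI allI impI B'(1,2))
          fix r z assume "poly (real_cpoly n (v(i := s, j := r))) z = 0" "z \<in> alg_curve (c l) d" "Im z \<noteq> 0"
          from vanish[OF this] show "r \<in> B'" using ij by (intro B'(3)) (simp add: sw)
        qed
      qed
    qed
  qed
  then have "\<forall>l. \<exists>B. l < k \<longrightarrow> finite B \<and> card B \<le> D \<and> (\<forall>s. s \<notin> B \<longrightarrow> (\<exists>B'. P s l B'))" by blast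
  from choice[OF this] obtain B where B: "\<And>l. l < k \<Longrightarrow> finite (B l)" "\<And>l. l < k \<Longrightarrow> card (B l) \<le> D"
    "\<And>l s. l < k \<Longrightarrow> s \<notin> B l \<Longrightarrow> \<exists>B'. P s l B'" by blast
  have un: "finite (\<Union>l<k. A l) \<and> card (\<Union>l<k. A l) \<le> k * D" if "\<And>l. l < k \<Longrightarrow> finite (A l)" "\<And>l. l < k \<Longrightarrow> card (A l) \<le> D"
    for A :: "nat \<Rightarrow> real set"
  proof -
    have "card (\<Union>l<k. A l) \<le> (\<Sum>l<k. card (A l))" by (rule card_UN_le) auto
    also have "\<dots> \<le> (\<Sum>l<k. D)" using that(2) by (intro sum_mono) auto
    finally show ?thesis using that(1) by auto
  qed
  show ?thesis
  proof (rule exI[of _ "\<Union>l<k. B l"], intro conjI allI impI)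
    show "finite (\<Union>l<k. B l)" "card (\<Union>l<k. B l) \<le> K" using un[of B] B(1,2) by (auto simp: K_def)
    fix s assume s: "s \<notin> (\<Union>l<k. B l)"
    have "\<forall>l. \<exists>B'. l < k \<longrightarrow> P s l B'" using B(3)[of _ s] s by blast
    from choice[OF this] obtain B' where "\<And>l. l < k \<Longrightarrow> P s l (B' l)" by blast
    then have B': "\<And>l. l < k \<Longrightarrow> finite (B' l)" "\<And>l. l < k \<Longrightarrow> card (B' l) \<le> D"
      "\<And>l r z. l < k \<Longrightarrow> poly (real_cpoly n (v(i := s, j := r))) z = 0 \<Longrightarrow> z \<in> alg_curve (c l) d \<Longrightarrow> Im z \<noteq> 0 \<Longrightarrow> r \<in> B' l"
      unfolding P_def by blast+
    have "\<exists>B. finite B \<and> card B \<le> k * D + n + 1 \<and> (\<forall>r1 r2. r1 \<le> r2 \<longrightarrow> {r1..r2} \<inter> B = {} \<longrightarrow>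
     trunc_count n \<Omega> ((v(i := s))(j := r1)) = trunc_count n \<Omega> ((v(i := s))(j := r2)))"
    proof (rule trunc_count_line[OF n(1,3) \<Omega>(1,2), of "\<Union>l<k. B' l"])
      show "finite (\<Union>l<k. B' l)" "card (\<Union>l<k. B' l) \<le> k * D" using un[of B'] B'(1,2) by auto
      fix r z assume *: "poly (real_cpoly n (v(i := s, j := r))) z = 0" "z \<in> frontier \<Omega>" "z \<notin> \<real>"
      then have "Im z \<noteq> 0" by (simp add: complex_is_Real_iff)
      obtain l where "l < k" "z \<in> alg_curve (c l) d" using \<Omega>(3) *(2) by blast
      then show "r \<in> (\<Union>l<k. B' l)" using B'(3)[OF _ *(1)] \<open>Im z \<noteq> 0\<close> by blast
    qed
    then show "\<exists>B'. finite B' \<and> card B' \<le> K \<and> (\<forall>r1 r2. r1 \<le> r2 \<longrightarrow> {r1..r2} \<inter> B' = {} \<longrightarrow>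
      trunc_count n \<Omega> (v(i := s, j := r1)) = trunc_count n \<Omega> (v(i := s, j := r2)))"
      unfolding K_def .
  qed
qed

section \<open>Shifts of lattice sums\<close>

lemma sum_PiE_insert:
  assumes "i \<notin> R"
  shows "(\<Sum>a\<in>PiE (insert i R) S. f a) = (\<Sum>x\<in>S i. \<Sum>b\<in>PiE R S. f (b(i := x)))"
proof -
  have "(\<Sum>a\<in>PiE (insert i R) S. f a) = (\<Sum>p\<in>S i \<times> PiE R S. f ((snd p)(i := fst p)))"
    unfolding PiE_insert_eq
    by (subst sum.reindex) (use inj_combinator[OF assms] in \<open>auto simp: case_prod_beta\<close>)
  then show ?thesis by (simp add: sum.cartesian_product case_prod_beta)
qed

text \<open>This is what the lattice argument uses about root counts. Exceptional \<open>s\<close>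
  have to be allowed since the eliminant may vanish identically in \<open>r\<close> there. The same
  \<open>K\<close> serves all base points \<open>v\<close>, which makes the estimate
  uniform.\<close>

definition few_jumps :: "nat \<Rightarrow> nat \<Rightarrow> ((nat \<Rightarrow> real) \<Rightarrow> nat) \<Rightarrow> bool" where
  "few_jumps n K F \<longleftrightarrow> (\<forall>i\<le>n. \<forall>j\<le>n. \<forall>v. (i = j + 1 \<or> j = i + 1) \<longrightarrow>
     (\<exists>B. finite B \<and> card B \<le> K \<and> (\<forall>s. s \<notin> B \<longrightarrow> (\<exists>B'. finite B' \<and> card B' \<le> K \<and>
     (\<forall>r1 r2. r1 \<le> r2 \<longrightarrow> {r1..r2} \<inter> B' = {} \<longrightarrow> F (v(i := s, j := r1)) = F (v(i := s, j := r2)))))))"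

text \<open>As \<open>\<bar>t\<bar> \<le> 1/2\<close>, the segments from \<open>y\<close> to
  \<open>y + t\<close> are disjoint for different integers \<open>y\<close>, so each point of
  \<open>B\<close> spoils at most one \<open>y\<close>.\<close>

lemma integer_line_variation:
  fixes h :: "real \<Rightarrow> nat" and t :: real
  assumes "\<And>r. h r \<le> L" "\<bar>t\<bar> \<le> 1/2" "finite B" "card B \<le> K"
    and const: "\<And>r1 r2. r1 \<le> r2 \<Longrightarrow> {r1..r2} \<inter> B = {} \<Longrightarrow> h r1 = h r2"
  shows "(\<Sum>y\<in>{-int M..int M}. \<bar>real (h (of_int y + t)) - real (h (of_int y))\<bar>) \<le> real L * real K"
proof -
  define seg where "seg y = {min (of_int y) (of_int y + t)..max (of_int y) (of_int y + t)}" for y :: int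
  define Y where "Y = {y\<in>{-int M..int M}. seg y \<inter> B \<noteq> {}}"
  have zero: "h (of_int y + t) = h (of_int y)" if "seg y \<inter> B = {}" for y
    using const[of "min (of_int y) (of_int y + t)" "max (of_int y) (of_int y + t)"] that
    unfolding seg_def by (auto simp: min_def max_def split: if_splits)
  \<comment> \<open>The integer is recovered from any point of its segment by rounding towards it:
    down when \<open>t \<ge> 0\<close>, up otherwise.\<close>
  have "Y \<subseteq> (\<lambda>p. if t \<ge> 0 then \<lfloor>p\<rfloor> else \<lceil>p\<rceil>) ` B"
  proof
    fix y assume "y \<in> Y"
    then obtain p where p: "p \<in> B" "p \<in> seg y" by (auto simp: Y_def)
    have "(if t \<ge> 0 then \<lfloor>p\<rfloor> else \<lceil>p\<rceil>) = y"
    proof (cases "t \<ge> 0")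
      case True
      then have "of_int y \<le> p" "p < of_int y + 1" using p(2) assms(2) by (auto simp: seg_def)
      then have "\<lfloor>p\<rfloor> = y" by (rule floor_unique)
      then show ?thesis using True by simp
    next
      case False
      then have "of_int y - 1 < p" "p \<le> of_int y" using p(2) assms(2) by (auto simp: seg_def)
      then have "\<lceil>p\<rceil> = y" by (rule ceiling_unique)
      then show ?thesis using False by simp
    qed
    then show "y \<in> (\<lambda>p. if t \<ge> 0 then \<lfloor>p\<rfloor> else \<lceil>p\<rceil>) ` B" using p(1) by (intro image_eqI[of _ _ p]) auto
  qed
  then have "card Y \<le> card ((\<lambda>p. if t \<ge> 0 then \<lfloor>p\<rfloor> else \<lceil>p\<rceil>) ` B)"
    using assms(3) by (intro card_mono) auto
  also have "\<dots> \<le> card B" using assms(3) by (rule card_image_le)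
  finally have cY: "card Y \<le> K" using assms(4) by simp
  have "(\<Sum>y\<in>{-int M..int M}. \<bar>real (h (of_int y + t)) - real (h (of_int y))\<bar>)
      = (\<Sum>y\<in>Y. \<bar>real (h (of_int y + t)) - real (h (of_int y))\<bar>)"
    using zero by (intro sum.mono_neutral_right) (auto simp: Y_def)
  also have "\<dots> \<le> (\<Sum>y\<in>Y. real L)"
  proof (rule sum_mono)
    fix y
    have "real (h (of_int y + t)) \<le> real L" "real (h (of_int y)) \<le> real L" using assms(1) by simp_all
    then show "\<bar>real (h (of_int y + t)) - real (h (of_int y))\<bar> \<le> real L"
      using of_nat_0_le_iff[of "h (of_int y + t)"] of_nat_0_le_iff[of "h (of_int y)"] by linarith
  qed
  also have "\<dots> = real L * real (card Y)" by (simp add: mult.commute)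
  also have "\<dots> \<le> real L * real K" using cY by (intro mult_left_mono) auto
  finally show ?thesis .
qed

abbreviation int_grid :: "nat set \<Rightarrow> nat \<Rightarrow> (nat \<Rightarrow> int) set" where
  "int_grid I M \<equiv> PiE I (\<lambda>_. {-int M..int M})"

lemma card_int_grid: "finite I \<Longrightarrow> card (int_grid I M) = (2 * M + 1) ^ card I"
proof -
  assume "finite I"
  have "card {-int M..int M} = 2 * M + 1" by simp
  then show ?thesis using \<open>finite I\<close> by (simp add: card_PiE)
qed

text \<open>The grid is sliced into planes spanned by coordinate \<open>j\<close> and a neighbour
  \<open>i\<close>. In a plane, at most \<open>K\<close> rows are exceptional and get the trivial
  bound \<open>L * (2 * M + 1)\<close>; each of the at most \<open>2 * M + 1\<close> other rows
  varies by at most \<open>L * K\<close>. The two contributions are equal, hence the factor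
  2.\<close>

lemma grid_shift_one_coordinate:
  fixes F :: "(nat \<Rightarrow> real) \<Rightarrow> nat"
  assumes "few_jumps n K F" "\<And>w. F w \<le> L" "n \<ge> 1" "j \<le> n" "\<bar>t\<bar> \<le> 1/2"
    and local: "\<And>w w'. (\<And>i. i \<le> n \<Longrightarrow> w i = w' i) \<Longrightarrow> F w = F w'"
  shows "(\<Sum>a\<in>int_grid {..n} M. \<bar>real (F (\<lambda>l. of_int (a l) + (u(j := t)) l)) - real (F (\<lambda>l. of_int (a l) + (u(j := 0)) l))\<bar>)
    \<le> 2 * real K * real L * (2 * real M + 1) ^ n"
proof -
  \<comment> \<open>Any neighbour would do; the lower one exists except at \<open>j = 0\<close>,
    where \<open>n \<ge> 1\<close> supplies the upper one.\<close>
  define i where "i = (if j = 0 then 1 else j - 1)"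
  have i: "i \<le> n" "i = j + 1 \<or> j = i + 1" "i \<noteq> j" using assms(3,4) by (auto simp: i_def)
  define R where "R = {..n} - {i, j}"
  have R: "{..n} = insert i (insert j R)" "i \<notin> insert j R" "j \<notin> R" "finite R"
    using i assms(4) by (auto simp: R_def)
  have cR: "card R = n - 1" using i assms(4) by (simp add: R_def card_Diff_subset)
  let ?S = "{-int M..int M}"
  have cS: "real (card ?S) = 2 * real M + 1" by simp
  define f where "f a = \<bar>real (F (\<lambda>l. of_int (a l) + (u(j := t)) l)) - real (F (\<lambda>l. of_int (a l) + (u(j := 0)) l))\<bar>"
    for a :: "nat \<Rightarrow> int"
  have fL: "f a \<le> real L" for a
  proof -
    have "real (F (\<lambda>l. of_int (a l) + (u(j := t)) l)) \<le> real L" "real (F (\<lambda>l. of_int (a l) + (u(j := 0)) l)) \<le> real L"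
      using assms(2) by simp_all
    then show ?thesis unfolding f_def
      using of_nat_0_le_iff[of "F (\<lambda>l. of_int (a l) + (u(j := t)) l)"] of_nat_0_le_iff[of "F (\<lambda>l. of_int (a l) + (u(j := 0)) l)"] by linarith
  qed
  have plane: "(\<Sum>x\<in>?S. \<Sum>y\<in>?S. f (b(j := y, i := x))) \<le> 2 * real K * real L * (2 * real M + 1)" for b
  proof -
    define v where "v l = of_int (b l) + u l" for l
    have fe: "f (b(j := y, i := x)) = \<bar>real (F (v(i := of_int x + u i, j := of_int y + t))) - real (F (v(i := of_int x + u i, j := of_int y)))\<bar>"
      for x y
    proof -
      have "(\<lambda>l. of_int ((b(j := y, i := x)) l) + (u(j := t)) l) = v(i := of_int x + u i, j := of_int y + t)"
        "(\<lambda>l. of_int ((b(j := y, i := x)) l) + (u(j := 0)) l) = v(i := of_int x + u i, j := of_int y)"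
        using i(3) by (auto simp: v_def fun_eq_iff)
      then show ?thesis by (simp add: f_def)
    qed
    have "\<exists>B. finite B \<and> card B \<le> K \<and> (\<forall>s. s \<notin> B \<longrightarrow> (\<exists>B'. finite B' \<and> card B' \<le> K \<and>
      (\<forall>r1 r2. r1 \<le> r2 \<longrightarrow> {r1..r2} \<inter> B' = {} \<longrightarrow> F (v(i := s, j := r1)) = F (v(i := s, j := r2)))))"
      by (rule assms(1)[unfolded few_jumps_def, rule_format, OF i(1) assms(4) i(2)])
    then obtain B where B: "finite B" "card B \<le> K" "\<And>s. s \<notin> B \<Longrightarrow> \<exists>B'. finite B' \<and> card B' \<le> K \<and>
      (\<forall>r1 r2. r1 \<le> r2 \<longrightarrow> {r1..r2} \<inter> B' = {} \<longrightarrow> F (v(i := s, j := r1)) = F (v(i := s, j := r2)))"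
      by auto
    define X where "X = {x\<in>?S. of_int x + u i \<in> B}"
    have "card X \<le> card B"
      by (rule card_inj_on_le[of "\<lambda>x. of_int x + u i"]) (auto simp: X_def inj_on_def B(1))
    then have cX: "card X \<le> K" using B(2) by simp
    have row: "(\<Sum>y\<in>?S. f (b(j := y, i := x))) \<le> real L * real K" if "x \<in> ?S - X" for x
    proof -
      have "of_int x + u i \<notin> B" using that by (auto simp: X_def)
      from B(3)[OF this] obtain B' where B': "finite B'" "card B' \<le> K"
        "\<And>r1 r2. r1 \<le> r2 \<Longrightarrow> {r1..r2} \<inter> B' = {} \<Longrightarrow> F (v(i := of_int x + u i, j := r1)) = F (v(i := of_int x + u i, j := r2))"
        by blast
      show ?thesis unfolding fe
        by (rule integer_line_variation[of "\<lambda>r. F (v(i := of_int x + u i, j := r))", OF assms(2,5) B'])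
    qed
    have "(\<Sum>x\<in>?S. \<Sum>y\<in>?S. f (b(j := y, i := x))) =
      (\<Sum>x\<in>?S - X. \<Sum>y\<in>?S. f (b(j := y, i := x))) + (\<Sum>x\<in>X. \<Sum>y\<in>?S. f (b(j := y, i := x)))"
      by (rule sum.subset_diff) (auto simp: X_def)
    also have "\<dots> \<le> (\<Sum>x\<in>?S - X. real L * real K) + (\<Sum>x\<in>X. \<Sum>y\<in>?S. real L)"
      using row fL by (intro add_mono sum_mono) auto
    also have "\<dots> \<le> (2 * real M + 1) * (real L * real K) + real K * ((2 * real M + 1) * real L)"
    proof (rule add_mono)
      have "(\<Sum>x\<in>?S - X. real L * real K) \<le> (\<Sum>x\<in>?S. real L * real K)"
        by (intro sum_mono2) auto
      then show "(\<Sum>x\<in>?S - X. real L * real K) \<le> (2 * real M + 1) * (real L * real K)"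
        by (simp add: algebra_simps)
      have "(\<Sum>x\<in>X. \<Sum>y\<in>?S. real L) = real (card X) * ((2 * real M + 1) * real L)" by simp
      also have "\<dots> \<le> real K * ((2 * real M + 1) * real L)" using cX by (intro mult_right_mono) auto
      finally show "(\<Sum>x\<in>X. \<Sum>y\<in>?S. real L) \<le> real K * ((2 * real M + 1) * real L)" .
    qed
    also have "\<dots> = 2 * real K * real L * (2 * real M + 1)" by (simp add: algebra_simps)
    finally show ?thesis .
  qed
  have "(\<Sum>a\<in>int_grid {..n} M. f a) = (\<Sum>x\<in>?S. \<Sum>y\<in>?S. \<Sum>b\<in>int_grid R M. f (b(j := y, i := x)))"
    unfolding R(1) sum_PiE_insert[OF R(2)] sum_PiE_insert[OF R(3)] ..
  also have "\<dots> = (\<Sum>x\<in>?S. \<Sum>b\<in>int_grid R M. \<Sum>y\<in>?S. f (b(j := y, i := x)))"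
    by (intro sum.cong refl, rule sum.swap)
  also have "\<dots> = (\<Sum>b\<in>int_grid R M. \<Sum>x\<in>?S. \<Sum>y\<in>?S. f (b(j := y, i := x)))"
    by (rule sum.swap)
  also have "\<dots> \<le> (\<Sum>b\<in>int_grid R M. 2 * real K * real L * (2 * real M + 1))"
    by (intro sum_mono plane)
  also have "\<dots> = (2 * real M + 1) ^ (n - 1) * (2 * real K * real L * (2 * real M + 1))"
    using R(4) by (simp add: card_int_grid cR add.commute)
  also have "\<dots> = 2 * real K * real L * (2 * real M + 1) ^ n"
    using assms(3) by (cases n) (auto simp: algebra_simps)
  finally show ?thesis unfolding f_def .
qed

lemma grid_shift:
  fixes F :: "(nat \<Rightarrow> real) \<Rightarrow> nat"
  assumes "few_jumps n K F" "\<And>w. F w \<le> L" "n \<ge> 1" "\<And>i. i \<le> n \<Longrightarrow> \<bar>u i\<bar> \<le> 1/2"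
    and local: "\<And>w w'. (\<And>i. i \<le> n \<Longrightarrow> w i = w' i) \<Longrightarrow> F w = F w'"
  shows "\<bar>(\<Sum>a\<in>int_grid {..n} M. real (F (\<lambda>l. of_int (a l) + u l))) - (\<Sum>a\<in>int_grid {..n} M. real (F (\<lambda>l. of_int (a l))))\<bar>
    \<le> real (n + 1) * (2 * real K * real L * (2 * real M + 1) ^ n)"
proof -
  \<comment> \<open>Only the coordinates below \<open>j\<close> are shifted, so the total change
    telescopes into changes of a single coordinate.\<close>
  define U where "U j = (\<lambda>l. if l < j then u l else 0)" for j
  define A where "A j = (\<Sum>a\<in>int_grid {..n} M. real (F (\<lambda>l. of_int (a l) + U j l)))" for j
  have "\<bar>A (Suc j) - A j\<bar> \<le> 2 * real K * real L * (2 * real M + 1) ^ n" if "j \<le> n" for j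
  proof -
    have U: "U (Suc j) = (U j)(j := u j)" "U j = (U j)(j := 0)" by (auto simp: U_def fun_eq_iff)
    have "\<bar>A (Suc j) - A j\<bar> \<le> (\<Sum>a\<in>int_grid {..n} M. \<bar>real (F (\<lambda>l. of_int (a l) + U (Suc j) l)) - real (F (\<lambda>l. of_int (a l) + U j l))\<bar>)"
      unfolding A_def sum_subtractf[symmetric] by (rule sum_abs)
    also have "\<dots> \<le> 2 * real K * real L * (2 * real M + 1) ^ n"
      unfolding U(1) by (subst (2) U(2)) (intro grid_shift_one_coordinate assms that)
    finally show ?thesis .
  qed
  then have "(\<Sum>j\<le>n. \<bar>A (Suc j) - A j\<bar>) \<le> (\<Sum>j\<le>n. 2 * real K * real L * (2 * real M + 1) ^ n)"
    by (intro sum_mono) auto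
  moreover have "(\<Sum>j<Suc n. A (Suc j) - A j) = A (Suc n) - A 0" by (rule sum_lessThan_telescope)
  then have "\<bar>A (Suc n) - A 0\<bar> \<le> (\<Sum>j\<le>n. \<bar>A (Suc j) - A j\<bar>)"
    by (metis sum_abs lessThan_Suc_atMost)
  moreover have "A (Suc n) = (\<Sum>a\<in>int_grid {..n} M. real (F (\<lambda>l. of_int (a l) + u l)))"
    unfolding A_def by (intro sum.cong refl arg_cong[of _ _ real] local) (auto simp: U_def)
  moreover have "A 0 = (\<Sum>a\<in>int_grid {..n} M. real (F (\<lambda>l. of_int (a l))))"
    unfolding A_def by (simp add: U_def)
  ultimately show ?thesis by (simp add: algebra_simps)
qed

lemma card_grid_coordinate_fixed:
  assumes "i \<le> n"
  shows "card {a\<in>int_grid {..n} M. real_of_int (a i) + t = 0} \<le> (2 * M + 1) ^ n"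
proof -
  have "card {a\<in>int_grid {..n} M. real_of_int (a i) + t = 0} \<le> card (int_grid ({..n} - {i}) M)"
  proof (rule card_inj_on_le[of "\<lambda>a. restrict a ({..n} - {i})"])
    show "inj_on (\<lambda>a. restrict a ({..n} - {i})) {a\<in>int_grid {..n} M. real_of_int (a i) + t = 0}"
    proof (rule inj_onI)
      fix a b assume ab: "a \<in> {a\<in>int_grid {..n} M. real_of_int (a i) + t = 0}" "b \<in> {a\<in>int_grid {..n} M. real_of_int (a i) + t = 0}"
        "restrict a ({..n} - {i}) = restrict b ({..n} - {i})"
      have "real_of_int (a i) = real_of_int (b i)" using ab by auto
      then have "a i = b i" by simp
      moreover have "a l = b l" if "l \<in> {..n} - {i}" for l using fun_cong[OF ab(3), of l] that by simp
      ultimately have "a l = b l" if "l \<in> {..n}" for l using that by (cases "l = i") auto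
      then show "a = b" using ab(1,2) by (auto intro: PiE_ext)
    qed
    show "finite (int_grid ({..n} - {i}) M)" by (intro finite_PiE) auto
  qed (auto simp: PiE_iff restrict_def split: if_splits)
  also have "\<dots> = (2 * M + 1) ^ n" using assms by (subst card_int_grid) auto
  finally show ?thesis .
qed

text \<open>Here \<open>F\<close> is the truncated count and \<open>G\<close> the true one. They
  differ only where the first or last coordinate vanishes, and each of these hyperplanes meets a
  shifted grid in at most \<open>(2 * M + 1) ^ n\<close> points. The exchange is made for the
  shifted and for the unshifted sum, which gives \<open>4 * L\<close>.\<close>

lemma grid_shift_up_to_hyperplanes:
  fixes F G :: "(nat \<Rightarrow> real) \<Rightarrow> nat"
  assumes "few_jumps n K F" "\<And>w. F w \<le> G w" "\<And>w. G w \<le> L" "n \<ge> 1" "\<And>i. i \<le> n \<Longrightarrow> \<bar>u i\<bar> \<le> 1/2"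
    and local: "\<And>w w'. (\<And>i. i \<le> n \<Longrightarrow> w i = w' i) \<Longrightarrow> F w = F w'"
    and off: "\<And>w. w 0 \<noteq> 0 \<Longrightarrow> w n \<noteq> 0 \<Longrightarrow> F w = G w"
  shows "\<bar>(\<Sum>a\<in>int_grid {..n} M. real (G (\<lambda>l. of_int (a l) + u l))) - (\<Sum>a\<in>int_grid {..n} M. real (G (\<lambda>l. of_int (a l))))\<bar>
    \<le> (2 * real (n + 1) * real K * real L + 4 * real L) * (2 * real M + 1) ^ n"
proof -
  have diff: "\<bar>(\<Sum>a\<in>int_grid {..n} M. real (G (\<lambda>l. of_int (a l) + u l))) - (\<Sum>a\<in>int_grid {..n} M. real (F (\<lambda>l. of_int (a l) + u l)))\<bar>
    \<le> 2 * real L * (2 * real M + 1) ^ n" for u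
  proof -
    define H where "H i = {a\<in>int_grid {..n} M. real_of_int (a i) + u i = 0}" for i
    have fin: "finite (int_grid {..n} M)" by (intro finite_PiE) auto
    have "\<bar>(\<Sum>a\<in>int_grid {..n} M. real (G (\<lambda>l. of_int (a l) + u l))) - (\<Sum>a\<in>int_grid {..n} M. real (F (\<lambda>l. of_int (a l) + u l)))\<bar>
      \<le> (\<Sum>a\<in>int_grid {..n} M. \<bar>real (G (\<lambda>l. of_int (a l) + u l)) - real (F (\<lambda>l. of_int (a l) + u l))\<bar>)"
      unfolding sum_subtractf[symmetric] by (rule sum_abs)
    also have "\<dots> = (\<Sum>a\<in>H 0 \<union> H n. \<bar>real (G (\<lambda>l. of_int (a l) + u l)) - real (F (\<lambda>l. of_int (a l) + u l))\<bar>)"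
      using off fin by (intro sum.mono_neutral_right) (auto simp: H_def)
    also have "\<dots> \<le> (\<Sum>a\<in>H 0 \<union> H n. real L)"
    proof (rule sum_mono)
      fix a :: "nat \<Rightarrow> int"
      let ?w = "\<lambda>l. of_int (a l) + u l"
      have "real (F ?w) \<le> real (G ?w)" "real (G ?w) \<le> real L" using assms(2,3) by simp_all
      then show "\<bar>real (G ?w) - real (F ?w)\<bar> \<le> real L" by simp
    qed
    also have "\<dots> = real (card (H 0 \<union> H n)) * real L" by simp
    also have "\<dots> \<le> real (2 * (2 * M + 1) ^ n) * real L"
    proof (intro mult_right_mono of_nat_mono)
      have "card (H 0 \<union> H n) \<le> card (H 0) + card (H n)" by (rule card_Un_le)
      then show "card (H 0 \<union> H n) \<le> 2 * (2 * M + 1) ^ n"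
        using card_grid_coordinate_fixed[of 0 n M "u 0"] card_grid_coordinate_fixed[of n n M "u n"]
        unfolding H_def by simp
    qed simp
    finally show ?thesis by (simp add: algebra_simps)
  qed
  have FL: "F w \<le> L" for w using assms(2,3)[of w] by linarith
  have A: "\<bar>(\<Sum>a\<in>int_grid {..n} M. real (F (\<lambda>l. of_int (a l) + u l))) - (\<Sum>a\<in>int_grid {..n} M. real (F (\<lambda>l. of_int (a l))))\<bar>
    \<le> real (n + 1) * (2 * real K * real L * (2 * real M + 1) ^ n)"
    by (rule grid_shift[OF assms(1) FL assms(4,5) local]) auto
  show ?thesis
    using diff[of u] diff[of "\<lambda>_. 0"] A by (simp add: algebra_simps abs_le_iff)
qed

section \<open>The area formula\<close>

text \<open>Boundedness gives the image finite measure, so the change of variables, available for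
  finite integrals, can be read as an equality of extended nonnegative numbers.\<close>

lemma emeasure_injective_differentiable_image:
  fixes f :: "real^'n::{finite,wellorder} \<Rightarrow> real^'n::_"
  assumes S: "S \<in> sets borel"
    and der: "\<And>x. x \<in> S \<Longrightarrow> (f has_derivative f' x) (at x)"
    and inj: "inj_on f S" and bdd: "bounded (f ` S)"
  shows "f ` S \<in> sets lebesgue"
    "emeasure lebesgue (f ` S) = (\<integral>\<^sup>+x. indicator S x * ennreal \<bar>det (matrix (f' x))\<bar> \<partial>lborel)"
proof -
  have S': "S \<in> sets lebesgue" using S by simp
  have der': "\<And>x. x \<in> S \<Longrightarrow> (f has_derivative f' x) (at x within S)"
    using der has_derivative_at_withinI by blast
  have "f differentiable_on S" unfolding differentiable_on_def differentiable_def using der' by blast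
  then show *: "f ` S \<in> sets lebesgue"
    by (intro differentiable_image_in_sets_lebesgue S') auto
  then have lm: "f ` S \<in> lmeasurable" using bdd by (intro bounded_set_imp_lmeasurable)
  then have "((\<lambda>x. \<bar>det (matrix (f' x))\<bar>) has_integral measure lebesgue (f ` S)) S"
    using has_measure_differentiable_image[OF S' der' inj] by blast
  from nn_integral_has_integral_lebesgue[OF _ this]
  have "(\<integral>\<^sup>+x. ennreal (indicator S x * \<bar>det (matrix (f' x))\<bar>) \<partial>lborel) = ennreal (measure lebesgue (f ` S))"
    by simp
  also have "\<dots> = emeasure lebesgue (f ` S)" using lm by (intro emeasure_eq_measure2[symmetric] fmeasurableD2)
  finally show "emeasure lebesgue (f ` S) = (\<integral>\<^sup>+x. indicator S x * ennreal \<bar>det (matrix (f' x))\<bar> \<partial>lborel)"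
    by (simp add: ennreal_mult' ennreal_indicator)
qed

text \<open>A countable subcover exists by the Lindelof property; subtracting from each member the
  earlier ones makes it disjoint while keeping injectivity.\<close>

lemma countable_injective_partition:
  fixes V :: "'a :: second_countable_topology set" and f :: "'a \<Rightarrow> 'b"
  assumes "\<And>x. x \<in> V \<Longrightarrow> \<exists>W. open W \<and> x \<in> W \<and> W \<subseteq> V \<and> inj_on f W"
  shows "\<exists>S :: nat \<Rightarrow> 'a set. disjoint_family S \<and> (\<Union>i. S i) = V \<and> (\<forall>i. S i \<in> sets borel \<and> inj_on f (S i))"
proof -
  define \<F> where "\<F> = {W. open W \<and> W \<subseteq> V \<and> inj_on f W}"
  obtain \<F>' where F': "\<F>' \<subseteq> \<F>" "countable \<F>'" "\<Union>\<F>' = \<Union>\<F>"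
    using Lindelof[of \<F>] by (auto simp: \<F>_def)
  define \<G> where "\<G> = insert {} \<F>'"
  have G: "\<G> \<noteq> {}" "countable \<G>" "\<Union>\<G> = V" "\<And>W. W \<in> \<G> \<Longrightarrow> open W \<and> inj_on f W"
  proof -
    have "\<Union>\<F> = V" using assms by (auto simp: \<F>_def)
    then show "\<Union>\<G> = V" using F'(3) by (simp add: \<G>_def)
  qed (use F'(1,2) in \<open>auto simp: \<G>_def \<F>_def\<close>)
  define W where "W = from_nat_into \<G>"
  have W: "open (W i)" "inj_on f (W i)" for i using G(4)[OF from_nat_into[OF G(1), of i]] by (auto simp: W_def)
  have UW: "(\<Union>i. W i) = V" unfolding W_def using range_from_nat_into[OF G(1,2)] G(3) by simp
  have "disjointed W i \<in> sets borel" for i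
    using sets.range_disjointed_sets[of W borel] W(1) by (auto simp: image_subset_iff)
  moreover have "inj_on f (disjointed W i)" for i
    by (rule inj_on_subset[OF W(2) disjointed_subset])
  ultimately show ?thesis
    using disjoint_family_disjointed[of W] UN_disjointed_eq[of W] UW by blast
qed

text \<open>The noncritical points are cut into countably many Borel pieces on which
  \<open>f\<close> is injective, and the change of variables is summed over the pieces. Critical
  values form a null set by Sard's theorem, which is why \<open>N\<close> is tied to the fibres only
  away from them. This leaves room for the zero polynomial, whose fibre is all of \<Omega>.\<close>

lemma area_formula:
  fixes f :: "real^'n::{finite,wellorder} \<Rightarrow> real^'n::_" and N :: "real^'n::{finite,wellorder} \<Rightarrow> nat"
  assumes U: "open U"
    and der: "\<And>x. x \<in> U \<Longrightarrow> (f has_derivative f' x) (at x)"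
    and J: "\<And>x. x \<in> U \<Longrightarrow> \<bar>det (matrix (f' x))\<bar> = J x" and contJ: "continuous_on U J"
    and inj: "\<And>x. x \<in> U \<Longrightarrow> J x \<noteq> 0 \<Longrightarrow> \<exists>W. open W \<and> x \<in> W \<and> inj_on f W"
    and B: "B \<in> sets borel" "bounded B"
    and count: "\<And>w. w \<notin> f ` {x\<in>U. J x = 0} \<Longrightarrow> finite {x\<in>U. f x = w} \<and> N w = card {x\<in>U. f x = w}"
  shows "(\<integral>\<^sup>+w. indicator B w * ennreal (real (N w)) \<partial>lborel) =
    (\<integral>\<^sup>+x. indicator U x * indicator B (f x) * ennreal (J x) \<partial>lborel)"
proof -
  define V where "V = {x\<in>U. J x \<noteq> 0}"
  have "openin (top_of_set U) (U \<inter> J -` (- {0}))"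
    by (rule continuous_openin_preimage_gen[OF contJ]) auto
  then have openV: "open V" using U unfolding V_def
    by (simp add: openin_open_eq vimage_def Int_def)
  have loc_inj: "\<exists>W. open W \<and> x \<in> W \<and> W \<subseteq> V \<and> inj_on f W" if x: "x \<in> V" for x
  proof -
    obtain W where W: "open W" "x \<in> W" "inj_on f W" using inj x by (auto simp: V_def)
    then show ?thesis using openV x by (intro exI[of _ "W \<inter> V"]) (auto intro: inj_on_subset)
  qed
  have "\<exists>S :: nat \<Rightarrow> _ set. disjoint_family S \<and> (\<Union>i. S i) = V \<and> (\<forall>i. S i \<in> sets borel \<and> inj_on f (S i))"
    by (rule countable_injective_partition) (rule loc_inj)
  then obtain S where "disjoint_family S \<and> (\<Union>i::nat. S i) = V \<and> (\<forall>i. S i \<in> sets borel \<and> inj_on f (S i))"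
    by (rule exE)
  then have S: "disjoint_family S" "(\<Union>i. S i) = V" "\<And>i. S i \<in> sets borel" "\<And>i. inj_on f (S i)"
    by simp_all
  have SV: "S i \<subseteq> V" for i using S(2) by blast
  have VU: "V \<subseteq> U" by (auto simp: V_def)
  have contf: "continuous_on U f"
    using der by (intro continuous_at_imp_continuous_on ballI) (auto intro: has_derivative_continuous)
  define fb where "fb x = indicator U x *\<^sub>R f x" for x
  have fb[measurable]: "fb \<in> borel_measurable borel"
    unfolding fb_def[abs_def] using U contf by (intro borel_measurable_continuous_on_indicator) auto
  define T where "T i = {x\<in>S i. f x \<in> B}" for i
  have T_eq: "T i = S i \<inter> (fb -` B \<inter> space borel)" for i
    using SV[of i] VU by (auto simp: T_def fb_def)
  have Tb[measurable]: "T i \<in> sets borel" for i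
    unfolding T_eq using S(3) by (intro sets.Int measurable_sets[OF fb B(1)])
  have TV: "T i \<subseteq> V" for i using SV by (auto simp: T_def)
  have Tinj: "inj_on f (T i)" for i using S(4) by (rule inj_on_subset) (auto simp: T_def)
  have Tder: "\<And>x. x \<in> T i \<Longrightarrow> (f has_derivative f' x) (at x)" for i using TV VU der by blast
  have Tbdd: "bounded (f ` T i)" for i by (rule bounded_subset[OF B(2)]) (auto simp: T_def)
  have img: "f ` T i \<in> sets lebesgue"
    "emeasure lebesgue (f ` T i) = (\<integral>\<^sup>+x. indicator (T i) x * ennreal \<bar>det (matrix (f' x))\<bar> \<partial>lborel)" for i
    by (rule emeasure_injective_differentiable_image[OF Tb _ Tinj Tbdd], erule Tder)+
  define Jb where "Jb x = indicator U x *\<^sub>R J x" for x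
  have Jb[measurable]: "Jb \<in> borel_measurable borel"
    unfolding Jb_def[abs_def] using U contJ by (intro borel_measurable_continuous_on_indicator) auto
  have J0: "J x \<ge> 0" if "x \<in> U" for x using J[OF that] by auto
  have imgJ: "emeasure lebesgue (f ` T i) = (\<integral>\<^sup>+x. indicator (T i) x * ennreal (Jb x) \<partial>lborel)" for i
    unfolding img(2)
  proof (rule nn_integral_cong)
    fix x
    show "indicator (T i) x * ennreal \<bar>det (matrix (f' x))\<bar> = indicator (T i) x * ennreal (Jb x)"
      using TV[of i] VU J[of x] by (auto simp: indicator_def Jb_def)
  qed
  have Tdisj: "disjoint_family T" using S(1) unfolding disjoint_family_on_def T_def by blast
  have sum_ind: "(\<Sum>i. indicator (T i) x * ennreal (Jb x)) = indicator U x * indicator B (f x) * ennreal (J x)" for x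
  proof -
    have "(\<Sum>i. indicator (T i) x * ennreal (Jb x)) = (\<Sum>i. indicator (T i) x) * ennreal (Jb x)"
      by (rule ennreal_suminf_multc)
    also have "(\<Sum>i. indicator (T i) x :: ennreal) = indicator (\<Union>i. T i) x"
      by (rule suminf_indicator[OF Tdisj])
    also have "(\<Union>i. T i) = {x\<in>V. f x \<in> B}" using S(2) by (auto simp: T_def)
    also have "indicator {x\<in>V. f x \<in> B} x * ennreal (Jb x) = indicator U x * indicator B (f x) * ennreal (J x)"
      by (auto simp: indicator_def V_def Jb_def)
    finally show ?thesis .
  qed
  have crit: "negligible (f ` {x\<in>U. J x = 0})"
  proof (rule baby_Sard[where f' = f'])
    fix x assume x: "x \<in> {x\<in>U. J x = 0}"
    show "(f has_derivative f' x) (at x within {x\<in>U. J x = 0})"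
      using der x has_derivative_at_withinI by blast
    show "rank (matrix (f' x)) < CARD('n)"
      using J[of x] x unfolding det_eq_0_rank[symmetric] by auto
  qed simp
  then have AE_nc: "AE w in lebesgue. w \<notin> f ` {x\<in>U. J x = 0}"
    by (simp add: AE_not_in negligible_iff_null_sets)
  have counting: "indicator B w * ennreal (real (N w)) = (\<Sum>i. indicator (f ` T i) w)"
    if w: "w \<notin> f ` {x\<in>U. J x = 0}" for w
  proof (cases "w \<in> B")
    case False
    then have "w \<notin> f ` T i" for i by (auto simp: T_def)
    then show ?thesis using False by simp
  next
    case True
    define X where "X = {x\<in>U. f x = w}"
    have X: "finite X" "N w = card X" using count[OF w] by (auto simp: X_def)
    have "X \<subseteq> V" using w by (auto simp: X_def V_def)
    \<comment> \<open>Every point of the fibre lies in exactly one piece and no piece holds two of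
      them, so the number of images containing \<open>w\<close> is the size of the fibre.\<close>
    then have "\<forall>x. \<exists>i. x \<in> X \<longrightarrow> x \<in> S i" using S(2) by blast
    from choice[OF this] obtain idx where idx: "\<And>x. x \<in> X \<Longrightarrow> x \<in> S (idx x)" by blast
    have inj: "inj_on idx X"
    proof (rule inj_onI)
      fix x y assume "x \<in> X" "y \<in> X" "idx x = idx y"
      then show "x = y" using idx[of x] idx[of y] S(4)[of "idx x"] by (auto simp: X_def dest: inj_onD)
    qed
    have ind: "indicator (f ` T i) w = (if i \<in> idx ` X then 1 else 0 :: ennreal)" for i
    proof (cases "i \<in> idx ` X")
      case True
      then obtain x where x: "x \<in> X" "i = idx x" by blast
      then have "x \<in> T i" "f x = w" using idx[OF x(1)] \<open>w \<in> B\<close> by (auto simp: T_def X_def)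
      then show ?thesis using True by (auto simp: indicator_def)
    next
      case False
      have "w \<notin> f ` T i"
      proof
        assume "w \<in> f ` T i"
        then obtain x where x: "x \<in> S i" "f x = w" by (auto simp: T_def)
        then have xX: "x \<in> X" using SV[of i] VU by (auto simp: X_def)
        then have "x \<in> S (idx x)" by (rule idx)
        then have "idx x = i" using x(1) S(1) unfolding disjoint_family_on_def by blast
        then show False using False xX by blast
      qed
      then show ?thesis using False by simp
    qed
    have "(\<Sum>i. indicator (f ` T i) w) = (\<Sum>i\<in>idx ` X. 1 :: ennreal)"
      unfolding ind using X(1) by (subst suminf_finite[of "idx ` X"]) auto
    also have "\<dots> = of_nat (card X)" using inj by (simp add: card_image)
    finally show ?thesis using True X(2) by (simp add: ennreal_of_nat_eq_real_of_nat)
  qed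
  have "(\<integral>\<^sup>+w. indicator B w * ennreal (real (N w)) \<partial>lborel) = (\<integral>\<^sup>+w. indicator B w * ennreal (real (N w)) \<partial>lebesgue)"
    by (rule nn_integral_completion[symmetric])
  also have "\<dots> = (\<integral>\<^sup>+w. (\<Sum>i. indicator (f ` T i) w) \<partial>lebesgue)"
    by (rule nn_integral_cong_AE) (use AE_nc in eventually_elim, rule counting)
  also have "\<dots> = (\<Sum>i. \<integral>\<^sup>+w. indicator (f ` T i) w \<partial>lebesgue)"
    by (rule nn_integral_suminf) (use img(1) in simp)
  also have "\<dots> = (\<Sum>i. \<integral>\<^sup>+x. indicator (T i) x * ennreal (Jb x) \<partial>lborel)"
    using img(1) by (simp add: imgJ)
  also have "\<dots> = (\<integral>\<^sup>+x. (\<Sum>i. indicator (T i) x * ennreal (Jb x)) \<partial>lborel)"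
    by (rule nn_integral_suminf[symmetric]) measurable
  finally show ?thesis unfolding sum_ind .
qed

section \<open>Integration over planes, boxes and cubes\<close>

lemma real2_eq_iff: "(x :: real^2) = y \<longleftrightarrow> x $ 1 = y $ 1 \<and> x $ 2 = y $ 2"
  by (simp add: vec_eq_iff forall_2)

lemma Basis_real2: "(Basis :: (real^2) set) = {axis 1 1, axis 2 1}"
  by (auto simp: Basis_vec_def UNIV_2)

lemma measurable_pair_to_real2 [measurable]: "(\<lambda>p. vector [fst p, snd p] :: real^2) \<in> borel_measurable (borel \<Otimes>\<^sub>M borel)"
  by (subst borel_measurable_euclidean_space) (auto simp: Basis_real2 inner_axis)

text \<open>Determinants live on \<open>real^2\<close>, the coefficient box is treated by iterated
  real integrals, and \<open>psi\<close> is integrated over \<open>complex\<close>. Writing both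
  plane measures as images of one product measure moves integrals between the three
  settings.\<close>

lemma lborel_real2: "lborel = distr (lborel \<Otimes>\<^sub>M lborel) borel (\<lambda>p. vector [fst p, snd p] :: real^2)"
proof (rule lborel_eqI)
  fix l u :: "real^2" assume le: "\<And>b. b \<in> Basis \<Longrightarrow> l \<bullet> b \<le> u \<bullet> b"
  have le': "l $ 1 \<le> u $ 1" "l $ 2 \<le> u $ 2"
    using le[of "axis 1 1"] le[of "axis 2 1"] by (simp_all add: Basis_real2 inner_axis)
  have pre: "(\<lambda>p. vector [fst p, snd p] :: real^2) -` box l u \<inter> space (lborel \<Otimes>\<^sub>M lborel) = {l$1<..<u$1} \<times> {l$2<..<u$2}"
    by (auto simp: mem_box Basis_real2 inner_axis space_pair_measure)
  have "emeasure (distr (lborel \<Otimes>\<^sub>M lborel) borel (\<lambda>p. vector [fst p, snd p] :: real^2)) (box l u)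
    = emeasure (lborel \<Otimes>\<^sub>M lborel) ({l$1<..<u$1} \<times> {l$2<..<u$2})"
    by (subst emeasure_distr) (auto simp: pre)
  also have "\<dots> = ennreal (u$1 - l$1) * ennreal (u$2 - l$2)"
    using le' by (subst lborel.emeasure_pair_measure_Times) auto
  also have "\<dots> = ennreal (\<Prod>b\<in>Basis. (u - l) \<bullet> b)"
  proof -
    have "axis 1 1 \<noteq> (axis 2 1 :: real^2)" by (simp add: axis_eq_axis)
    then show ?thesis using le' by (simp add: Basis_real2 inner_axis ennreal_mult'')
  qed
  finally show "emeasure (distr (lborel \<Otimes>\<^sub>M lborel) borel (\<lambda>p. vector [fst p, snd p] :: real^2)) (box l u) = (\<Prod>b\<in>Basis. (u - l) \<bullet> b)" .
qed simp

lemma nn_integral_real2: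
  assumes "h \<in> borel_measurable (borel :: (real^2) measure)"
  shows "(\<integral>\<^sup>+w. h w \<partial>lborel) = (\<integral>\<^sup>+x. \<integral>\<^sup>+y. h (vector [x, y]) \<partial>lborel \<partial>lborel)"
proof -
  have "(\<integral>\<^sup>+w. h w \<partial>lborel) = (\<integral>\<^sup>+p. h (vector [fst p, snd p]) \<partial>(lborel \<Otimes>\<^sub>M lborel))"
    by (subst lborel_real2, subst nn_integral_distr) (use assms in auto)
  also have "\<dots> = (\<integral>\<^sup>+x. \<integral>\<^sup>+y. h (vector [x, y]) \<partial>lborel \<partial>lborel)"
    by (subst lborel.nn_integral_fst[symmetric]) (use assms in auto)
  finally show ?thesis .
qed

lemma measurable_pair_to_complex: "(\<lambda>p. Complex (fst p) (snd p)) \<in> borel_measurable (borel \<Otimes>\<^sub>M borel)"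
  unfolding borel_prod by (intro borel_measurable_continuous_onI continuous_intros)

lemma lborel_complex: "lborel = distr (lborel \<Otimes>\<^sub>M lborel) borel (\<lambda>p. Complex (fst p) (snd p))"
proof (rule lborel_eqI)
  note [measurable] = measurable_pair_to_complex
  fix l u :: complex assume le: "\<And>b. b \<in> Basis \<Longrightarrow> l \<bullet> b \<le> u \<bullet> b"
  have le': "Re l \<le> Re u" "Im l \<le> Im u"
    using le[of 1] le[of \<i>] by (simp_all add: Basis_complex_def inner_complex_def)
  have pre: "(\<lambda>p. Complex (fst p) (snd p)) -` box l u \<inter> space (lborel \<Otimes>\<^sub>M lborel) = {Re l<..<Re u} \<times> {Im l<..<Im u}"
    by (auto simp: mem_box Basis_complex_def inner_complex_def space_pair_measure)
  have "emeasure (distr (lborel \<Otimes>\<^sub>M lborel) borel (\<lambda>p. Complex (fst p) (snd p))) (box l u)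
    = emeasure (lborel \<Otimes>\<^sub>M lborel) ({Re l<..<Re u} \<times> {Im l<..<Im u})"
    by (subst emeasure_distr) (auto simp: pre)
  also have "\<dots> = ennreal (Re u - Re l) * ennreal (Im u - Im l)"
    using le' by (subst lborel.emeasure_pair_measure_Times) auto
  also have "\<dots> = ennreal (\<Prod>b\<in>Basis. (u - l) \<bullet> b)"
    using le' by (simp add: Basis_complex_def inner_complex_def ennreal_mult'' complex_eq_iff)
  finally show "emeasure (distr (lborel \<Otimes>\<^sub>M lborel) borel (\<lambda>p. Complex (fst p) (snd p))) (box l u) = (\<Prod>b\<in>Basis. (u - l) \<bullet> b)" .
qed simp

lemma nn_integral_complex:
  assumes "h \<in> borel_measurable borel"
  shows "(\<integral>\<^sup>+z. h z \<partial>lborel) = (\<integral>\<^sup>+x. \<integral>\<^sup>+y. h (Complex x y) \<partial>lborel \<partial>lborel)"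
proof -
  note [measurable] = measurable_pair_to_complex assms
  have "(\<integral>\<^sup>+z. h z \<partial>lborel) = (\<integral>\<^sup>+p. h (Complex (fst p) (snd p)) \<partial>(lborel \<Otimes>\<^sub>M lborel))"
    by (subst lborel_complex, subst nn_integral_distr) auto
  also have "\<dots> = (\<integral>\<^sup>+x. \<integral>\<^sup>+y. h (Complex x y) \<partial>lborel \<partial>lborel)"
    by (subst lborel.nn_integral_fst[symmetric]) auto
  finally show ?thesis .
qed

lemma nn_integral_real2_complex:
  assumes "h \<in> borel_measurable borel"
  shows "(\<integral>\<^sup>+x. h (Complex (x $ 1) (x $ 2)) \<partial>(lborel :: (real^2) measure)) = (\<integral>\<^sup>+z. h z \<partial>lborel)"
proof -
  have "(\<lambda>x::real^2. Complex (x $ 1) (x $ 2)) \<in> borel_measurable borel"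
    by (intro borel_measurable_continuous_onI continuous_intros)
  then have "(\<lambda>x::real^2. h (Complex (x $ 1) (x $ 2))) \<in> borel_measurable borel"
    using assms by measurable
  then show ?thesis by (simp add: nn_integral_real2 nn_integral_complex assms)
qed

section \<open>Scaling and tiling in finite products of the line\<close>

interpretation lborel_product: product_sigma_finite "\<lambda>_ :: nat. lborel :: real measure" ..

lemma nn_integral_PiM_scale:
  fixes c :: real
  assumes "finite I" "c > 0" "f \<in> borel_measurable (PiM I (\<lambda>_ :: nat. lborel :: real measure))"
  shows "(\<integral>\<^sup>+x. f x \<partial>PiM I (\<lambda>_. lborel)) = ennreal c ^ card I * (\<integral>\<^sup>+x. f (\<lambda>i\<in>I. c * x i) \<partial>PiM I (\<lambda>_. lborel))"
  using assms(1,3)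
proof (induction I arbitrary: f rule: finite_induct)
  case empty
  show ?case by (simp add: lborel_product.nn_integral_empty space_PiM_empty)
next
  case (insert i I)
  note f[measurable] = insert.prems
  have m1[measurable]: "(\<lambda>p. (fst p)(i := c * snd p)) \<in> PiM I (\<lambda>_. lborel) \<Otimes>\<^sub>M lborel \<rightarrow>\<^sub>M PiM (insert i I) (\<lambda>_. lborel :: real measure)"
    by measurable
  have "(\<lambda>p. f ((fst p)(i := c * snd p))) \<in> borel_measurable (PiM I (\<lambda>_. lborel) \<Otimes>\<^sub>M lborel)"
    by (rule measurable_compose[OF m1 f])
  then have m2: "(\<lambda>x. \<integral>\<^sup>+y. f (x(i := c * y)) \<partial>lborel) \<in> borel_measurable (PiM I (\<lambda>_. lborel))"
    using lborel.borel_measurable_nn_integral[of "\<lambda>x y. f (x(i := c * y))"] by (simp add: case_prod_beta')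
  have m3: "(\<lambda>x. f (\<lambda>j\<in>insert i I. c * x j)) \<in> borel_measurable (PiM (insert i I) (\<lambda>_. lborel))"
    by measurable
  have "(\<integral>\<^sup>+x. f x \<partial>PiM (insert i I) (\<lambda>_. lborel)) = (\<integral>\<^sup>+x. \<integral>\<^sup>+y. f (x(i := y)) \<partial>lborel \<partial>PiM I (\<lambda>_. lborel))"
    using insert by (intro lborel_product.product_nn_integral_insert) auto
  also have "\<dots> = (\<integral>\<^sup>+x. ennreal c * (\<integral>\<^sup>+y. f (x(i := c * y)) \<partial>lborel) \<partial>PiM I (\<lambda>_. lborel))"
  proof (rule nn_integral_cong)
    fix x assume x: "x \<in> space (PiM I (\<lambda>_. lborel :: real measure))"
    have "(\<lambda>y. f (x(i := y))) \<in> borel_measurable borel"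
    proof -
      have "(\<lambda>y. x(i := y)) \<in> borel \<rightarrow>\<^sub>M PiM (insert i I) (\<lambda>_. lborel :: real measure)"
        by (rule measurable_fun_upd[where J = I]) (use x in auto)
      from measurable_compose[OF this f] show ?thesis .
    qed
    from nn_integral_real_affine[OF this, of c 0] assms(2)
    show "(\<integral>\<^sup>+y. f (x(i := y)) \<partial>lborel) = ennreal c * (\<integral>\<^sup>+y. f (x(i := c * y)) \<partial>lborel)" by simp
  qed
  also have "\<dots> = ennreal c * (\<integral>\<^sup>+x. \<integral>\<^sup>+y. f (x(i := c * y)) \<partial>lborel \<partial>PiM I (\<lambda>_. lborel))"
    using m2 by (rule nn_integral_cmult)
  also have "\<dots> = ennreal c * (ennreal c ^ card I * (\<integral>\<^sup>+x. \<integral>\<^sup>+y. f ((\<lambda>j\<in>I. c * x j)(i := c * y)) \<partial>lborel \<partial>PiM I (\<lambda>_. lborel)))"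
    by (subst insert.IH[OF m2]) simp
  also have "(\<integral>\<^sup>+x. \<integral>\<^sup>+y. f ((\<lambda>j\<in>I. c * x j)(i := c * y)) \<partial>lborel \<partial>PiM I (\<lambda>_. lborel))
     = (\<integral>\<^sup>+x. \<integral>\<^sup>+y. f (\<lambda>j\<in>insert i I. c * (x(i := y)) j) \<partial>lborel \<partial>PiM I (\<lambda>_. lborel))"
    using insert.hyps by (intro nn_integral_cong arg_cong[of _ _ f]) (auto simp: fun_eq_iff)
  also have "\<dots> = (\<integral>\<^sup>+x. f (\<lambda>j\<in>insert i I. c * x j) \<partial>PiM (insert i I) (\<lambda>_. lborel))"
    using insert m3 by (intro lborel_product.product_nn_integral_insert[symmetric]) auto
  finally show ?case unfolding card_insert_disjoint[OF insert.hyps] power_Suc mult.assoc .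
qed

text \<open>The closed unit intervals about the integers from \<open>-M\<close> to \<open>M\<close>
  fill the interval of radius \<open>M + 1/2\<close> and overlap only at half-integers, which are
  negligible.\<close>

lemma nn_integral_unit_intervals:
  assumes [measurable]: "g \<in> borel_measurable borel"
  shows "(\<integral>\<^sup>+y. indicator {-(real M + 1/2)..real M + 1/2} y * g y \<partial>lborel) =
    (\<Sum>a\<in>{-int M..int M}. \<integral>\<^sup>+u. indicator {-(1/2)..1/2} u * g (of_int a + u) \<partial>lborel)"
proof -
  define H where "H = (\<lambda>a::int. of_int a + 1/2 :: real) ` UNIV"
  have "countable H" by (simp add: H_def)
  then have AE: "AE y in lborel. y \<notin> H" by (rule AE_not_in[OF countable_imp_null_set_lborel])
  have ind: "indicator {-(real M + 1/2)..real M + 1/2} y = (\<Sum>a\<in>{-int M..int M}. indicator {-(1/2)..1/2} (y - of_int a) :: ennreal)"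
    if y: "y \<notin> H" for y
  proof -
    define b where "b = \<lfloor>y + 1/2\<rfloor>"
    have b: "of_int b - 1/2 < y" "y < of_int b + 1/2"
    proof -
      have "of_int b \<le> y + 1/2" "y + 1/2 < of_int b + 1" by (simp_all add: b_def)
      moreover have "y \<noteq> of_int (b - 1) + 1/2" using y unfolding H_def by blast
      ultimately show "of_int b - 1/2 < y" "y < of_int b + 1/2" by auto
    qed
    have one: "\<bar>y - of_int a\<bar> \<le> 1/2 \<longleftrightarrow> a = b" for a :: int
    proof
      assume "\<bar>y - of_int a\<bar> \<le> 1/2"
      then have "y - of_int a \<le> 1/2" "- (1/2) \<le> y - of_int a" by linarith+
      then have "real_of_int a < of_int (b + 1)" "real_of_int b < of_int (a + 1)" using b by auto
      then show "a = b" by linarith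
    next
      assume "a = b"
      then show "\<bar>y - of_int a\<bar> \<le> 1/2" using b by (simp only: abs_le_iff) linarith
    qed
    have "(\<Sum>a\<in>{-int M..int M}. indicator {-(1/2)..1/2} (y - of_int a) :: ennreal) = (\<Sum>a\<in>{-int M..int M}. if a = b then 1 else 0)"
    proof (rule sum.cong[OF refl])
      fix a :: int
      have mem: "y - of_int a \<in> {-(1/2)..1/2} \<longleftrightarrow> a = b"
        using one[of a] unfolding abs_le_iff atLeastAtMost_iff by linarith
      show "indicator {-(1/2)..1/2} (y - of_int a) = (if a = b then 1 else 0 :: ennreal)"
        unfolding indicator_def of_bool_def mem ..
    qed
    also have "\<dots> = (if b \<in> {-int M..int M} then 1 else 0)" by simp
    also have "\<dots> = indicator {-(real M + 1/2)..real M + 1/2} y"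
    proof -
      have "b \<in> {-int M..int M} \<longleftrightarrow> y \<in> {-(real M + 1/2)..real M + 1/2}"
      proof
        assume "b \<in> {-int M..int M}"
        then have "real_of_int (- int M) \<le> real_of_int b" "real_of_int b \<le> real_of_int (int M)"
          unfolding of_int_le_iff by simp_all
        then have "- real M \<le> real_of_int b" "real_of_int b \<le> real M" by simp_all
        then show "y \<in> {-(real M + 1/2)..real M + 1/2}" using b by auto
      next
        assume "y \<in> {-(real M + 1/2)..real M + 1/2}"
        then have "real_of_int b < of_int (int M + 1)" "real_of_int (- int M - 1) < of_int b" using b by auto
        then show "b \<in> {-int M..int M}" unfolding of_int_less_iff by auto
      qed
      then show ?thesis by simp
    qed
    finally show ?thesis by simp
  qed
  have "(\<integral>\<^sup>+y. indicator {-(real M + 1/2)..real M + 1/2} y * g y \<partial>lborel)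
    = (\<integral>\<^sup>+y. (\<Sum>a\<in>{-int M..int M}. indicator {-(1/2)..1/2} (y - of_int a) * g y) \<partial>lborel)"
  proof (rule nn_integral_cong_AE)
    show "AE y in lborel. indicator {-(real M + 1/2)..real M + 1/2} y * g y =
        (\<Sum>a\<in>{-int M..int M}. indicator {-(1/2)..1/2} (y - of_int a) * g y)"
      using AE
    proof eventually_elim
      case (elim y)
      show ?case unfolding ind[OF elim] by (rule sum_distrib_right)
    qed
  qed
  also have "\<dots> = (\<Sum>a\<in>{-int M..int M}. \<integral>\<^sup>+y. indicator {-(1/2)..1/2} (y - of_int a) * g y \<partial>lborel)"
    by (rule nn_integral_sum) measurable
  also have "\<dots> = (\<Sum>a\<in>{-int M..int M}. \<integral>\<^sup>+u. indicator {-(1/2)..1/2} u * g (of_int a + u) \<partial>lborel)"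
  proof (rule sum.cong[OF refl])
    fix a :: int
    show "(\<integral>\<^sup>+y. indicator {-(1/2)..1/2} (y - of_int a) * g y \<partial>lborel) =
        (\<integral>\<^sup>+u. indicator {-(1/2)..1/2} u * g (of_int a + u) \<partial>lborel)"
      by (subst nn_integral_real_affine[where c = 1 and t = "of_int a"]) simp_all
  qed
  finally show ?thesis .
qed

lemma nn_integral_PiM_unit_cubes:
  assumes "finite I" "f \<in> borel_measurable (PiM I (\<lambda>_ :: nat. lborel :: real measure))"
  shows "(\<integral>\<^sup>+x. (\<Prod>i\<in>I. indicator {-(real M + 1/2)..real M + 1/2} (x i)) * f x \<partial>PiM I (\<lambda>_. lborel)) =
    (\<Sum>a\<in>int_grid I M. \<integral>\<^sup>+u. (\<Prod>i\<in>I. indicator {-(1/2)..1/2} (u i)) * f (\<lambda>i\<in>I. of_int (a i) + u i) \<partial>PiM I (\<lambda>_. lborel))"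
  using assms
proof (induction I arbitrary: f rule: finite_induct)
  case empty
  show ?case by (simp add: lborel_product.nn_integral_empty space_PiM_empty)
next
  case (insert i I)
  note f[measurable] = insert.prems
  define T :: "real set" where "T = {-(real M + 1/2)..real M + 1/2}"
  define C :: "real set" where "C = {-(1/2)..1/2}"
  have [measurable]: "T \<in> sets borel" "C \<in> sets borel" by (simp_all add: T_def C_def)
  let ?L = "\<lambda>_ :: nat. lborel :: real measure"
  have slice: "(\<lambda>y. f (x(i := y))) \<in> borel_measurable borel" if x: "x \<in> space (PiM I ?L)" for x
  proof -
    have "(\<lambda>y. x(i := y)) \<in> borel \<rightarrow>\<^sub>M PiM (insert i I) ?L"
      by (rule measurable_fun_upd[where J = I]) (use x in auto)
    from measurable_compose[OF this f] show ?thesis .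
  qed
  \<comment> \<open>Coordinate \<open>i\<close> is cut into unit intervals and integrated out first;
    what remains is a function on the smaller product, to which the induction hypothesis
    applies.\<close>
  define g where "g x = (\<Sum>b\<in>{-int M..int M}. \<integral>\<^sup>+u. indicator C u * f (x(i := of_int b + u)) \<partial>lborel)" for x
  have m1: "(\<lambda>p. (fst p)(i := of_int b + snd p)) \<in> PiM I ?L \<Otimes>\<^sub>M lborel \<rightarrow>\<^sub>M PiM (insert i I) ?L" for b :: int
    by measurable
  have g[measurable]: "g \<in> borel_measurable (PiM I ?L)"
  proof -
    have "(\<lambda>p. f ((fst p)(i := of_int b + snd p))) \<in> borel_measurable (PiM I ?L \<Otimes>\<^sub>M lborel)" for b
      by (rule measurable_compose[OF m1 f])
    then have "(\<lambda>x. \<integral>\<^sup>+u. indicator C u * f (x(i := of_int b + u)) \<partial>lborel) \<in> borel_measurable (PiM I ?L)" for b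
      using lborel.borel_measurable_nn_integral[of "\<lambda>x u. indicator C u * f (x(i := of_int b + u))" "PiM I ?L"]
      by (simp add: case_prod_beta')
    then show ?thesis unfolding g_def[abs_def] by measurable
  qed
  have prodT: "(\<lambda>x. \<Prod>j\<in>J. indicator A (x j) :: ennreal) \<in> borel_measurable (PiM J ?L)"
    if "A \<in> sets borel" for A and J
    using that by measurable
  have "(\<integral>\<^sup>+x. (\<Prod>j\<in>insert i I. indicator T (x j)) * f x \<partial>PiM (insert i I) ?L)
    = (\<integral>\<^sup>+x. \<integral>\<^sup>+y. (\<Prod>j\<in>insert i I. indicator T ((x(i := y)) j)) * f (x(i := y)) \<partial>lborel \<partial>PiM I ?L)"
    using insert.hyps prodT[of T "insert i I"] by (intro lborel_product.product_nn_integral_insert) auto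
  also have "\<dots> = (\<integral>\<^sup>+x. (\<Prod>j\<in>I. indicator T (x j)) * g x \<partial>PiM I ?L)"
  proof (rule nn_integral_cong)
    fix x assume x: "x \<in> space (PiM I ?L)"
    note slice[OF x, measurable]
    have "(\<integral>\<^sup>+y. (\<Prod>j\<in>insert i I. indicator T ((x(i := y)) j)) * f (x(i := y)) \<partial>lborel)
      = (\<integral>\<^sup>+y. (\<Prod>j\<in>I. indicator T (x j)) * (indicator T y * f (x(i := y))) \<partial>lborel)"
    proof (rule nn_integral_cong)
      fix y
      have "(\<Prod>j\<in>I. indicator T ((x(i := y)) j)) = (\<Prod>j\<in>I. indicator T (x j) :: ennreal)"
        using insert.hyps by (intro prod.cong) auto
      then show "(\<Prod>j\<in>insert i I. indicator T ((x(i := y)) j)) * f (x(i := y))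
        = (\<Prod>j\<in>I. indicator T (x j)) * (indicator T y * f (x(i := y)))"
        using insert.hyps by (simp add: mult_ac)
    qed
    also have "\<dots> = (\<Prod>j\<in>I. indicator T (x j)) * (\<integral>\<^sup>+y. indicator T y * f (x(i := y)) \<partial>lborel)"
      by (rule nn_integral_cmult) measurable
    also have "(\<integral>\<^sup>+y. indicator T y * f (x(i := y)) \<partial>lborel) = g x"
      unfolding T_def g_def C_def by (rule nn_integral_unit_intervals[OF slice[OF x]])
    finally show "(\<integral>\<^sup>+y. (\<Prod>j\<in>insert i I. indicator T ((x(i := y)) j)) * f (x(i := y)) \<partial>lborel)
      = (\<Prod>j\<in>I. indicator T (x j)) * g x" .
  qed
  also have "\<dots> = (\<Sum>a\<in>int_grid I M. \<integral>\<^sup>+u. (\<Prod>j\<in>I. indicator C (u j)) * g (\<lambda>j\<in>I. of_int (a j) + u j) \<partial>PiM I ?L)"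
    unfolding T_def C_def by (rule insert.IH[OF g])
  also have "\<dots> = (\<Sum>a\<in>int_grid I M. \<Sum>b\<in>{-int M..int M}.
      \<integral>\<^sup>+u. (\<Prod>j\<in>insert i I. indicator C (u j)) * f (\<lambda>j\<in>insert i I. of_int ((a(i := b)) j) + u j) \<partial>PiM (insert i I) ?L)"
  proof (rule sum.cong[OF refl])
    fix a :: "nat \<Rightarrow> int"
    have shift: "(\<lambda>u. \<lambda>j\<in>J. of_int (a j) + u j) \<in> PiM J ?L \<rightarrow>\<^sub>M PiM J ?L" for J and a :: "nat \<Rightarrow> int"
      by measurable
    define G where "G b u = (\<Prod>j\<in>insert i I. indicator C (u j)) * f (\<lambda>j\<in>insert i I. of_int ((a(i := b)) j) + u j)" for b u
    have G: "G b \<in> borel_measurable (PiM (insert i I) ?L)" for b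
      unfolding G_def[abs_def]
      using prodT[of C "insert i I"] measurable_compose[OF shift[where J="insert i I" and a="a(i := b)"] f] by measurable
    have G_upd: "G b (u(i := y)) = (\<Prod>j\<in>I. indicator C (u j)) * (indicator C y * f ((\<lambda>j\<in>I. of_int (a j) + u j)(i := of_int b + y)))"
      for b u y
    proof -
      have "(\<lambda>j\<in>insert i I. of_int ((a(i := b)) j) + (u(i := y)) j) = (\<lambda>j\<in>I. of_int (a j) + u j)(i := of_int b + y)"
        using insert.hyps by (auto simp: fun_eq_iff)
      moreover have "(\<Prod>j\<in>I. indicator C ((u(i := y)) j)) = (\<Prod>j\<in>I. indicator C (u j) :: ennreal)"
        using insert.hyps by (intro prod.cong) auto
      ultimately show ?thesis using insert.hyps by (simp add: G_def mult_ac)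
    qed
    have Gint: "(\<integral>\<^sup>+u. G b u \<partial>PiM (insert i I) ?L) = (\<integral>\<^sup>+u. \<integral>\<^sup>+y. G b (u(i := y)) \<partial>lborel \<partial>PiM I ?L)" for b
      using insert.hyps G by (intro lborel_product.product_nn_integral_insert) auto
    have "(\<integral>\<^sup>+u. (\<Prod>j\<in>I. indicator C (u j)) * g (\<lambda>j\<in>I. of_int (a j) + u j) \<partial>PiM I ?L)
      = (\<integral>\<^sup>+u. (\<Sum>b\<in>{-int M..int M}. \<integral>\<^sup>+y. G b (u(i := y)) \<partial>lborel) \<partial>PiM I ?L)"
    proof (rule nn_integral_cong)
      fix u assume u: "u \<in> space (PiM I ?L)"
      have sp: "(\<lambda>j\<in>I. of_int (a j) + u j) \<in> space (PiM I ?L)" by (auto simp: space_PiM)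
      have "(\<lambda>y. f ((\<lambda>j\<in>I. of_int (a j) + u j)(i := of_int b + y))) \<in> borel_measurable borel" for b
        using measurable_compose[OF _ slice[OF sp], of "\<lambda>y. of_int b + y" borel] by simp
      then show "(\<Prod>j\<in>I. indicator C (u j)) * g (\<lambda>j\<in>I. of_int (a j) + u j) = (\<Sum>b\<in>{-int M..int M}. \<integral>\<^sup>+y. G b (u(i := y)) \<partial>lborel)"
        unfolding g_def sum_distrib_left G_upd
        by (intro sum.cong refl nn_integral_cmult[symmetric]) measurable
    qed
    also have "\<dots> = (\<Sum>b\<in>{-int M..int M}. \<integral>\<^sup>+u. \<integral>\<^sup>+y. G b (u(i := y)) \<partial>lborel \<partial>PiM I ?L)"
    proof (rule nn_integral_sum)
      fix b
      have "(\<lambda>p. G b ((fst p)(i := snd p))) \<in> borel_measurable (PiM I ?L \<Otimes>\<^sub>M lborel)"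
        by (rule measurable_compose[OF _ G]) measurable
      then show "(\<lambda>u. \<integral>\<^sup>+y. G b (u(i := y)) \<partial>lborel) \<in> borel_measurable (PiM I ?L)"
        using lborel.borel_measurable_nn_integral[of "\<lambda>u y. G b (u(i := y))" "PiM I ?L"] by (simp add: case_prod_beta')
    qed
    finally show "(\<integral>\<^sup>+u. (\<Prod>j\<in>I. indicator C (u j)) * g (\<lambda>j\<in>I. of_int (a j) + u j) \<partial>PiM I ?L) =
      (\<Sum>b\<in>{-int M..int M}. \<integral>\<^sup>+u. (\<Prod>j\<in>insert i I. indicator C (u j)) * f (\<lambda>j\<in>insert i I. of_int ((a(i := b)) j) + u j) \<partial>PiM (insert i I) ?L)"
      unfolding Gint[symmetric] unfolding G_def .
  qed
  also have "\<dots> = (\<Sum>a\<in>int_grid (insert i I) M. \<integral>\<^sup>+u. (\<Prod>j\<in>insert i I. indicator C (u j)) * f (\<lambda>j\<in>insert i I. of_int (a j) + u j) \<partial>PiM (insert i I) ?L)"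
    unfolding sum_PiE_insert[OF insert.hyps(2)] by (rule sum.swap)
  finally show ?case unfolding T_def C_def .
qed

section \<open>The coefficient map of a root\<close>

text \<open>In the formula for \<open>psi\<close> the variable \<open>t k\<close> belongs to the
  power \<open>k + 1\<close>, so the coefficient at index \<open>i \<ge> 2\<close> is
  \<open>t (i - 1)\<close>; the two lowest coefficients are kept apart because they are solved
  for.\<close>

definition prepend2 :: "real \<Rightarrow> real \<Rightarrow> (nat \<Rightarrow> real) \<Rightarrow> nat \<Rightarrow> real" where
  "prepend2 a0 a1 t i = (if i = 0 then a0 else if i = 1 then a1 else t (i - 1))"

definition upper_part :: "nat \<Rightarrow> (nat \<Rightarrow> real) \<Rightarrow> complex \<Rightarrow> complex" where
  "upper_part n t z = (\<Sum>k=1..n-1. of_real (t k) * z ^ (k + 1))"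

definition upper_deriv :: "nat \<Rightarrow> (nat \<Rightarrow> real) \<Rightarrow> complex \<Rightarrow> complex" where
  "upper_deriv n t z = (\<Sum>k=1..n-1. of_real (t k) * (of_nat (k + 1) * z ^ k))"

text \<open>With real coefficients, the imaginary part of the equation
  \<open>a0 + a1 * z + upper_part n t z = 0\<close> determines \<open>a1\<close> when
  \<open>z\<close> is nonreal; the real part then determines \<open>a0\<close>, which is
  \<open>solve0\<close>.\<close>

definition solve1 :: "nat \<Rightarrow> (nat \<Rightarrow> real) \<Rightarrow> complex \<Rightarrow> real" where
  "solve1 n t z = - (Im (upper_part n t z) / Im z)"

definition solve0 :: "nat \<Rightarrow> (nat \<Rightarrow> real) \<Rightarrow> complex \<Rightarrow> real" where
  "solve0 n t z = - Re (upper_part n t z) - solve1 n t z * Re z"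

lemma poly_prepend2:
  assumes "n \<ge> 2"
  shows "poly (real_cpoly n (prepend2 a0 a1 t)) z = of_real a0 + of_real a1 * z + upper_part n t z"
proof -
  obtain m where n: "n = Suc (Suc m)" using assms by (metis add_2_eq_Suc le_Suc_ex)
  have "poly (real_cpoly n (prepend2 a0 a1 t)) z
      = of_real a0 + of_real a1 * z + (\<Sum>i\<le>m. of_real (t (Suc i)) * z ^ (Suc (Suc i)))"
    unfolding poly_real_cpoly n sum.atMost_Suc_shift by (simp add: prepend2_def)
  also have "(\<Sum>i\<le>m. of_real (t (Suc i)) * z ^ (Suc (Suc i))) = upper_part n t z"
    unfolding upper_part_def n by (rule sum.reindex_bij_witness[of _ "\<lambda>k. k - 1" Suc]) auto
  finally show ?thesis .
qed

lemma poly_prepend2_eq_0_iff: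
  assumes "n \<ge> 2" "Im z \<noteq> 0"
  shows "poly (real_cpoly n (prepend2 a0 a1 t)) z = 0 \<longleftrightarrow> a0 = solve0 n t z \<and> a1 = solve1 n t z"
proof -
  have "poly (real_cpoly n (prepend2 a0 a1 t)) z = 0 \<longleftrightarrow>
      a0 + a1 * Re z + Re (upper_part n t z) = 0 \<and> a1 * Im z + Im (upper_part n t z) = 0"
    unfolding poly_prepend2[OF assms(1)] by (auto simp: complex_eq_iff)
  also have "a1 * Im z + Im (upper_part n t z) = 0 \<longleftrightarrow> a1 = solve1 n t z"
    using assms(2) by (auto simp: solve1_def field_simps)
  also have "a0 + a1 * Re z + Re (upper_part n t z) = 0 \<and> a1 = solve1 n t z \<longleftrightarrow> a0 = solve0 n t z \<and> a1 = solve1 n t z"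
    by (auto simp: solve0_def)
  finally show ?thesis .
qed

lemma upper_part_deriv: "(upper_part n t has_field_derivative upper_deriv n t z) (at z)"
  unfolding upper_part_def[abs_def] upper_deriv_def
proof (rule DERIV_sum)
  fix k
  show "((\<lambda>z. of_real (t k) * z ^ (k + 1)) has_field_derivative of_real (t k) * (of_nat (k + 1) * z ^ k)) (at z)"
    using DERIV_cmult[OF DERIV_power[OF DERIV_ident, where n = "k + 1"], of "of_real (t k)" z] by simp
qed

definition complex_of_vec :: "real^2 \<Rightarrow> complex" where "complex_of_vec x = Complex (x $ 1) (x $ 2)"

lemma complex_of_vec_sel [simp]: "Re (complex_of_vec x) = x $ 1" "Im (complex_of_vec x) = x $ 2"
  by (simp_all add: complex_of_vec_def)

lemma bounded_linear_complex_of_vec: "bounded_linear complex_of_vec"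
  unfolding linear_conv_bounded_linear[symmetric]
  by (rule linearI) (simp_all add: complex_eq_iff)

lemma complex_of_vec_vector: "complex_of_vec (vector [Re z, Im z]) = z"
  by (simp add: complex_eq_iff)

lemma inj_complex_of_vec: "inj complex_of_vec"
  by (rule injI) (simp add: real2_eq_iff complex_eq_iff)

definition solve_vec :: "nat \<Rightarrow> (nat \<Rightarrow> real) \<Rightarrow> real^2 \<Rightarrow> real^2" where
  "solve_vec n t x = vector [solve0 n t (complex_of_vec x), solve1 n t (complex_of_vec x)]"

text \<open>Differentiating \<open>a0 + a1 * z + upper_part n t z = 0\<close> gives
  \<open>da0 + z * da1 = - p'(z) * dz\<close>, where \<open>p'(z)\<close> is
  \<open>upper_deriv n t z + solve1 n t z\<close>. Multiplication by \<open>p'(z)\<close> has real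
  determinant \<open>|p'(z)|^2\<close>, and the map from \<open>(a0, a1)\<close> to
  \<open>a0 + a1 * z\<close> has determinant \<open>Im z\<close>. The proof computes the same
  quotient from explicit partial derivatives.\<close>

lemma solve_vec_derivative:
  fixes x :: "real^2"
  assumes "x $ 2 \<noteq> 0"
  defines "z \<equiv> complex_of_vec x"
  shows "\<exists>D. (solve_vec n t has_derivative D) (at x) \<and>
    \<bar>det (matrix D)\<bar> = (cmod (upper_deriv n t z + of_real (solve1 n t z)))\<^sup>2 / \<bar>Im z\<bar>"
proof -
  define q where "q = upper_deriv n t z"
  define b where "b = Im (upper_part n t z)"
  define D1 where "D1 h = - ((Im (q * complex_of_vec h) * x $ 2 - b * h $ 2) / (x $ 2 * x $ 2))" for h :: "real^2"
  define D0 where "D0 h = - Re (q * complex_of_vec h) - (solve1 n t z * h $ 1 + D1 h * x $ 1)" for h :: "real^2"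
  have dz: "(complex_of_vec has_derivative complex_of_vec) (at x)"
    by (rule bounded_linear_imp_has_derivative[OF bounded_linear_complex_of_vec])
  have dn: "((\<lambda>x::real^2. x $ i) has_derivative (\<lambda>h. h $ i)) (at x)" for i
    by (rule bounded_linear_imp_has_derivative[OF bounded_linear_vec_nth])
  have "(upper_part n t has_derivative (\<lambda>h. q * h)) (at (complex_of_vec x))"
    using upper_part_deriv[of n t z] unfolding has_field_derivative_def q_def z_def by simp
  from has_derivative_compose[OF dz this]
  have dq: "((\<lambda>x. upper_part n t (complex_of_vec x)) has_derivative (\<lambda>h. q * complex_of_vec h)) (at x)" .
  have d1: "((\<lambda>x. solve1 n t (complex_of_vec x)) has_derivative D1) (at x)"
    unfolding solve1_def D1_def[abs_def] b_def z_def complex_of_vec_sel(2)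
    by (intro has_derivative_minus has_derivative_divide' has_derivative_Im dq dn assms(1))
  have d0: "((\<lambda>x. solve0 n t (complex_of_vec x)) has_derivative D0) (at x)"
    unfolding solve0_def D0_def[abs_def] z_def complex_of_vec_sel(1)
    by (intro has_derivative_minus has_derivative_diff has_derivative_mult has_derivative_Re dq d1 dn)
  have "(solve_vec n t has_derivative (\<lambda>h. vector [D0 h, D1 h])) (at x)"
  proof (rule has_derivative_componentwise_within[THEN iffD2], rule ballI)
    fix i :: "real^2" assume "i \<in> Basis"
    then consider "i = axis 1 1" | "i = axis 2 1" unfolding Basis_real2 by blast
    then show "((\<lambda>x. solve_vec n t x \<bullet> i) has_derivative (\<lambda>h. vector [D0 h, D1 h] \<bullet> i)) (at x)"
    proof cases
      case 1
      show ?thesis using d0 unfolding 1 inner_axis solve_vec_def vector_2 by simp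
    next
      case 2
      show ?thesis using d1 unfolding 2 inner_axis solve_vec_def vector_2 by simp
    qed
  qed
  moreover have "\<bar>det (matrix (\<lambda>h. vector [D0 h, D1 h] :: real^2))\<bar> = (cmod (q + of_real (solve1 n t z)))\<^sup>2 / \<bar>Im z\<bar>"
  proof -
    define a y where "a = solve1 n t z" and "y = x $ 2"
    have y: "y \<noteq> 0" "Im z = y" using assms by (simp_all add: y_def z_def)
    have b: "b = - (a * y)" using y by (simp add: a_def solve1_def b_def)
    have e1: "complex_of_vec (axis 1 1) = 1" "complex_of_vec (axis 2 1) = \<i>"
      by (simp_all add: complex_eq_iff axis_def)
    have ax: "axis 1 1 $ 1 = (1::real)" "axis 1 1 $ (2::2) = (0::real)" "axis 2 1 $ (1::2) = (0::real)" "axis 2 1 $ (2::2) = (1::real)"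
      by (simp_all add: axis_def)
    have D1e: "D1 (axis 1 1) = - (Im q / y)" "D1 (axis 2 1) = - ((Re q + a) / y)"
      using y(1) unfolding D1_def e1 ax b y_def[symmetric] by (simp_all add: field_simps)
    have D0e: "D0 (axis 1 1) = - Re q - a + (Im q / y) * x $ 1" "D0 (axis 2 1) = Im q + ((Re q + a) / y) * x $ 1"
      unfolding D0_def D1e e1 ax a_def[symmetric] by simp_all
    have "det (matrix (\<lambda>h. vector [D0 h, D1 h] :: real^2)) =
        D0 (axis 1 1) * D1 (axis 2 1) - D0 (axis 2 1) * D1 (axis 1 1)"
      by (simp add: det_2 matrix_def)
    also have "\<dots> = ((Re q + a)\<^sup>2 + (Im q)\<^sup>2) / y"
      unfolding D0e D1e using y(1) by (simp add: field_simps power2_eq_square)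
    also have "\<bar>\<dots>\<bar> = (cmod (q + of_real a))\<^sup>2 / \<bar>y\<bar>"
      by (simp add: cmod_power2)
    finally show ?thesis by (simp add: a_def y(2))
  qed
  ultimately show ?thesis unfolding q_def by blast
qed

lemma continuous_on_upper: "continuous_on S (upper_part n t)" "continuous_on S (upper_deriv n t)"
  unfolding upper_part_def[abs_def] upper_deriv_def[abs_def] by (intro continuous_intros)+

lemma continuous_on_solve:
  assumes "S \<inter> \<real> = {}"
  shows "continuous_on S (solve1 n t)" "continuous_on S (solve0 n t)"
proof -
  have Im: "Im z \<noteq> 0" if "z \<in> S" for z using that assms by (auto simp: complex_is_Real_iff)
  show *: "continuous_on S (solve1 n t)"
    unfolding solve1_def[abs_def] using Im by (intro continuous_intros continuous_on_upper) auto
  show "continuous_on S (solve0 n t)"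
    unfolding solve0_def[abs_def] by (intro continuous_intros continuous_on_upper *)
qed

text \<open>If \<open>z \<noteq> w\<close> had the same pair of solved coefficients, both would be
  roots of one polynomial and its divided difference would vanish at \<open>(z, w)\<close>. At
  \<open>(z0, z0)\<close> that divided difference is the derivative, nonzero by hypothesis, and it
  is continuous.\<close>

lemma solve_locally_injective:
  assumes "open \<Omega>" "\<Omega> \<inter> \<real> = {}" "z0 \<in> \<Omega>" "n \<ge> 2"
    and "upper_deriv n t z0 + of_real (solve1 n t z0) \<noteq> 0"
  shows "\<exists>W. open W \<and> z0 \<in> W \<and> W \<subseteq> \<Omega> \<and> (\<forall>z\<in>W. \<forall>w\<in>W. solve0 n t z = solve0 n t w \<longrightarrow> solve1 n t z = solve1 n t w \<longrightarrow> z = w)"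
proof -
  \<comment> \<open>The divided difference of \<open>upper_part\<close>; adding
    \<open>solve1\<close> accounts for the linear term of the polynomial.\<close>
  define Q where "Q p = (\<Sum>k=1..n-1. of_real (t k) * (\<Sum>i<Suc k. fst p ^ i * snd p ^ (k - i)))" for p :: "complex \<times> complex"
  define g where "g p = Q p + of_real (solve1 n t (fst p))" for p
  have diff: "upper_part n t z - upper_part n t w = (z - w) * Q (z, w)" for z w
    unfolding upper_part_def Q_def sum_subtractf[symmetric] sum_distrib_left[of "z - w"]
  proof (intro sum.cong refl)
    fix k
    have "z ^ (k + 1) - w ^ (k + 1) = (z - w) * (\<Sum>i<Suc k. z ^ i * w ^ (k - i))"
      using diff_power_eq_sum[of z k w] by simp
    then show "of_real (t k) * z ^ (k + 1) - of_real (t k) * w ^ (k + 1) =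
        (z - w) * (of_real (t k) * (\<Sum>i<Suc k. fst (z, w) ^ i * snd (z, w) ^ (k - i)))"
      unfolding right_diff_distrib[symmetric] by simp
  qed
  have "Q (z0, z0) = upper_deriv n t z0"
    unfolding Q_def upper_deriv_def by (intro sum.cong refl arg_cong2[of _ _ _ _ "(*)"]) (simp_all add: power_add[symmetric])
  then have g0: "g (z0, z0) \<noteq> 0" using assms(5) by (simp add: g_def)
  have "continuous_on (\<Omega> \<times> \<Omega>) g"
    unfolding g_def[abs_def] Q_def
    by (intro continuous_intros continuous_on_compose2[OF continuous_on_solve(1)[OF assms(2)]]) auto
  then have "open ((\<Omega> \<times> \<Omega>) \<inter> g -` (- {0}))"
    using assms(1) by (intro continuous_open_preimage open_Times) auto
  moreover have "(z0, z0) \<in> (\<Omega> \<times> \<Omega>) \<inter> g -` (- {0})" using g0 assms(3) by auto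
  ultimately obtain A B where AB: "open A" "open B" "(z0, z0) \<in> A \<times> B" "A \<times> B \<subseteq> (\<Omega> \<times> \<Omega>) \<inter> g -` (- {0})"
    by (rule open_prod_elim)
  have "z = w" if "z \<in> A \<inter> B" "w \<in> A \<inter> B" "solve0 n t z = solve0 n t w" "solve1 n t z = solve1 n t w" for z w
  proof (rule ccontr)
    assume "z \<noteq> w"
    have zw: "(z, w) \<in> A \<times> B" "z \<in> \<Omega>" "w \<in> \<Omega>" using that AB(4) by auto
    then have Im: "Im z \<noteq> 0" "Im w \<noteq> 0" using assms(2) by (auto simp: complex_is_Real_iff)
    have h1: "of_real (solve0 n t z) + of_real (solve1 n t z) * z + upper_part n t z = 0"
      using poly_prepend2_eq_0_iff[OF assms(4) Im(1), of "solve0 n t z" "solve1 n t z" t] unfolding poly_prepend2[OF assms(4)] by simp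
    have h2: "of_real (solve0 n t z) + of_real (solve1 n t z) * w + upper_part n t w = 0"
      using poly_prepend2_eq_0_iff[OF assms(4) Im(2), of "solve0 n t z" "solve1 n t z" t] that(3,4) unfolding poly_prepend2[OF assms(4)] by simp
    have "of_real (solve1 n t z) * (z - w) + (upper_part n t z - upper_part n t w) =
      (of_real (solve0 n t z) + of_real (solve1 n t z) * z + upper_part n t z) -
      (of_real (solve0 n t z) + of_real (solve1 n t z) * w + upper_part n t w)"
      by (simp add: algebra_simps)
    also have "\<dots> = 0" unfolding h1 h2 by simp
    finally have "(z - w) * g (z, w) = 0" unfolding diff by (simp add: g_def algebra_simps)
    then show False using \<open>z \<noteq> w\<close> zw(1) AB(4) by auto
  qed
  then show ?thesis using AB by (intro exI[of _ "A \<inter> B"]) (auto intro: open_Int)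
qed

text \<open>While only the two lowest coefficients vary, the degree is fixed by the highest nonzero
  \<open>t m\<close>, so lower semicontinuity applies and superlevel sets are open. If all
  \<open>t k\<close> vanish, the polynomial has no nonreal root unless it is zero, and then the
  count is 0 by convention.\<close>

lemma root_count_prepend2_measurable:
  assumes "n \<ge> 2" "open \<Omega>" "\<Omega> \<inter> \<real> = {}"
  shows "(\<lambda>w::real^2. real (root_count n \<Omega> (prepend2 (w $ 1) (w $ 2) t))) \<in> borel_measurable borel"
proof (cases "\<forall>k\<in>{1..n-1}. t k = 0")
  case True
  have "root_count n \<Omega> (prepend2 a0 a1 t) = 0" for a0 a1
  proof (cases "a0 = 0 \<and> a1 = 0")
    case z: True
    have "upper_part n t z = 0" for z using True unfolding upper_part_def by (intro sum.neutral) auto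
    then have "{z \<in> \<Omega>. poly (real_cpoly n (prepend2 a0 a1 t)) z = 0} = \<Omega>"
      using z poly_prepend2[OF assms(1)] by auto
    moreover have "\<Omega> = {} \<or> infinite \<Omega>" using assms(2) finite_imp_not_open by blast
    ultimately show ?thesis by (auto simp: root_count_def)
  next
    case nz: False
    have "upper_part n t z = 0" for z using True unfolding upper_part_def by (intro sum.neutral) auto
    then have "{z \<in> \<Omega>. poly (real_cpoly n (prepend2 a0 a1 t)) z = 0} = {}"
      using nz assms(3) poly_prepend2[OF assms(1)]
      by (auto simp: complex_is_Real_iff complex_eq_iff)
    then show ?thesis unfolding root_count_def by (simp only: card.empty)
  qed
  then show ?thesis by simp
next
  case False
  define m where "m = Max {k\<in>{1..n-1}. t k \<noteq> 0}"
  have fin: "finite {k\<in>{1..n-1}. t k \<noteq> 0}" "{k\<in>{1..n-1}. t k \<noteq> 0} \<noteq> {}" using False by auto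
  have m: "m \<in> {1..n-1}" "t m \<noteq> 0" using Max_in[OF fin] by (auto simp: m_def)
  have above: "t k = 0" if "k \<in> {1..n-1}" "k > m" for k
  proof (rule ccontr)
    assume "t k \<noteq> 0"
    then have "k \<in> {k\<in>{1..n-1}. t k \<noteq> 0}" using that(1) by simp
    from Max_ge[OF fin(1) this] show False using that(2) unfolding m_def by linarith
  qed
  define N where "N = Suc m"
  have coeffs: "real_cpoly n (prepend2 a0 a1 t) = real_cpoly N (prepend2 a0 a1 t)" for a0 a1
    using m(1) above by (auto simp: poly_eq_iff coeff_real_cpoly N_def prepend2_def)
  have top: "prepend2 a0 a1 t N \<noteq> 0" for a0 a1 using m by (auto simp: prepend2_def N_def)
  have eq: "root_count n \<Omega> (prepend2 a0 a1 t) = root_count N \<Omega> (prepend2 a0 a1 t)" for a0 a1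
    by (simp add: root_count_def coeffs)
  have "open {w::real^2. c < real (root_count n \<Omega> (prepend2 (w $ 1) (w $ 2) t))}" for c
    unfolding open_contains_ball
  proof
    fix w :: "real^2" assume w: "w \<in> {w. c < real (root_count n \<Omega> (prepend2 (w $ 1) (w $ 2) t))}"
    obtain \<delta> where \<delta>: "\<delta> > 0" "\<And>a'. (\<forall>i\<le>N. \<bar>a' i - prepend2 (w $ 1) (w $ 2) t i\<bar> < \<delta>) \<Longrightarrow>
        root_count N \<Omega> (prepend2 (w $ 1) (w $ 2) t) \<le> root_count N \<Omega> a'"
      using root_count_lower_semicontinuous[of "prepend2 (w $ 1) (w $ 2) t" N, OF top assms(2)] by blast
    have "ball w \<delta> \<subseteq> {w. c < real (root_count n \<Omega> (prepend2 (w $ 1) (w $ 2) t))}"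
    proof
      fix w' assume "w' \<in> ball w \<delta>"
      then have d: "dist w' w < \<delta>" by (simp add: dist_commute)
      have "\<bar>w' $ i - w $ i\<bar> < \<delta>" for i
        using order.strict_trans1[OF dist_vec_nth_le[of w' i w] d] by (simp add: dist_real_def)
      then have "\<forall>i\<le>N. \<bar>prepend2 (w' $ 1) (w' $ 2) t i - prepend2 (w $ 1) (w $ 2) t i\<bar> < \<delta>"
        using \<delta>(1) by (simp add: prepend2_def)
      from \<delta>(2)[OF this] show "w' \<in> {w. c < real (root_count n \<Omega> (prepend2 (w $ 1) (w $ 2) t))}"
        using w by (simp add: eq)
    qed
    then show "\<exists>e>0. ball w e \<subseteq> {w. c < real (root_count n \<Omega> (prepend2 (w $ 1) (w $ 2) t))}"
      using \<delta>(1) by blast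
  qed
  then show ?thesis by (subst borel_measurable_iff_greater) auto
qed

text \<open>The integrand over \<Omega> that the change of variables produces: the Jacobian,
  restricted to those \<open>z\<close> whose solved coefficients fall into the box of radius
  \<open>T\<close>.\<close>

definition root_density :: "nat \<Rightarrow> real \<Rightarrow> (nat \<Rightarrow> real) \<Rightarrow> complex \<Rightarrow> ennreal" where
  "root_density n T t z = indicator {-T..T} (solve0 n t z) * indicator {-T..T} (solve1 n t z) *
     ennreal ((cmod (upper_deriv n t z + of_real (solve1 n t z)))\<^sup>2 / \<bar>Im z\<bar>)"

lemma solve_borel:
  "solve1 n t \<in> borel_measurable borel" "solve0 n t \<in> borel_measurable borel" "upper_deriv n t \<in> borel_measurable borel"
proof -
  have [measurable]: "upper_part n t \<in> borel_measurable borel" "Re \<in> borel_measurable borel" "Im \<in> borel_measurable borel"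
    by (intro borel_measurable_continuous_onI continuous_on_upper continuous_intros)+
  show [measurable]: "solve1 n t \<in> borel_measurable borel"
    unfolding solve1_def[abs_def] by measurable
  show "solve0 n t \<in> borel_measurable borel"
    unfolding solve0_def[abs_def] by measurable
  show "upper_deriv n t \<in> borel_measurable borel"
    by (intro borel_measurable_continuous_onI continuous_on_upper)
qed

lemma root_density_borel: "root_density n T t \<in> borel_measurable borel"
proof -
  note [measurable] = solve_borel
  have [measurable]: "Im \<in> borel_measurable borel" by (intro borel_measurable_continuous_onI continuous_intros)
  show ?thesis unfolding root_density_def[abs_def] by measurable
qed

text \<open>The area formula for \<open>solve_vec\<close>: the fibre over a coefficient pair is the
  set of roots in \<Omega> of the polynomial with this pair as lowest coefficients.\<close>

lemma root_count_area:
  assumes "n \<ge> 2" "open \<Omega>" "\<Omega> \<inter> \<real> = {}"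
  shows "(\<integral>\<^sup>+x. indicator {-T..T} x * (\<integral>\<^sup>+y. indicator {-T..T} y * ennreal (real (root_count n \<Omega> (prepend2 x y t))) \<partial>lborel) \<partial>lborel)
    = (\<integral>\<^sup>+z. indicator \<Omega> z * root_density n T t z \<partial>lborel)"
proof -
  define U where "U = complex_of_vec -` \<Omega>"
  define J where "J x = (cmod (upper_deriv n t (complex_of_vec x) + of_real (solve1 n t (complex_of_vec x))))\<^sup>2 / \<bar>Im (complex_of_vec x)\<bar>" for x
  define B where "B = {w::real^2. w $ 1 \<in> {-T..T} \<and> w $ 2 \<in> {-T..T}}"
  have Im0: "x $ 2 \<noteq> 0" if "x \<in> U" for x :: "real^2"
    using that assms(3) by (auto simp: U_def complex_is_Real_iff disjoint_iff)
  have contc: "continuous_on S complex_of_vec" for S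
    by (intro linear_continuous_on bounded_linear_complex_of_vec)
  have openU: "open U" unfolding U_def using assms(2) contc by (intro open_vimage)
  have "\<forall>x. \<exists>D. x \<in> U \<longrightarrow> (solve_vec n t has_derivative D) (at x) \<and> \<bar>det (matrix D)\<bar> = J x"
    using solve_vec_derivative Im0 unfolding J_def by blast
  from choice[OF this] obtain f' where f': "\<And>x. x \<in> U \<Longrightarrow> (solve_vec n t has_derivative f' x) (at x)"
    "\<And>x. x \<in> U \<Longrightarrow> \<bar>det (matrix (f' x))\<bar> = J x" by blast
  have contJ: "continuous_on U J"
  proof -
    have c1: "continuous_on U (\<lambda>x. upper_deriv n t (complex_of_vec x))"
      by (rule continuous_on_compose2[OF continuous_on_upper(2)[of UNIV] contc]) auto
    have c2: "continuous_on U (\<lambda>x. solve1 n t (complex_of_vec x))"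
      by (rule continuous_on_compose2[OF continuous_on_solve(1)[OF assms(3)] contc]) (auto simp: U_def)
    have c3: "continuous_on U (\<lambda>x. Im (complex_of_vec x))" by (intro continuous_intros contc)
    show ?thesis unfolding J_def[abs_def] by (intro continuous_intros c1 c2 c3) (use Im0 in auto)
  qed
  have inj: "\<exists>W. open W \<and> x \<in> W \<and> inj_on (solve_vec n t) W" if x: "x \<in> U" "J x \<noteq> 0" for x
  proof -
    have "complex_of_vec x \<in> \<Omega>" "upper_deriv n t (complex_of_vec x) + of_real (solve1 n t (complex_of_vec x)) \<noteq> 0"
      using x by (auto simp: U_def J_def)
    from solve_locally_injective[OF assms(2,3) this(1) assms(1) this(2)] obtain W where W:
      "open W" "complex_of_vec x \<in> W"
      "\<And>z w. z \<in> W \<Longrightarrow> w \<in> W \<Longrightarrow> solve0 n t z = solve0 n t w \<Longrightarrow> solve1 n t z = solve1 n t w \<Longrightarrow> z = w" by blast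
    have "inj_on (solve_vec n t) (complex_of_vec -` W)"
    proof (rule inj_onI)
      fix x y assume xy: "x \<in> complex_of_vec -` W" "y \<in> complex_of_vec -` W" "solve_vec n t x = solve_vec n t y"
      then have "complex_of_vec x = complex_of_vec y"
        by (intro W(3)) (auto simp: solve_vec_def real2_eq_iff)
      then show "x = y" by (rule injD[OF inj_complex_of_vec])
    qed
    then show ?thesis using W(1,2) contc by (intro exI[of _ "complex_of_vec -` W"]) (auto intro: open_vimage)
  qed
  have "B = cbox (vector [-T, -T]) (vector [T, T])" by (auto simp: B_def mem_box Basis_real2 inner_axis)
  then have B: "B \<in> sets borel" "bounded B" by auto
  have img: "complex_of_vec ` {x\<in>U. solve_vec n t x = w} = {z\<in>\<Omega>. poly (real_cpoly n (prepend2 (w $ 1) (w $ 2) t)) z = 0}" for w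
  proof -
    have "solve_vec n t x = w \<longleftrightarrow> poly (real_cpoly n (prepend2 (w $ 1) (w $ 2) t)) (complex_of_vec x) = 0" if "x \<in> U" for x
      using poly_prepend2_eq_0_iff[OF assms(1), of "complex_of_vec x"] Im0[OF that]
      by (auto simp: solve_vec_def real2_eq_iff)
    note iff = this
    show ?thesis
    proof (intro subset_antisym subsetI)
      fix z assume "z \<in> complex_of_vec ` {x\<in>U. solve_vec n t x = w}"
      then obtain x where "x \<in> U" "solve_vec n t x = w" "z = complex_of_vec x" by blast
      then show "z \<in> {z\<in>\<Omega>. poly (real_cpoly n (prepend2 (w $ 1) (w $ 2) t)) z = 0}"
        using iff[of x] by (simp add: U_def)
    next
      fix z assume z: "z \<in> {z\<in>\<Omega>. poly (real_cpoly n (prepend2 (w $ 1) (w $ 2) t)) z = 0}"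
      define x where "x = (vector [Re z, Im z] :: real^2)"
      have zx: "z = complex_of_vec x" unfolding x_def by (rule complex_of_vec_vector[symmetric])
      have "x \<in> U" using z zx by (simp add: U_def)
      then have "x \<in> {x\<in>U. solve_vec n t x = w}" using z zx iff[of x] by simp
      then show "z \<in> complex_of_vec ` {x\<in>U. solve_vec n t x = w}" unfolding zx by (rule imageI)
    qed
  qed
  have cnt: "finite {x\<in>U. solve_vec n t x = w} \<and> root_count n \<Omega> (prepend2 (w $ 1) (w $ 2) t) = card {x\<in>U. solve_vec n t x = w}"
    if w: "w \<notin> solve_vec n t ` {x\<in>U. J x = 0}" for w
  proof
    have injc: "inj_on complex_of_vec A" for A using inj_complex_of_vec by (rule inj_on_subset) auto
    show "root_count n \<Omega> (prepend2 (w $ 1) (w $ 2) t) = card {x\<in>U. solve_vec n t x = w}"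
      unfolding root_count_def img[symmetric] by (rule card_image[OF injc])
    have "finite {z\<in>\<Omega>. poly (real_cpoly n (prepend2 (w $ 1) (w $ 2) t)) z = 0}"
    proof (cases "real_cpoly n (prepend2 (w $ 1) (w $ 2) t) = 0")
      case True
      \<comment> \<open>For the zero polynomial the map is constantly \<open>w\<close> with zero
        Jacobian, so \<open>w\<close> would be a critical value unless \<Omega> is empty.\<close>
      then have z: "\<And>i. i \<le> n \<Longrightarrow> prepend2 (w $ 1) (w $ 2) t i = 0" by (simp add: real_cpoly_eq_0_iff)
      have "t k = 0" if "k \<in> {1..n-1}" for k using z[of "Suc k"] that by (auto simp: prepend2_def)
      then have U0: "upper_part n t z = 0" "upper_deriv n t z = 0" for z
        unfolding upper_part_def upper_deriv_def by (auto intro: sum.neutral)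
      have "w $ 1 = 0" "w $ 2 = 0" using z[of 0] z[of 1] assms(1) by (auto simp: prepend2_def)
      then have "solve_vec n t x = w" "J x = 0" for x
        by (simp_all add: solve_vec_def J_def solve0_def solve1_def U0 real2_eq_iff)
      then have "U = {}" using w by auto
      then show ?thesis unfolding img[symmetric] by simp
    qed (rule finite_roots)
    then show "finite {x\<in>U. solve_vec n t x = w}"
      unfolding img[symmetric] by (rule finite_imageD[OF _ injc])
  qed
  have "(\<integral>\<^sup>+w. indicator B w * ennreal (real (root_count n \<Omega> (prepend2 (w $ 1) (w $ 2) t))) \<partial>lborel) =
    (\<integral>\<^sup>+x. indicator U x * indicator B (solve_vec n t x) * ennreal (J x) \<partial>lborel)"
    by (rule area_formula[OF openU f' contJ inj B cnt])
  also have "\<dots> = (\<integral>\<^sup>+x. indicator \<Omega> (Complex (x $ 1) (x $ 2)) * root_density n T t (Complex (x $ 1) (x $ 2)) \<partial>(lborel :: (real^2) measure))"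
    by (intro nn_integral_cong) (auto simp: U_def B_def J_def root_density_def solve_vec_def complex_of_vec_def indicator_def)
  also have "\<dots> = (\<integral>\<^sup>+z. indicator \<Omega> z * root_density n T t z \<partial>lborel)"
    using assms(2) root_density_borel by (intro nn_integral_real2_complex borel_measurable_times) auto
  also have "(\<integral>\<^sup>+w. indicator B w * ennreal (real (root_count n \<Omega> (prepend2 (w $ 1) (w $ 2) t))) \<partial>lborel)
    = (\<integral>\<^sup>+x. \<integral>\<^sup>+y. indicator B (vector [x, y]) * ennreal (real (root_count n \<Omega> (prepend2 x y t))) \<partial>lborel \<partial>lborel)"
    using B(1) root_count_prepend2_measurable[OF assms] by (subst nn_integral_real2) auto
  also have "\<dots> = (\<integral>\<^sup>+x. indicator {-T..T} x * (\<integral>\<^sup>+y. indicator {-T..T} y * ennreal (real (root_count n \<Omega> (prepend2 x y t))) \<partial>lborel) \<partial>lborel)"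
  proof (rule nn_integral_cong)
    fix x
    show "(\<integral>\<^sup>+y. indicator B (vector [x, y]) * ennreal (real (root_count n \<Omega> (prepend2 x y t))) \<partial>lborel) =
      indicator {-T..T} x * (\<integral>\<^sup>+y. indicator {-T..T} y * ennreal (real (root_count n \<Omega> (prepend2 x y t))) \<partial>lborel)"
      by (cases "x \<in> {-T..T}") (auto intro!: nn_integral_cong simp: B_def indicator_def)
  qed
  finally show ?thesis .
qed

section \<open>Integration over the upper coefficients\<close>

abbreviation coeff_space :: "nat \<Rightarrow> (nat \<Rightarrow> real) measure" where
  "coeff_space n \<equiv> PiM {1..n-1} (\<lambda>_. lborel)"

lemma measurable_solve_joint:
  "(\<lambda>p. solve1 n (fst p) (snd p)) \<in> borel_measurable (coeff_space n \<Otimes>\<^sub>M borel)"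
  "(\<lambda>p. solve0 n (fst p) (snd p)) \<in> borel_measurable (coeff_space n \<Otimes>\<^sub>M borel)"
  "(\<lambda>p. upper_deriv n (fst p) (snd p)) \<in> borel_measurable (coeff_space n \<Otimes>\<^sub>M borel)"
proof -
  have [measurable]: "Re \<in> borel_measurable borel" "Im \<in> borel_measurable borel"
    by (intro borel_measurable_continuous_onI continuous_intros)+
  have [measurable]: "(\<lambda>p. fst p k) \<in> borel_measurable (coeff_space n \<Otimes>\<^sub>M borel)" if "k \<in> {1..n-1}" for k
    using that by measurable
  have [measurable]: "(\<lambda>p. upper_part n (fst p) (snd p)) \<in> borel_measurable (coeff_space n \<Otimes>\<^sub>M borel)"
    unfolding upper_part_def by measurable
  show [measurable]: "(\<lambda>p. solve1 n (fst p) (snd p)) \<in> borel_measurable (coeff_space n \<Otimes>\<^sub>M borel)"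
    unfolding solve1_def by measurable
  show "(\<lambda>p. solve0 n (fst p) (snd p)) \<in> borel_measurable (coeff_space n \<Otimes>\<^sub>M borel)"
    unfolding solve0_def by measurable
  show "(\<lambda>p. upper_deriv n (fst p) (snd p)) \<in> borel_measurable (coeff_space n \<Otimes>\<^sub>M borel)"
    unfolding upper_deriv_def by measurable
qed

lemma measurable_root_density_joint:
  "(\<lambda>p. root_density n T (fst p) (snd p)) \<in> borel_measurable (coeff_space n \<Otimes>\<^sub>M borel)"
proof -
  note [measurable] = measurable_solve_joint
  have [measurable]: "Im \<in> borel_measurable borel" by (intro borel_measurable_continuous_onI continuous_intros)
  show ?thesis unfolding root_density_def by measurable
qed

definition box_indicator :: "nat set \<Rightarrow> real \<Rightarrow> (nat \<Rightarrow> real) \<Rightarrow> ennreal" where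
  "box_indicator I T t = (\<Prod>k\<in>I. indicator {-T..T} (t k))"

lemma measurable_box_indicator [measurable]: "box_indicator I T \<in> borel_measurable (PiM I (\<lambda>_. lborel))"
  unfolding box_indicator_def[abs_def] by measurable

lemma box_indicator_eq: "finite I \<Longrightarrow> box_indicator I T t = (if \<forall>k\<in>I. \<bar>t k\<bar> \<le> T then 1 else 0)"
proof -
  assume I: "finite I"
  have ind: "indicator {-T..T} x = (if \<bar>x\<bar> \<le> T then 1 else 0 :: ennreal)" for x
    by (auto simp: indicator_def)
  show ?thesis
  proof (cases "\<forall>k\<in>I. \<bar>t k\<bar> \<le> T")
    case True
    then show ?thesis unfolding box_indicator_def ind by (auto intro: prod.neutral)
  next
    case False
    then obtain k where "k \<in> I" "\<not> \<bar>t k\<bar> \<le> T" by blast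
    then have zero: "(\<Prod>k\<in>I. indicator {-T..T} (t k) :: ennreal) = 0"
      using I unfolding ind by (intro prod_zero) auto
    show ?thesis unfolding box_indicator_def zero if_not_P[OF False] ..
  qed
qed

lemma nn_integral_box_indicator:
  assumes "finite I" "T \<ge> 0"
  shows "(\<integral>\<^sup>+t. box_indicator I T t \<partial>PiM I (\<lambda>_. lborel)) = ennreal (2 * T) ^ card I"
proof -
  have "(\<integral>\<^sup>+t. box_indicator I T t \<partial>PiM I (\<lambda>_. lborel)) = (\<Prod>k\<in>I. \<integral>\<^sup>+x. indicator {-T..T} x \<partial>lborel)"
    unfolding box_indicator_def using assms(1) by (intro lborel_product.product_nn_integral_prod) auto
  also have "(\<integral>\<^sup>+x. indicator {-T..T} x \<partial>lborel) = ennreal (2 * T)" using assms(2) by simp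
  finally show ?thesis by simp
qed

lemma upper_scale:
  assumes "\<And>k. k \<in> {1..n-1} \<Longrightarrow> s k = c * t k"
  shows "upper_part n s z = of_real c * upper_part n t z" "upper_deriv n s z = of_real c * upper_deriv n t z"
    "solve1 n s z = c * solve1 n t z" "solve0 n s z = c * solve0 n t z"
proof -
  show u: "upper_part n s z = of_real c * upper_part n t z" "upper_deriv n s z = of_real c * upper_deriv n t z"
    unfolding upper_part_def upper_deriv_def sum_distrib_left
    by (intro sum.cong refl; simp add: assms mult_ac)+
  show s1: "solve1 n s z = c * solve1 n t z" by (simp add: solve1_def u)
  show "solve0 n s z = c * solve0 n t z" by (simp add: solve0_def u s1 algebra_simps)
qed

lemma root_density_scale:
  assumes "T > 0" "\<And>k. k \<in> {1..n-1} \<Longrightarrow> s k = T * t k"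
  shows "root_density n T s z = ennreal (T\<^sup>2) * root_density n 1 t z"
proof -
  have ind: "indicator {-T..T} (T * a) = (indicator {-1..1} a :: ennreal)" for a
  proof -
    have "T * a \<in> {-T..T} \<longleftrightarrow> a \<in> {-1..1}"
      using assms(1) mult_le_cancel_left_pos[of T a 1] mult_le_cancel_left_pos[of T "-1" a] by auto
    then show ?thesis by (simp add: indicator_def)
  qed
  have "cmod (of_real T * upper_deriv n t z + of_real (T * solve1 n t z)) = T * cmod (upper_deriv n t z + of_real (solve1 n t z))"
  proof -
    have "of_real T * upper_deriv n t z + of_real (T * solve1 n t z) = of_real T * (upper_deriv n t z + of_real (solve1 n t z))"
      by (simp add: distrib_left)
    then show ?thesis using assms(1) by (simp add: norm_mult)
  qed
  then have "(cmod (of_real T * upper_deriv n t z + of_real (T * solve1 n t z)))\<^sup>2 / \<bar>Im z\<bar> =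
    T\<^sup>2 * ((cmod (upper_deriv n t z + of_real (solve1 n t z)))\<^sup>2 / \<bar>Im z\<bar>)"
    by (simp add: power_mult_distrib)
  note sq = this
  have up: "upper_deriv n s z = of_real T * upper_deriv n t z" "solve1 n s z = T * solve1 n t z" "solve0 n s z = T * solve0 n t z"
    using upper_scale[of n s T t z] assms(2) by blast+
  show ?thesis unfolding root_density_def up ind sq
    by (subst ennreal_mult') (simp_all add: mult_ac)
qed

text \<open>The complex number whose modulus is bounded in \<open>D_set\<close> is real: it equals
  \<open>- solve0\<close>. The last condition concerns \<open>- solve1\<close>. So
  \<open>D_set\<close> says that all coefficients of the polynomial lie in
  \<open>[-1, 1]\<close>.\<close>

lemma D_set_iff:
  assumes "Im z \<noteq> 0" "t \<in> space (coeff_space n)"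
  shows "t \<in> D_set n z \<longleftrightarrow> (\<forall>k\<in>{1..n-1}. \<bar>t k\<bar> \<le> 1) \<and> \<bar>solve0 n t z\<bar> \<le> 1 \<and> \<bar>solve1 n t z\<bar> \<le> 1"
proof -
  have s1: "(1 / Im z) * (\<Sum>k=1..n-1. t k * Im (z ^ (k+1))) = - solve1 n t z"
    by (simp add: solve1_def upper_part_def del: power_Suc)
  have s1': "of_real (solve1 n t z) = - (\<Sum>k=1..n-1. complex_of_real (t k) * of_real (Im (z ^ (k+1)) / Im z))"
  proof -
    have "solve1 n t z = - (\<Sum>k=1..n-1. t k * (Im (z ^ (k+1)) / Im z))"
      using s1 by (simp add: sum_divide_distrib[symmetric] del: power_Suc)
    then show ?thesis by (simp del: power_Suc)
  qed
  have "z * (\<Sum>k=1..n-1. of_real (t k) * (z ^ k - of_real (Im (z ^ (k+1)) / Im z)))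
    = upper_part n t z + of_real (solve1 n t z) * z"
    unfolding s1' upper_part_def by (simp add: right_diff_distrib sum_subtractf sum_distrib_left mult_ac)
  also have "\<dots> = - of_real (solve0 n t z)"
    using assms(1) by (auto simp: complex_eq_iff solve0_def solve1_def)
  finally have s0: "cmod (z * (\<Sum>k=1..n-1. of_real (t k) * (z ^ k - of_real (Im (z ^ (k+1)) / Im z)))) = \<bar>solve0 n t z\<bar>"
    by simp
  show ?thesis using assms(2) unfolding D_set_def mem_Collect_eq s0 s1 by (simp add: space_PiM)
qed

lemma psi_integrand:
  "(\<Sum>k=1..n-1. of_real (t k) * (of_nat (k+1) * z ^ k - of_real (Im (z ^ (k+1)) / Im z)))
    = upper_deriv n t z + of_real (solve1 n t z)"
proof -
  have "solve1 n t z = - (\<Sum>k=1..n-1. t k * (Im (z ^ (k+1)) / Im z))"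
    by (simp add: solve1_def upper_part_def sum_divide_distrib del: power_Suc)
  then have "of_real (solve1 n t z) = - (\<Sum>k=1..n-1. complex_of_real (t k) * of_real (Im (z ^ (k+1)) / Im z))"
    by (simp del: power_Suc)
  then show ?thesis unfolding upper_deriv_def by (simp add: right_diff_distrib sum_subtractf del: power_Suc)
qed

text \<open>Since \<open>psi\<close> is a Bochner integral, with default value 0 in the absence of
  integrability, finiteness has to be established: on the box the integrand is at most
  \<open>K\<^sup>2\<close> for fixed \<open>z\<close>.\<close>

lemma psi_eq_nn_integral:
  assumes "Im z \<noteq> 0"
  shows "(\<integral>\<^sup>+t. box_indicator {1..n-1} 1 t * root_density n 1 t z \<partial>coeff_space n) = ennreal (psi n z)"
proof -
  define g where "g t = (cmod (upper_deriv n t z + of_real (solve1 n t z)))\<^sup>2" for t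
  define h where "h t = indicat_real (D_set n z) t * g t" for t
  have sec: "(\<lambda>t. (t, z)) \<in> coeff_space n \<rightarrow>\<^sub>M coeff_space n \<Otimes>\<^sub>M borel" by measurable
  have [measurable]: "(\<lambda>t. solve1 n t z) \<in> borel_measurable (coeff_space n)"
    "(\<lambda>t. solve0 n t z) \<in> borel_measurable (coeff_space n)"
    "(\<lambda>t. upper_deriv n t z) \<in> borel_measurable (coeff_space n)"
    using measurable_compose[OF sec measurable_solve_joint(1)] measurable_compose[OF sec measurable_solve_joint(2)]
      measurable_compose[OF sec measurable_solve_joint(3)] by simp_all
  have [measurable]: "g \<in> borel_measurable (coeff_space n)" unfolding g_def[abs_def] by measurable
  \<comment> \<open>The indicator of \<open>D_set\<close> in a form built from measurable functions;
    the two agree on the space of the product measure.\<close>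
  define ind where "ind t = (\<Prod>k\<in>{1..n-1}. indicat_real {-1..1} (t k)) * indicat_real {-1..1} (solve0 n t z) * indicat_real {-1..1} (solve1 n t z)" for t
  have [measurable]: "ind \<in> borel_measurable (coeff_space n)" unfolding ind_def[abs_def] by measurable
  have ind_D: "indicat_real (D_set n z) t = ind t" if "t \<in> space (coeff_space n)" for t
  proof -
    have i1: "indicat_real {-1..1} x = (if \<bar>x\<bar> \<le> 1 then 1 else 0)" for x :: real by (auto simp: indicator_def abs_le_iff)
    show ?thesis
    proof (cases "\<forall>k\<in>{1..n-1}. \<bar>t k\<bar> \<le> 1")
      case True
      then have "(\<Prod>k\<in>{1..n-1}. indicat_real {-1..1} (t k)) = 1" unfolding i1 by (intro prod.neutral) auto
      then show ?thesis using True D_set_iff[OF assms that] unfolding ind_def i1 by (simp add: indicator_def)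
    next
      case False
      then obtain k where "k \<in> {1..n-1}" "\<not> \<bar>t k\<bar> \<le> 1" by blast
      then have zero: "(\<Prod>k\<in>{1..n-1}. indicat_real {-1..1} (t k)) = 0" unfolding i1 by (intro prod_zero) auto
      have "t \<notin> D_set n z" using False D_set_iff[OF assms that] by blast
      then show ?thesis unfolding ind_def zero by simp
    qed
  qed
  have h: "h \<in> borel_measurable (coeff_space n)"
  proof -
    have "(\<lambda>t. ind t * g t) \<in> borel_measurable (coeff_space n)" by measurable
    moreover have "h t = ind t * g t" if "t \<in> space (coeff_space n)" for t by (simp add: h_def ind_D[OF that])
    ultimately show ?thesis by (subst measurable_cong)
  qed
  define w where "w k = of_nat (k+1) * z ^ k - of_real (Im (z ^ (k+1)) / Im z)" for k
  \<comment> \<open>By the triangle inequality this bounds the derivative at \<open>z\<close> over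
    all \<open>t\<close> with entries in \<open>[-1, 1]\<close>.\<close>
  define K where "K = (\<Sum>k=1..n-1. cmod (w k))"
  have box: "ennreal (h t) \<le> box_indicator {1..n-1} 1 t * ennreal (K\<^sup>2)" if t: "t \<in> space (coeff_space n)" for t
  proof (cases "t \<in> D_set n z")
    case True
    then have le1: "\<forall>k\<in>{1..n-1}. \<bar>t k\<bar> \<le> 1" using D_set_iff[OF assms t] by blast
    have "cmod (upper_deriv n t z + of_real (solve1 n t z)) = cmod (\<Sum>k=1..n-1. of_real (t k) * w k)"
      unfolding w_def psi_integrand ..
    also have "\<dots> \<le> (\<Sum>k=1..n-1. \<bar>t k\<bar> * cmod (w k))"
      by (rule order.trans[OF norm_sum]) (simp add: norm_mult)
    also have "\<dots> \<le> K" unfolding K_def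
      using le1 by (intro sum_mono) (simp add: mult_left_le_one_le)
    finally have "g t \<le> K\<^sup>2" unfolding g_def by (intro power_mono) auto
    then show ?thesis using True le1 by (simp add: h_def box_indicator_eq ennreal_leI)
  qed (simp add: h_def)
  have "(\<integral>\<^sup>+t. ennreal (h t) \<partial>coeff_space n) \<le> (\<integral>\<^sup>+t. box_indicator {1..n-1} 1 t * ennreal (K\<^sup>2) \<partial>coeff_space n)"
    by (intro nn_integral_mono box)
  also have "\<dots> = ennreal 2 ^ (n - 1) * ennreal (K\<^sup>2)"
    by (subst nn_integral_multc) (simp_all add: nn_integral_box_indicator)
  also have "\<dots> < \<infinity>" by (simp add: ennreal_mult_less_top power_less_top_ennreal)
  finally have fin: "(\<integral>\<^sup>+t. ennreal (h t) \<partial>coeff_space n) < \<infinity>" .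
  have h0: "h t \<ge> 0" for t by (simp add: h_def g_def)
  have int: "integrable (coeff_space n) h" using fin h h0 by (intro integrableI_nonneg) auto
  have "psi n z = (1 / \<bar>Im z\<bar>) * integral\<^sup>L (coeff_space n) h"
    unfolding psi_def set_lebesgue_integral_def psi_integrand h_def g_def by simp
  then have "ennreal (psi n z) = ennreal (1 / \<bar>Im z\<bar>) * (\<integral>\<^sup>+t. ennreal (h t) \<partial>coeff_space n)"
    using nn_integral_eq_integral[OF int] h0
    by (simp only: ennreal_mult'[of "1 / \<bar>Im z\<bar>"] zero_le_divide_1_iff abs_ge_zero AE_I2)
  also have "\<dots> = (\<integral>\<^sup>+t. ennreal (1 / \<bar>Im z\<bar>) * ennreal (h t) \<partial>coeff_space n)"
    using h by (intro nn_integral_cmult[symmetric]) auto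
  also have "\<dots> = (\<integral>\<^sup>+t. box_indicator {1..n-1} 1 t * root_density n 1 t z \<partial>coeff_space n)"
  proof (rule nn_integral_cong)
    fix t assume t: "t \<in> space (coeff_space n)"
    have i1: "indicator {-1..1} x = (if \<bar>x\<bar> \<le> 1 then 1 else 0 :: ennreal)" for x :: real by (auto simp: indicator_def abs_le_iff)
    show "ennreal (1 / \<bar>Im z\<bar>) * ennreal (h t) = box_indicator {1..n-1} 1 t * root_density n 1 t z"
    proof (cases "t \<in> D_set n z")
      case True
      have "ennreal (1 / \<bar>Im z\<bar>) * ennreal (g t) = ennreal (g t / \<bar>Im z\<bar>)"
        by (subst ennreal_mult'[symmetric]) auto
      then show ?thesis using True D_set_iff[OF assms t]
        by (simp add: h_def box_indicator_eq root_density_def i1 g_def)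
    next
      case False
      then show ?thesis using D_set_iff[OF assms t]
        by (auto simp: h_def box_indicator_eq root_density_def i1)
    qed
  qed
  finally show ?thesis ..
qed

text \<open>Rescaling \<open>n - 1\<close> variables gives \<open>T ^ (n - 1)\<close>. The solved
  coefficients and the derivative are homogeneous of degree one in \<open>t\<close>, so the box
  constraints rescale too and the squared derivative adds \<open>T\<^sup>2\<close>.\<close>

lemma root_density_space_integral:
  assumes "n \<ge> 2" "T > 0"
  shows "(\<integral>\<^sup>+t. box_indicator {1..n-1} T t * root_density n T t z \<partial>coeff_space n)
    = ennreal T ^ (n + 1) * (\<integral>\<^sup>+t. box_indicator {1..n-1} 1 t * root_density n 1 t z \<partial>coeff_space n)"
proof -
  have sec: "(\<lambda>t. (t, z)) \<in> coeff_space n \<rightarrow>\<^sub>M coeff_space n \<Otimes>\<^sub>M borel" by measurable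
  have m[measurable]: "(\<lambda>t. root_density n T t z) \<in> borel_measurable (coeff_space n)" for T
    using measurable_compose[OF sec measurable_root_density_joint] by simp
  have mm: "(\<lambda>t. box_indicator {1..n-1} T t * root_density n T t z) \<in> borel_measurable (coeff_space n)" by measurable
  have c: "card {1..n-1} = n - 1" by simp
  have "(\<integral>\<^sup>+t. box_indicator {1..n-1} T t * root_density n T t z \<partial>coeff_space n)
    = ennreal T ^ (n - 1) * (\<integral>\<^sup>+t. box_indicator {1..n-1} T (\<lambda>i\<in>{1..n-1}. T * t i) * root_density n T (\<lambda>i\<in>{1..n-1}. T * t i) z \<partial>coeff_space n)"
    by (rule nn_integral_PiM_scale[OF finite_atLeastAtMost assms(2) mm, unfolded c])
  also have "(\<integral>\<^sup>+t. box_indicator {1..n-1} T (\<lambda>i\<in>{1..n-1}. T * t i) * root_density n T (\<lambda>i\<in>{1..n-1}. T * t i) z \<partial>coeff_space n)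
    = (\<integral>\<^sup>+t. ennreal (T\<^sup>2) * (box_indicator {1..n-1} 1 t * root_density n 1 t z) \<partial>coeff_space n)"
  proof (rule nn_integral_cong)
    fix t
    have "box_indicator {1..n-1} T (\<lambda>i\<in>{1..n-1}. T * t i) = box_indicator {1..n-1} 1 t"
    proof -
      have "\<bar>T * x\<bar> \<le> T \<longleftrightarrow> \<bar>x\<bar> \<le> 1" for x using assms(2) by (simp add: abs_mult)
      then show ?thesis by (simp add: box_indicator_eq)
    qed
    moreover have "root_density n T (\<lambda>i\<in>{1..n-1}. T * t i) z = ennreal (T\<^sup>2) * root_density n 1 t z"
      using assms(2) by (intro root_density_scale) auto
    ultimately show "box_indicator {1..n-1} T (\<lambda>i\<in>{1..n-1}. T * t i) * root_density n T (\<lambda>i\<in>{1..n-1}. T * t i) z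
      = ennreal (T\<^sup>2) * (box_indicator {1..n-1} 1 t * root_density n 1 t z)"
      by (simp add: mult_ac)
  qed
  also have "\<dots> = ennreal (T\<^sup>2) * (\<integral>\<^sup>+t. box_indicator {1..n-1} 1 t * root_density n 1 t z \<partial>coeff_space n)"
    by (rule nn_integral_cmult) measurable
  also have "ennreal (T\<^sup>2) = ennreal T ^ 2" using assms(2) by (simp add: ennreal_power)
  also have "ennreal T ^ (n - 1) * (ennreal T ^ 2 * (\<integral>\<^sup>+t. box_indicator {1..n-1} 1 t * root_density n 1 t z \<partial>coeff_space n))
    = ennreal T ^ (n - 1 + 2) * (\<integral>\<^sup>+t. box_indicator {1..n-1} 1 t * root_density n 1 t z \<partial>coeff_space n)"
    unfolding power_add by (simp only: mult.assoc)
  also have "n - 1 + 2 = n + 1" using assms(1) by simp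
  finally show ?thesis .
qed

text \<open>Tonelli's theorem exchanges the integrals over \<open>t\<close> and \<open>z\<close>;
  for fixed \<open>z\<close> the inner one is \<open>psi n z\<close> up to the power of
  \<open>T\<close>. Measurability of \<open>psi\<close> on \<Omega> falls out as that of a partial
  integral of a jointly measurable function.\<close>

lemma root_count_box_integral:
  assumes "n \<ge> 2" "open \<Omega>" "\<Omega> \<inter> \<real> = {}" "T > 0"
  shows "(\<integral>\<^sup>+t. box_indicator {1..n-1} T t * (\<integral>\<^sup>+x. indicator {-T..T} x * (\<integral>\<^sup>+y. indicator {-T..T} y *
      ennreal (real (root_count n \<Omega> (prepend2 x y t))) \<partial>lborel) \<partial>lborel) \<partial>coeff_space n)
    = ennreal T ^ (n + 1) * (\<integral>\<^sup>+z. indicator \<Omega> z * ennreal (psi n z) \<partial>lborel)"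
    and "(\<lambda>t. \<integral>\<^sup>+x. indicator {-T..T} x * (\<integral>\<^sup>+y. indicator {-T..T} y *
      ennreal (real (root_count n \<Omega> (prepend2 x y t))) \<partial>lborel) \<partial>lborel) \<in> borel_measurable (coeff_space n)"
    and "(\<lambda>z. indicator \<Omega> z * ennreal (psi n z)) \<in> borel_measurable lborel"
proof -
  have [measurable]: "\<Omega> \<in> sets borel" using assms(2) by simp
  note joint[measurable] = measurable_root_density_joint
  interpret P: finite_product_sigma_finite "\<lambda>_. lborel" "{1..n-1}" by standard auto
  interpret pair: pair_sigma_finite "coeff_space n" "lborel :: complex measure" ..
  have m2: "(\<lambda>p. indicator \<Omega> (snd p) * root_density n T (fst p) (snd p)) \<in> borel_measurable (coeff_space n \<Otimes>\<^sub>M lborel)" for T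
    by measurable
  show meas: "(\<lambda>t. \<integral>\<^sup>+x. indicator {-T..T} x * (\<integral>\<^sup>+y. indicator {-T..T} y *
      ennreal (real (root_count n \<Omega> (prepend2 x y t))) \<partial>lborel) \<partial>lborel) \<in> borel_measurable (coeff_space n)"
    unfolding root_count_area[OF assms(1-3)]
    using lborel.borel_measurable_nn_integral[of "\<lambda>t z. indicator \<Omega> z * root_density n T t z" "coeff_space n"] m2
    by (simp add: case_prod_beta')
  have inner: "(\<integral>\<^sup>+t. box_indicator {1..n-1} T t * (indicator \<Omega> z * root_density n T t z) \<partial>coeff_space n)
      = ennreal T ^ (n + 1) * (indicator \<Omega> z * ennreal (psi n z))" if "T > 0" for z T
  proof (cases "z \<in> \<Omega>")
    case True
    then have "Im z \<noteq> 0" using assms(3) by (auto simp: complex_is_Real_iff)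
    then show ?thesis using True root_density_space_integral[OF assms(1) that] psi_eq_nn_integral by simp
  qed simp
  have m3: "(\<lambda>p. box_indicator {1..n-1} T (fst p) * (indicator \<Omega> (snd p) * root_density n T (fst p) (snd p))) \<in> borel_measurable (coeff_space n \<Otimes>\<^sub>M lborel)" for T
    by measurable
  have "(\<lambda>z. \<integral>\<^sup>+t. box_indicator {1..n-1} 1 t * (indicator \<Omega> z * root_density n 1 t z) \<partial>coeff_space n) \<in> borel_measurable lborel"
    using P.borel_measurable_nn_integral[of "\<lambda>z t. box_indicator {1..n-1} 1 t * (indicator \<Omega> z * root_density n 1 t z)" lborel]
      measurable_compose[OF measurable_pair_swap' m3[of 1]] by (simp only: case_prod_beta' fst_conv snd_conv)
  then show psi_meas: "(\<lambda>z. indicator \<Omega> z * ennreal (psi n z)) \<in> borel_measurable lborel"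
    unfolding inner[OF zero_less_one] by simp
  have "(\<integral>\<^sup>+t. box_indicator {1..n-1} T t * (\<integral>\<^sup>+x. indicator {-T..T} x * (\<integral>\<^sup>+y. indicator {-T..T} y *
      ennreal (real (root_count n \<Omega> (prepend2 x y t))) \<partial>lborel) \<partial>lborel) \<partial>coeff_space n)
    = (\<integral>\<^sup>+t. (\<integral>\<^sup>+z. box_indicator {1..n-1} T t * (indicator \<Omega> z * root_density n T t z) \<partial>lborel) \<partial>coeff_space n)"
    unfolding root_count_area[OF assms(1-3)]
    using root_density_borel by (intro nn_integral_cong nn_integral_cmult[symmetric]) auto
  also have "\<dots> = (\<integral>\<^sup>+z. (\<integral>\<^sup>+t. box_indicator {1..n-1} T t * (indicator \<Omega> z * root_density n T t z) \<partial>coeff_space n) \<partial>lborel)"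
    by (rule pair.Fubini'[symmetric]) (use m3 in \<open>simp add: case_prod_beta'\<close>)
  also have "\<dots> = ennreal T ^ (n + 1) * (\<integral>\<^sup>+z. indicator \<Omega> z * ennreal (psi n z) \<partial>lborel)"
    unfolding inner[OF assms(4)] using psi_meas by (rule nn_integral_cmult)
  finally show "(\<integral>\<^sup>+t. box_indicator {1..n-1} T t * (\<integral>\<^sup>+x. indicator {-T..T} x * (\<integral>\<^sup>+y. indicator {-T..T} y *
      ennreal (real (root_count n \<Omega> (prepend2 x y t))) \<partial>lborel) \<partial>lborel) \<partial>coeff_space n)
    = ennreal T ^ (n + 1) * (\<integral>\<^sup>+z. indicator \<Omega> z * ennreal (psi n z) \<partial>lborel)" .
qed

section \<open>Roots of integer polynomials in a box\<close>

lemma nn_integral_unit_interval_const: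
  "(\<integral>\<^sup>+x. indicator {-(1/2)..1/2} x * c \<partial>(lborel :: real measure)) = (c :: ennreal)"
  by (subst nn_integral_multc) auto

lemma unit_interval_average_ge:
  assumes "\<And>x. \<bar>x\<bar> \<le> 1/2 \<Longrightarrow> c \<le> f x"
  shows "c \<le> (\<integral>\<^sup>+x. indicator {-(1/2)..1/2} x * f x \<partial>(lborel :: real measure))"
proof -
  have "(\<integral>\<^sup>+x. indicator {-(1/2)..1/2} x * c \<partial>(lborel :: real measure)) \<le> (\<integral>\<^sup>+x. indicator {-(1/2)..1/2} x * f x \<partial>lborel)"
  proof (rule nn_integral_mono)
    fix x :: real
    show "indicator {-(1/2)..1/2} x * c \<le> indicator {-(1/2)..1/2} x * f x"
      using assms[of x] by (cases "x \<in> {-(1/2)..1/2}") (auto simp: abs_le_iff)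
  qed
  then show ?thesis unfolding nn_integral_unit_interval_const .
qed

lemma unit_interval_average_le:
  assumes "\<And>x. \<bar>x\<bar> \<le> 1/2 \<Longrightarrow> f x \<le> c"
  shows "(\<integral>\<^sup>+x. indicator {-(1/2)..1/2} x * f x \<partial>(lborel :: real measure)) \<le> c"
proof -
  have "(\<integral>\<^sup>+x. indicator {-(1/2)..1/2} x * f x \<partial>(lborel :: real measure)) \<le> (\<integral>\<^sup>+x. indicator {-(1/2)..1/2} x * c \<partial>(lborel :: real measure))"
  proof (rule nn_integral_mono)
    fix x :: real
    show "indicator {-(1/2)..1/2} x * f x \<le> indicator {-(1/2)..1/2} x * c"
      using assms[of x] by (cases "x \<in> {-(1/2)..1/2}") (auto simp: abs_le_iff)
  qed
  then show ?thesis unfolding nn_integral_unit_interval_const .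
qed

lemma nn_integral_unit_cube_const:
  "finite I \<Longrightarrow> (\<integral>\<^sup>+t. box_indicator I (1/2) t * c \<partial>PiM I (\<lambda>_. lborel)) = c"
  using nn_integral_box_indicator[of I "1/2"] by (subst nn_integral_multc) auto

lemma unit_cube_average_ge:
  assumes "finite I" "\<And>t. (\<forall>k\<in>I. \<bar>t k\<bar> \<le> 1/2) \<Longrightarrow> c \<le> f t"
  shows "c \<le> (\<integral>\<^sup>+t. box_indicator I (1/2) t * f t \<partial>PiM I (\<lambda>_. lborel))"
proof -
  have "(\<integral>\<^sup>+t. box_indicator I (1/2) t * c \<partial>PiM I (\<lambda>_. lborel)) \<le> (\<integral>\<^sup>+t. box_indicator I (1/2) t * f t \<partial>PiM I (\<lambda>_. lborel))"
    by (rule nn_integral_mono) (use assms in \<open>auto simp: box_indicator_eq\<close>)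
  then show ?thesis unfolding nn_integral_unit_cube_const[OF assms(1)] .
qed

lemma unit_cube_average_le:
  assumes "finite I" "\<And>t. (\<forall>k\<in>I. \<bar>t k\<bar> \<le> 1/2) \<Longrightarrow> f t \<le> c"
  shows "(\<integral>\<^sup>+t. box_indicator I (1/2) t * f t \<partial>PiM I (\<lambda>_. lborel)) \<le> c"
proof -
  have "(\<integral>\<^sup>+t. box_indicator I (1/2) t * f t \<partial>PiM I (\<lambda>_. lborel)) \<le> (\<integral>\<^sup>+t. box_indicator I (1/2) t * c \<partial>PiM I (\<lambda>_. lborel))"
    by (rule nn_integral_mono) (use assms in \<open>auto simp: box_indicator_eq\<close>)
  then show ?thesis unfolding nn_integral_unit_cube_const[OF assms(1)] .
qed

text \<open>The sum over integer translates is kept inside the integral because the shift estimate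
  controls the whole lattice sum at a given offset, not its individual terms.\<close>

lemma nn_integral_unit_intervals_sum:
  assumes "g \<in> borel_measurable borel"
  shows "(\<integral>\<^sup>+y. indicator {-(real M + 1/2)..real M + 1/2} y * g y \<partial>lborel) =
    (\<integral>\<^sup>+u. indicator {-(1/2)..1/2} u * (\<Sum>a\<in>{-int M..int M}. g (of_int a + u)) \<partial>lborel)"
proof -
  note [measurable] = assms
  have "(\<integral>\<^sup>+u. indicator {-(1/2)..1/2} u * (\<Sum>a\<in>{-int M..int M}. g (of_int a + u)) \<partial>lborel)
    = (\<Sum>a\<in>{-int M..int M}. \<integral>\<^sup>+u. indicator {-(1/2)..1/2} u * g (of_int a + u) \<partial>lborel)"
    unfolding sum_distrib_left by (rule nn_integral_sum) measurable
  then show ?thesis using nn_integral_unit_intervals[OF assms, of M] by simp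
qed

lemma nn_integral_unit_squares_sum:
  fixes h :: "real \<Rightarrow> real \<Rightarrow> ennreal"
  assumes "(\<lambda>p. h (fst p) (snd p)) \<in> borel_measurable (borel \<Otimes>\<^sub>M borel)"
  shows "(\<integral>\<^sup>+x. indicator {-(real M + 1/2)..real M + 1/2} x * (\<integral>\<^sup>+y. indicator {-(real M + 1/2)..real M + 1/2} y * h x y \<partial>lborel) \<partial>lborel) =
    (\<integral>\<^sup>+u. indicator {-(1/2)..1/2} u * (\<integral>\<^sup>+v. indicator {-(1/2)..1/2} v *
      (\<Sum>a\<in>{-int M..int M}. \<Sum>b\<in>{-int M..int M}. h (of_int a + u) (of_int b + v)) \<partial>lborel) \<partial>lborel)"
proof -
  note [measurable] = assms
  have hx: "h x \<in> borel_measurable borel" for x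
    using measurable_compose[OF _ assms, of "\<lambda>y. (x, y)" borel] by simp
  define g where "g x = (\<integral>\<^sup>+v. indicator {-(1/2)..1/2} v * (\<Sum>b\<in>{-int M..int M}. h x (of_int b + v)) \<partial>lborel)" for x
  have sh: "(\<lambda>p. h (fst p) (of_int b + snd p)) \<in> borel_measurable (borel \<Otimes>\<^sub>M lborel)" for b :: int
    using measurable_compose[OF _ assms, of "\<lambda>p. (fst p, of_int b + snd p)" "borel \<Otimes>\<^sub>M lborel"] by simp
  have g: "g \<in> borel_measurable borel"
    unfolding g_def[abs_def]
    using lborel.borel_measurable_nn_integral[of "\<lambda>x v. indicator {-(1/2)..1/2} v * (\<Sum>b\<in>{-int M..int M}. h x (of_int b + v))" borel] sh
    by (simp add: case_prod_beta')
  have hx': "(\<lambda>v. h x (of_int b + v)) \<in> borel_measurable lborel" for x and b :: int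
    using measurable_compose[OF _ hx, of "\<lambda>v. of_int b + v" lborel] by simp
  have inner: "(\<Sum>a\<in>{-int M..int M}. g (of_int a + u)) = (\<integral>\<^sup>+v. indicator {-(1/2)..1/2} v *
      (\<Sum>a\<in>{-int M..int M}. \<Sum>b\<in>{-int M..int M}. h (of_int a + u) (of_int b + v)) \<partial>lborel)" for u
    unfolding g_def sum_distrib_left[of _ _ "{-int M..int M}"]
    by (rule nn_integral_sum[symmetric]) (use hx' in measurable)
  have "(\<integral>\<^sup>+x. indicator {-(real M + 1/2)..real M + 1/2} x * (\<integral>\<^sup>+y. indicator {-(real M + 1/2)..real M + 1/2} y * h x y \<partial>lborel) \<partial>lborel)
    = (\<integral>\<^sup>+x. indicator {-(real M + 1/2)..real M + 1/2} x * g x \<partial>lborel)"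
    unfolding g_def nn_integral_unit_intervals_sum[OF hx] ..
  also have "\<dots> = (\<integral>\<^sup>+u. indicator {-(1/2)..1/2} u * (\<Sum>a\<in>{-int M..int M}. g (of_int a + u)) \<partial>lborel)"
    by (rule nn_integral_unit_intervals_sum[OF g])
  finally show ?thesis unfolding inner .
qed

lemma sum_grid_prepend2:
  assumes "n \<ge> 2" and local: "\<And>w w'. (\<And>i. i \<le> n \<Longrightarrow> w i = w' i) \<Longrightarrow> F w = F w'"
  shows "(\<Sum>b\<in>int_grid {1..n-1} M. \<Sum>x\<in>{-int M..int M}. \<Sum>y\<in>{-int M..int M}.
      F (prepend2 (of_int x + u) (of_int y + v) (\<lambda>i\<in>{1..n-1}. of_int (b i) + \<tau> i)))
    = (\<Sum>a\<in>int_grid {..n} M. F (\<lambda>l. of_int (a l) + prepend2 u v \<tau> l))"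
proof -
  define S where "S = int_grid {1..n-1} M \<times> {-int M..int M} \<times> {-int M..int M}"
  \<comment> \<open>The value \<open>undefined\<close> beyond \<open>n\<close> is the one that
    elements of \<open>PiE\<close> take outside their domain.\<close>
  define \<phi> where "\<phi> p = (\<lambda>i. if i = 0 then fst (snd p) else if i = 1 then snd (snd p) else if i \<le> n then fst p (i - 1) else undefined)"
    for p :: "(nat \<Rightarrow> int) \<times> int \<times> int"
  define \<psi> where "\<psi> a = ((\<lambda>k\<in>{1..n-1}. a (k + 1)), a 0, a 1)" for a :: "nat \<Rightarrow> int"
  have "(\<Sum>b\<in>int_grid {1..n-1} M. \<Sum>x\<in>{-int M..int M}. \<Sum>y\<in>{-int M..int M}.
      F (prepend2 (of_int x + u) (of_int y + v) (\<lambda>i\<in>{1..n-1}. of_int (b i) + \<tau> i)))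
    = (\<Sum>p\<in>S. F (prepend2 (of_int (fst (snd p)) + u) (of_int (snd (snd p)) + v) (\<lambda>i\<in>{1..n-1}. of_int (fst p i) + \<tau> i)))"
    unfolding S_def by (simp add: sum.cartesian_product case_prod_beta')
  also have "\<dots> = (\<Sum>a\<in>int_grid {..n} M. F (\<lambda>l. of_int (a l) + prepend2 u v \<tau> l))"
  proof (rule sum.reindex_bij_witness[of S \<psi> \<phi>])
    fix p assume p: "p \<in> S"
    obtain b x y where pe: "p = (b, x, y)" by (cases p)
    have b: "b \<in> int_grid {1..n-1} M" and xy: "x \<in> {-int M..int M}" "y \<in> {-int M..int M}" using p by (auto simp: S_def pe)
    have bk: "b k \<in> {-int M..int M}" if "k \<in> {1..n-1}" for k using b that by (rule PiE_mem)
    show "\<phi> p \<in> int_grid {..n} M"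
    proof (rule PiE_I)
      fix i assume i: "i \<in> {..n}"
      show "\<phi> p i \<in> {-int M..int M}"
      proof (cases "i = 0 \<or> i = 1")
        case True
        then show ?thesis using xy by (auto simp: \<phi>_def pe)
      next
        case False
        then have "i - 1 \<in> {1..n-1}" using i by auto
        from bk[OF this] show ?thesis using False i by (simp add: \<phi>_def pe)
      qed
    qed (use assms(1) in \<open>simp add: \<phi>_def\<close>)
    have "(\<lambda>k\<in>{1..n-1}. \<phi> p (k + 1)) = b"
    proof
      fix k
      show "(\<lambda>k\<in>{1..n-1}. \<phi> p (k + 1)) k = b k"
        using PiE_arb[OF b, of k] by (cases "k \<in> {1..n-1}") (auto simp: \<phi>_def pe)
    qed
    then show "\<psi> (\<phi> p) = p" unfolding \<psi>_def by (simp add: \<phi>_def pe)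
    show "F (\<lambda>l. of_int (\<phi> p l) + prepend2 u v \<tau> l) =
      F (prepend2 (of_int (fst (snd p)) + u) (of_int (snd (snd p)) + v) (\<lambda>i\<in>{1..n-1}. of_int (fst p i) + \<tau> i))"
      by (rule local) (auto simp: \<phi>_def prepend2_def)
  next
    fix a assume a: "a \<in> int_grid {..n} M"
    have ak: "a k \<in> {-int M..int M}" if "k \<le> n" for k using PiE_mem[OF a, of k] that by simp
    show "\<psi> a \<in> S" unfolding \<psi>_def S_def using ak assms(1) by (auto intro!: restrict_PiE_iff[THEN iffD2])
    show "\<phi> (\<psi> a) = a"
    proof
      fix i
      show "\<phi> (\<psi> a) i = a i"
        using PiE_arb[OF a, of i] assms(1) by (cases "i \<le> n") (auto simp: \<phi>_def \<psi>_def)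
    qed
  qed
  finally show ?thesis .
qed

lemma real_cpoly_cong: "(\<And>i. i \<le> n \<Longrightarrow> w i = w' i) \<Longrightarrow> real_cpoly n w = real_cpoly n w'"
  unfolding real_cpoly_def by (intro sum.cong) auto

lemma root_count_cong: "(\<And>i. i \<le> n \<Longrightarrow> w i = w' i) \<Longrightarrow> root_count n \<Omega> w = root_count n \<Omega> w'"
  unfolding root_count_def using real_cpoly_cong[of n w w'] by simp

lemma trunc_count_cong: "(\<And>i. i \<le> n \<Longrightarrow> w i = w' i) \<Longrightarrow> trunc_count n \<Omega> w = trunc_count n \<Omega> w'"
  unfolding trunc_count_def using root_count_cong[of n w w' \<Omega>] by simp

text \<open>The integral over the box is the average, over offsets \<open>u\<close> in the unit
  cube, of the lattice sums shifted by \<open>u\<close>. Each of these is within \<open>E\<close> of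
  \<open>A\<close>, so the average is too. When \<open>A - E\<close> is negative,
  \<open>ennreal\<close> turns it into 0 and the lower bound is trivially true.\<close>

lemma box_integral_grid_bounds:
  assumes n: "n \<ge> 2" and \<Omega>: "open \<Omega>" "\<Omega> \<inter> \<real> = {}"
    and bnd: "\<And>u. (\<And>i. i \<le> n \<Longrightarrow> \<bar>u i\<bar> \<le> 1/2) \<Longrightarrow>
      \<bar>(\<Sum>a\<in>int_grid {..n} M. real (root_count n \<Omega> (\<lambda>l. of_int (a l) + u l))) - A\<bar> \<le> E"
  defines "T \<equiv> real M + 1/2"
  shows "ennreal (A - E) \<le> ennreal T ^ (n + 1) * (\<integral>\<^sup>+z. indicator \<Omega> z * ennreal (psi n z) \<partial>lborel)"
    "ennreal T ^ (n + 1) * (\<integral>\<^sup>+z. indicator \<Omega> z * ennreal (psi n z) \<partial>lborel) \<le> ennreal (A + E)"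
proof -
  define N where "N x y t = ennreal (real (root_count n \<Omega> (prepend2 x y t)))" for x y t
  define G where "G t = (\<integral>\<^sup>+x. indicator {-T..T} x * (\<integral>\<^sup>+y. indicator {-T..T} y * N x y t \<partial>lborel) \<partial>lborel)" for t
  have T0: "T > 0" by (simp add: T_def)
  have G: "G \<in> borel_measurable (coeff_space n)"
    unfolding G_def[abs_def] N_def by (rule root_count_box_integral(2)[OF n \<Omega> T0])
  have total: "(\<integral>\<^sup>+t. box_indicator {1..n-1} T t * G t \<partial>coeff_space n)
      = ennreal T ^ (n + 1) * (\<integral>\<^sup>+z. indicator \<Omega> z * ennreal (psi n z) \<partial>lborel)"
    unfolding G_def N_def by (rule root_count_box_integral(1)[OF n \<Omega> T0])
  have N2: "(\<lambda>p. N (fst p) (snd p) t) \<in> borel_measurable (borel \<Otimes>\<^sub>M borel)" for t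
  proof -
    have "(\<lambda>w::real^2. ennreal (real (root_count n \<Omega> (prepend2 (w $ 1) (w $ 2) t)))) \<in> borel_measurable borel"
      using root_count_prepend2_measurable[OF n \<Omega>] by simp
    from measurable_compose[OF measurable_pair_to_real2 this] show ?thesis by (simp add: N_def)
  qed
  define H where "H t u v = (\<Sum>a\<in>{-int M..int M}. \<Sum>b\<in>{-int M..int M}. N (of_int a + u) (of_int b + v) t)" for t u v
  have Geq: "G t = (\<integral>\<^sup>+u. indicator {-(1/2)..1/2} u * (\<integral>\<^sup>+v. indicator {-(1/2)..1/2} v * H t u v \<partial>lborel) \<partial>lborel)" for t
    unfolding G_def H_def T_def by (rule nn_integral_unit_squares_sum[OF N2])
  have H2: "(\<lambda>p. H t (fst p) (snd p)) \<in> borel_measurable (lborel \<Otimes>\<^sub>M lborel)" for t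
  proof -
    have "(\<lambda>p. N (of_int a + fst p) (of_int b + snd p) t) \<in> borel_measurable (lborel \<Otimes>\<^sub>M lborel)" for a b :: int
      using measurable_compose[OF _ N2, of "\<lambda>p. (of_int a + fst p, of_int b + snd p)" "lborel \<Otimes>\<^sub>M lborel"] by simp
    then show ?thesis unfolding H_def by measurable
  qed
  have H1: "H t u \<in> borel_measurable lborel" for t u
    using measurable_compose[OF _ H2, of "\<lambda>v. (u, v)" lborel t] by simp
  have Hint: "(\<lambda>u. \<integral>\<^sup>+v. indicator {-(1/2)..1/2} v * H t u v \<partial>lborel) \<in> borel_measurable lborel" for t
    using lborel.borel_measurable_nn_integral[of "\<lambda>u v. indicator {-(1/2)..1/2} v * H t u v" lborel] H2[of t]
    by (simp add: case_prod_beta')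
  define sh where "sh b \<tau> = (\<lambda>i\<in>{1..n-1}. of_int (b i) + \<tau> i :: real)" for b :: "nat \<Rightarrow> int" and \<tau>
  have sumG: "(\<Sum>b\<in>int_grid {1..n-1} M. G (sh b \<tau>)) = (\<integral>\<^sup>+u. indicator {-(1/2)..1/2} u * (\<integral>\<^sup>+v. indicator {-(1/2)..1/2} v *
      (\<Sum>b\<in>int_grid {1..n-1} M. H (sh b \<tau>) u v) \<partial>lborel) \<partial>lborel)" for \<tau>
  proof -
    have inner: "(\<integral>\<^sup>+v. indicator {-(1/2)..1/2} v * (\<Sum>b\<in>int_grid {1..n-1} M. H (sh b \<tau>) u v) \<partial>lborel)
      = (\<Sum>b\<in>int_grid {1..n-1} M. \<integral>\<^sup>+v. indicator {-(1/2)..1/2} v * H (sh b \<tau>) u v \<partial>lborel)" for u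
      unfolding sum_distrib_left by (rule nn_integral_sum) (use H1 in measurable)
    show ?thesis unfolding inner unfolding sum_distrib_left Geq
      by (rule nn_integral_sum[symmetric]) (use Hint in measurable)
  qed
  have sumH: "(\<Sum>b\<in>int_grid {1..n-1} M. H (sh b \<tau>) u v) =
      ennreal (\<Sum>a\<in>int_grid {..n} M. real (root_count n \<Omega> (\<lambda>l. of_int (a l) + prepend2 u v \<tau> l)))" for \<tau> u v
    unfolding H_def N_def sh_def
    by (subst sum_grid_prepend2[of n "\<lambda>w. ennreal (real (root_count n \<Omega> w))", OF n])
      (auto intro!: arg_cong[of _ _ "\<lambda>k. ennreal (real k)"] root_count_cong simp: sum_ennreal)
  have pw: "ennreal (A - E) \<le> (\<Sum>b\<in>int_grid {1..n-1} M. H (sh b \<tau>) u v)"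
    "(\<Sum>b\<in>int_grid {1..n-1} M. H (sh b \<tau>) u v) \<le> ennreal (A + E)"
    if "\<forall>k\<in>{1..n-1}. \<bar>\<tau> k\<bar> \<le> 1/2" "\<bar>u\<bar> \<le> 1/2" "\<bar>v\<bar> \<le> 1/2" for \<tau> u v
  proof -
    have pu: "\<bar>prepend2 u v \<tau> i\<bar> \<le> 1/2" if "i \<le> n" for i
    proof (cases "i \<le> 1")
      case True
      then show ?thesis using \<open>\<bar>u\<bar> \<le> 1/2\<close> \<open>\<bar>v\<bar> \<le> 1/2\<close> by (auto simp: prepend2_def)
    next
      case False
      then have "i - 1 \<in> {1..n-1}" using that by auto
      then show ?thesis using \<open>\<forall>k\<in>{1..n-1}. \<bar>\<tau> k\<bar> \<le> 1/2\<close> False by (simp add: prepend2_def)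
    qed
    from bnd[of "prepend2 u v \<tau>", OF pu] show "ennreal (A - E) \<le> (\<Sum>b\<in>int_grid {1..n-1} M. H (sh b \<tau>) u v)"
      "(\<Sum>b\<in>int_grid {1..n-1} M. H (sh b \<tau>) u v) \<le> ennreal (A + E)"
      unfolding sumH by (intro ennreal_leI; linarith)+
  qed
  have "(\<integral>\<^sup>+t. box_indicator {1..n-1} T t * G t \<partial>coeff_space n) =
    (\<Sum>b\<in>int_grid {1..n-1} M. \<integral>\<^sup>+\<tau>. box_indicator {1..n-1} (1/2) \<tau> * G (sh b \<tau>) \<partial>coeff_space n)"
    unfolding box_indicator_def T_def sh_def
    by (rule nn_integral_PiM_unit_cubes[OF finite_atLeastAtMost G])
  also have "\<dots> = (\<integral>\<^sup>+\<tau>. box_indicator {1..n-1} (1/2) \<tau> * (\<Sum>b\<in>int_grid {1..n-1} M. G (sh b \<tau>)) \<partial>coeff_space n)"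
    unfolding sum_distrib_left
  proof (rule nn_integral_sum[symmetric])
    fix b :: "nat \<Rightarrow> int"
    have "sh b \<in> coeff_space n \<rightarrow>\<^sub>M coeff_space n" unfolding sh_def[abs_def] by measurable
    from measurable_compose[OF this G] show "(\<lambda>\<tau>. box_indicator {1..n-1} (1/2) \<tau> * G (sh b \<tau>)) \<in> borel_measurable (coeff_space n)"
      by measurable
  qed
  finally have eq: "ennreal T ^ (n + 1) * (\<integral>\<^sup>+z. indicator \<Omega> z * ennreal (psi n z) \<partial>lborel) =
    (\<integral>\<^sup>+\<tau>. box_indicator {1..n-1} (1/2) \<tau> * (\<Sum>b\<in>int_grid {1..n-1} M. G (sh b \<tau>)) \<partial>coeff_space n)"
    unfolding total .
  show "ennreal (A - E) \<le> ennreal T ^ (n + 1) * (\<integral>\<^sup>+z. indicator \<Omega> z * ennreal (psi n z) \<partial>lborel)"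
    unfolding eq sumG
    by (intro unit_cube_average_ge unit_interval_average_ge pw finite_atLeastAtMost)
  show "ennreal T ^ (n + 1) * (\<integral>\<^sup>+z. indicator \<Omega> z * ennreal (psi n z) \<partial>lborel) \<le> ennreal (A + E)"
    unfolding eq sumG
    by (intro unit_cube_average_le unit_interval_average_le pw finite_atLeastAtMost)
qed

lemma psi_nonneg: "psi n z \<ge> 0"
  unfolding psi_def set_lebesgue_integral_def by (intro mult_nonneg_nonneg integral_nonneg) auto

definition grid_root_count :: "nat \<Rightarrow> complex set \<Rightarrow> nat \<Rightarrow> real" where
  "grid_root_count n \<Omega> M = (\<Sum>a\<in>int_grid {..n} M. real (root_count n \<Omega> (\<lambda>l. of_int (a l))))"

text \<open>The quantifier order carries the uniformity: \<open>C\<close> is fixed before \<Omega>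
  and the curves. The bound on the integral of \<open>psi\<close> is part of the claim because the
  later inversion multiplies this integral by errors of its own.\<close>

lemma grid_root_count_estimate:
  fixes n k d :: nat
  assumes n: "n \<ge> 2"
  shows "\<exists>C\<ge>0. \<forall>(\<Omega> :: complex set) (c :: nat \<Rightarrow> nat \<Rightarrow> nat \<Rightarrow> real).
    open \<Omega> \<and> \<Omega> \<inter> \<real> = {} \<and> (\<forall>i<k. bipoly_nonzero (c i) d) \<and> frontier \<Omega> \<subseteq> (\<Union>i<k. alg_curve (c i) d) \<longrightarrow>
    0 \<le> (LINT z : \<Omega> | lborel. psi n z) \<and> (LINT z : \<Omega> | lborel. psi n z) \<le> C \<and>
    (\<forall>M. \<bar>(real M + 1/2) ^ (n + 1) * (LINT z : \<Omega> | lborel. psi n z) - grid_root_count n \<Omega> M\<bar> \<le> C * (2 * real M + 1) ^ n)"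
proof -
  define K where "K = k * (2 * d * (2 * n + 1) + d + 1) + n + 1"
  \<comment> \<open>The constant of \<open>grid_shift_up_to_hyperplanes\<close>, with the count
    bounded by \<open>L = n\<close>.\<close>
  define C0 where "C0 = 2 * real (n + 1) * real K * real n + 4 * real n"
  have C0: "C0 \<ge> 0" by (simp add: C0_def)
  show ?thesis
  proof (intro exI[of _ "C0 * 2 ^ (n + 1)"] conjI allI impI)
    show "0 \<le> C0 * 2 ^ (n + 1)" using C0 by simp
  next
    fix \<Omega> :: "complex set" and c :: "nat \<Rightarrow> nat \<Rightarrow> nat \<Rightarrow> real"
    assume asm: "open \<Omega> \<and> \<Omega> \<inter> \<real> = {} \<and> (\<forall>i<k. bipoly_nonzero (c i) d) \<and> frontier \<Omega> \<subseteq> (\<Union>i<k. alg_curve (c i) d)"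
    then have \<Omega>: "open \<Omega>" "\<Omega> \<inter> \<real> = {}" by auto
    have few: "few_jumps n K (trunc_count n \<Omega>)"
      unfolding few_jumps_def K_def
      by (intro allI impI, rule trunc_count_plane[where c = c]) (use asm n in auto)
    define I where "I = (LINT z : \<Omega> | lborel. psi n z)"
    define Ie where "Ie = (\<integral>\<^sup>+z. indicator \<Omega> z * ennreal (psi n z) \<partial>lborel)"
    have shift: "\<bar>(\<Sum>a\<in>int_grid {..n} M. real (root_count n \<Omega> (\<lambda>l. of_int (a l) + u l))) - grid_root_count n \<Omega> M\<bar> \<le> C0 * (2 * real M + 1) ^ n"
      if "\<And>i. i \<le> n \<Longrightarrow> \<bar>u i\<bar> \<le> 1/2" for u M
      unfolding C0_def grid_root_count_def
    proof (rule grid_shift_up_to_hyperplanes[OF few])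
      show "trunc_count n \<Omega> w \<le> root_count n \<Omega> w" for w by (simp add: trunc_count_def)
      show "root_count n \<Omega> w \<le> n" for w by (rule root_count_le[OF \<Omega>(1)])
      show "trunc_count n \<Omega> w = trunc_count n \<Omega> w'" if "\<And>i. i \<le> n \<Longrightarrow> w i = w' i" for w w'
        using that by (rule trunc_count_cong)
    qed (use n that in \<open>auto simp: trunc_count_def\<close>)
    have bounds: "ennreal (grid_root_count n \<Omega> M - C0 * (2 * real M + 1) ^ n) \<le> ennreal (real M + 1/2) ^ (n + 1) * Ie"
      "ennreal (real M + 1/2) ^ (n + 1) * Ie \<le> ennreal (grid_root_count n \<Omega> M + C0 * (2 * real M + 1) ^ n)" for M
      unfolding Ie_def by (rule box_integral_grid_bounds[OF n \<Omega>], rule shift, assumption)+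
    have A0: "grid_root_count n \<Omega> M \<ge> 0" for M unfolding grid_root_count_def by (intro sum_nonneg) auto
    \<comment> \<open>The box for \<open>M = 0\<close> already has positive volume, so an infinite
      integral would violate the upper bound there.\<close>
    have fin: "Ie < \<infinity>"
    proof (rule ccontr)
      assume "\<not> ?thesis"
      then have "Ie = \<infinity>" by (simp add: less_top[symmetric])
      moreover have "ennreal (real 0 + 1/2) ^ (n + 1) \<noteq> 0" by (simp add: ennreal_power)
      ultimately have "ennreal (real 0 + 1/2) ^ (n + 1) * Ie = \<infinity>" by (simp add: ennreal_mult_top)
      moreover have "ennreal (grid_root_count n \<Omega> 0 + C0 * (2 * real 0 + 1) ^ n) < \<infinity>" by simp
      ultimately show False using bounds(2)[of 0] by (simp only: leD)
    qed
    have meas: "(\<lambda>z. indicat_real \<Omega> z * psi n z) \<in> borel_measurable lborel"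
    proof -
      have "(\<lambda>z. enn2real (indicator \<Omega> z * ennreal (psi n z))) \<in> borel_measurable lborel"
        using root_count_box_integral(3)[OF n \<Omega> zero_less_one] by measurable
      moreover have "enn2real (indicator \<Omega> z * ennreal (psi n z)) = indicat_real \<Omega> z * psi n z" for z
        using psi_nonneg[of n z] by (simp add: indicator_def)
      ultimately show ?thesis by simp
    qed
    have "I = enn2real (\<integral>\<^sup>+z. ennreal (indicat_real \<Omega> z * psi n z) \<partial>lborel)"
      unfolding I_def set_lebesgue_integral_def real_scaleR_def
      using meas psi_nonneg by (intro integral_eq_nn_integral) auto
    also have "(\<integral>\<^sup>+z. ennreal (indicat_real \<Omega> z * psi n z) \<partial>lborel) = Ie"
      unfolding Ie_def by (intro nn_integral_cong) (auto simp: indicator_def)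
    finally have I: "I = enn2real Ie" .
    then have IeI: "Ie = ennreal I" using fin by (simp add: less_top[symmetric])
    have I0: "I \<ge> 0" by (simp add: I)
    have est: "\<bar>(real M + 1/2) ^ (n + 1) * I - grid_root_count n \<Omega> M\<bar> \<le> C0 * (2 * real M + 1) ^ n" for M
    proof -
      have pw: "ennreal (real M + 1/2) ^ (n + 1) * Ie = ennreal ((real M + 1/2) ^ (n + 1) * I)"
      proof -
        have mult: "ennreal x ^ k * ennreal I = ennreal (x ^ k * I)" if "x \<ge> 0" for x k
          using that I0 by (simp add: ennreal_power ennreal_mult)
        show ?thesis unfolding IeI by (rule mult) simp
      qed
      have pos: "0 \<le> (real M + 1/2) ^ (n + 1) * I" using I0 by simp
      have "grid_root_count n \<Omega> M - C0 * (2 * real M + 1) ^ n \<le> (real M + 1/2) ^ (n + 1) * I"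
        using bounds(1)[of M] pos unfolding pw by (simp add: ennreal_le_iff)
      moreover have "0 \<le> grid_root_count n \<Omega> M + C0 * (2 * real M + 1) ^ n" using A0 C0 by (intro add_nonneg_nonneg) auto
      then have "(real M + 1/2) ^ (n + 1) * I \<le> grid_root_count n \<Omega> M + C0 * (2 * real M + 1) ^ n"
        using bounds(2)[of M] unfolding pw by (simp add: ennreal_le_iff)
      ultimately show ?thesis by linarith
    qed
    \<comment> \<open>The grid for \<open>M = 0\<close> holds only the zero polynomial. The estimate
      then reads \<open>(1/2) ^ (n + 1) * I \<le> C0\<close>, whence the factor
      \<open>2 ^ (n + 1)\<close> in the final constant.\<close>
    have "grid_root_count n \<Omega> 0 = 0"
    proof -
      have "root_count n \<Omega> (\<lambda>l. of_int (a l)) = 0" if a: "a \<in> int_grid {..n} 0" for a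
      proof -
        have "a l = 0" if "l \<le> n" for l using PiE_mem[OF a, of l] that by simp
        then have "real_cpoly n (\<lambda>l. of_int (a l)) = 0" by (simp add: real_cpoly_eq_0_iff)
        moreover have "\<Omega> = {} \<or> infinite \<Omega>" using \<Omega>(1) finite_imp_not_open by blast
        ultimately show ?thesis by (auto simp: root_count_def)
      qed
      then show ?thesis unfolding grid_root_count_def by (intro sum.neutral) auto
    qed
    then have "(1/2) ^ (n + 1) * I \<le> C0" using est[of 0] by simp
    then have "I \<le> C0 * 2 ^ (n + 1)" by (simp add: power_one_over field_simps)
    then show "(LINT z : \<Omega> | lborel. psi n z) \<le> C0 * 2 ^ (n + 1)" by (simp add: I_def)
    show "0 \<le> (LINT z : \<Omega> | lborel. psi n z)" using I0 by (simp add: I_def)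
    fix M
    have "(1::real) \<le> 2 ^ (n + 1)" by (rule one_le_power) simp
    then have "C0 * 1 \<le> C0 * 2 ^ (n + 1)" using C0 by (rule mult_left_mono)
    then have "C0 * (2 * real M + 1) ^ n \<le> C0 * 2 ^ (n + 1) * (2 * real M + 1) ^ n" by (intro mult_right_mono) auto
    then show "\<bar>(real M + 1/2) ^ (n + 1) * (LINT z : \<Omega> | lborel. psi n z) - grid_root_count n \<Omega> M\<bar> \<le> C0 * 2 ^ (n + 1) * (2 * real M + 1) ^ n"
      using est[of M] by (simp only: I_def[symmetric])
  qed
qed

section \<open>Inversion of a sum over dilations\<close>

text \<open>Sharpened to \<open>3/4 - 1/N\<close>, the bound passes through the induction: the next
  term is at most \<open>1/N - 1/(N+1)\<close>. What counts is that the sum from 2 onwards stays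
  below 1.\<close>

lemma sum_inverse_squares_le: "(\<Sum>g=2..N. 1 / (real g)\<^sup>2) \<le> 3/4"
proof (cases "N \<ge> 2")
  case True
  then have "(\<Sum>g=2..N. 1 / (real g)\<^sup>2) \<le> 3/4 - 1 / real N"
  proof (induction N rule: dec_induct)
    case base
    show ?case by (simp add: power2_eq_square)
  next
    case (step N)
    have "1 / (real (Suc N))\<^sup>2 \<le> 1 / real N - 1 / real (Suc N)"
    proof -
      have "1 / real N - 1 / real (Suc N) = 1 / (real N * real (Suc N))"
        using step.hyps by (simp add: field_simps)
      moreover have "real N * real (Suc N) \<le> (real (Suc N))\<^sup>2"
        unfolding power2_eq_square by (intro mult_right_mono) auto
      ultimately show ?thesis using step.hyps by (simp add: frac_le)
    qed
    then show ?case using step by simp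
  qed
  also have "\<dots> \<le> 3/4" by simp
  finally show ?thesis .
qed auto

lemma zeta_nat_summable: "m \<ge> 2 \<Longrightarrow> summable (\<lambda>k. 1 / (real k + 1) ^ m)"
proof -
  assume m: "m \<ge> 2"
  have "summable (\<lambda>k. inverse (real (Suc k) ^ m))"
    using inverse_power_summable[of m, where ?'a = real] m by (subst summable_Suc_iff) auto
  then show ?thesis by (simp add: inverse_eq_divide add.commute)
qed

lemma zeta_nat_ge_1: "m \<ge> 2 \<Longrightarrow> zeta_nat m \<ge> 1"
  unfolding zeta_nat_def
  using sum_le_suminf[OF zeta_nat_summable, of m "{0}"] by simp

text \<open>Every index in the tail exceeds \<open>x\<close>, so \<open>n - 1\<close> of the
  \<open>n + 1\<close> factors \<open>x\<close> are absorbed term by term, leaving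
  \<open>x\<^sup>2\<close> times a sum of inverse squares. The remaining \<open>x\<^sup>2\<close> is
  harmless since \<open>n \<ge> 2\<close>.\<close>

lemma zeta_nat_tail:
  assumes "n \<ge> 2" "x > 0" "x < real N + 1"
  shows "0 \<le> zeta_nat (n + 1) - (\<Sum>g=1..N. 1 / real g ^ (n + 1))"
    "x ^ (n + 1) * (zeta_nat (n + 1) - (\<Sum>g=1..N. 1 / real g ^ (n + 1))) \<le> 2 * x ^ 2"
proof -
  define f where "f k = 1 / (real k + 1) ^ (n + 1)" for k
  have f: "summable f" unfolding f_def using assms(1) by (intro zeta_nat_summable) auto
  have part: "(\<Sum>g=1..N. 1 / real g ^ (n + 1)) = sum f {..<N}"
    unfolding f_def by (rule sum.reindex_bij_witness[of _ Suc "\<lambda>g. g - 1"]) (auto simp: add.commute)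
  have tail: "zeta_nat (n + 1) - (\<Sum>g=1..N. 1 / real g ^ (n + 1)) = (\<Sum>k. f (k + N))"
    unfolding part zeta_nat_def f_def[symmetric] using suminf_minus_initial_segment[OF f, of N] by simp
  have sN: "summable (\<lambda>k. f (k + N))" using f by (subst summable_iff_shift)
  show "0 \<le> zeta_nat (n + 1) - (\<Sum>g=1..N. 1 / real g ^ (n + 1))"
    unfolding tail using sN by (intro suminf_nonneg) (auto simp: f_def)
  have le: "x ^ (n + 1) * f (k + N) \<le> x ^ 2 * (1 / (real (k + N) + 1) ^ 2)" for k
  proof -
    have "x \<le> real (k + N) + 1" using assms(3) by simp
    then have "x ^ (n - 1) \<le> (real (k + N) + 1) ^ (n - 1)" using assms(2) by (intro power_mono) auto
    moreover have "n + 1 = 2 + (n - 1)" using assms(1) by simp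
    ultimately show ?thesis unfolding f_def using assms(2)
      by (simp only: power_add) (simp add: divide_simps mult_left_mono)
  qed
  have s2: "summable (\<lambda>k. 1 / (real k + 1) ^ 2)" by (rule zeta_nat_summable) simp
  then have s2N: "summable (\<lambda>k. 1 / (real (k + N) + 1) ^ 2)" by (rule summable_ignore_initial_segment)
  have "x ^ (n + 1) * (\<Sum>k. f (k + N)) = (\<Sum>k. x ^ (n + 1) * f (k + N))"
    by (rule suminf_mult[OF sN, symmetric])
  also have "\<dots> \<le> (\<Sum>k. x ^ 2 * (1 / (real (k + N) + 1) ^ 2))"
    by (intro suminf_le le summable_mult sN s2N)
  also have "\<dots> = x ^ 2 * (\<Sum>k. 1 / (real (k + N) + 1) ^ 2)" by (rule suminf_mult[OF s2N])
  also have "\<dots> \<le> x ^ 2 * 2"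
  proof (rule mult_left_mono)
    have "(\<Sum>k. 1 / (real (k + N) + 1) ^ 2) \<le> 2"
    proof (rule suminf_le_const[OF s2N])
      fix K
      have "(\<Sum>k<K. 1 / (real (k + N) + 1) ^ 2) \<le> (\<Sum>g\<in>{1..K+N}. 1 / (real g)\<^sup>2)"
      proof -
        have "(\<Sum>k<K. 1 / (real (k + N) + 1) ^ 2) = (\<Sum>g\<in>{N+1..<N+1+K}. 1 / (real g)\<^sup>2)"
          by (rule sum.reindex_bij_witness[of _ "\<lambda>g. g - (N+1)" "\<lambda>k. k + N + 1"]) (auto simp: add_ac)
        also have "\<dots> \<le> (\<Sum>g\<in>{1..K+N}. 1 / (real g)\<^sup>2)" by (rule sum_mono2) auto
        finally show ?thesis .
      qed
      also have "\<dots> \<le> 1 + 3/4"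
      proof (cases "K + N \<ge> 1")
        case True
        then have "{1..K+N} = insert 1 {2..K+N}" by auto
        then show ?thesis using sum_inverse_squares_le[of "K + N"] by simp
      qed auto
      finally show "(\<Sum>k<K. 1 / (real (k + N) + 1) ^ 2) \<le> 2" by simp
    qed
    then show "(\<Sum>k. 1 / (real (k + N) + 1) ^ 2) \<le> 2" .
  qed simp
  finally show "x ^ (n + 1) * (zeta_nat (n + 1) - (\<Sum>g=1..N. 1 / real g ^ (n + 1))) \<le> 2 * x ^ 2"
    unfolding tail by simp
qed

lemma power_diff_le:
  fixes a b :: real
  assumes "0 \<le> a" "a \<le> B" "0 \<le> b" "b \<le> B"
  shows "\<bar>a ^ Suc n - b ^ Suc n\<bar> \<le> \<bar>a - b\<bar> * (real (Suc n) * B ^ n)"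
proof -
  have "a ^ Suc n - b ^ Suc n = (a - b) * (\<Sum>p<Suc n. a ^ p * b ^ (n - p))" by (rule diff_power_eq_sum)
  moreover have "\<bar>\<Sum>p<Suc n. a ^ p * b ^ (n - p)\<bar> \<le> (\<Sum>p<Suc n. B ^ n)"
  proof (rule order.trans[OF sum_abs sum_mono])
    fix p assume "p \<in> {..<Suc n}"
    then have "B ^ n = B ^ p * B ^ (n - p)" by (simp add: power_add[symmetric])
    moreover have "a ^ p * b ^ (n - p) \<le> B ^ p * B ^ (n - p)"
      using assms by (intro mult_mono power_mono) auto
    ultimately show "\<bar>a ^ p * b ^ (n - p)\<bar> \<le> B ^ n" using assms by (simp add: abs_mult)
  qed
  ultimately show ?thesis by (simp add: abs_mult mult_left_mono del: power_Suc sum.lessThan_Suc)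
qed

text \<open>Instead of Moebius inversion: the error term satisfies a convolution inequality whose
  off-diagonal part is a contraction, because \<open>\<zeta>(n) - 1 \<le> 3/4\<close>.\<close>

lemma dilation_inversion:
  fixes P A :: "nat \<Rightarrow> real"
  assumes n: "n \<ge> 2"
    and A: "\<And>M. A M = (\<Sum>g=1..M. P (M div g))"
    and est: "\<And>M. \<bar>(real M + 1/2) ^ (n + 1) * I - A M\<bar> \<le> C * (2 * real M + 1) ^ n"
    and I: "0 \<le> I" "I \<le> C" and x: "x \<ge> 1"
  shows "\<bar>P (nat \<lfloor>x\<rfloor>) - I / zeta_nat (n + 1) * x ^ (n + 1)\<bar> \<le> 4 * C * (3 ^ n + real (n + 1) * 2 ^ n + 2) * x ^ n"
  using x
proof (induction "nat \<lfloor>x\<rfloor>" arbitrary: x rule: less_induct)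
  case less
  define z where "z = zeta_nat (n + 1)"
  have z: "z \<ge> 1" unfolding z_def using n by (intro zeta_nat_ge_1) auto
  have C0: "C \<ge> 0" using I by simp
  \<comment> \<open>The summands stand for the lattice error with
    \<open>2 * M + 1 \<le> 3 * x\<close>, for the replacement of \<open>M + 1/2\<close> by
    \<open>x\<close> in the main term, and for the tail of the zeta series.\<close>
  define B where "B = C * (3 ^ n + real (n + 1) * 2 ^ n + 2)"
  have B0: "B \<ge> 0" using C0 by (simp add: B_def)
  define M where "M = nat \<lfloor>x\<rfloor>"
  have M: "M \<ge> 1" "real M \<le> x" "x < real M + 1"
    using less.prems by (auto simp: M_def le_nat_floor of_nat_floor)
  define E where "E y = P (nat \<lfloor>y\<rfloor>) - I / z * y ^ (n + 1)" for y
  \<comment> \<open>The induction runs over real \<open>x\<close> so that the main term at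
    \<open>x / g\<close> is exactly \<open>(x / g) ^ (n + 1)\<close>; nested floors cost nothing
    here.\<close>
  have fl: "nat \<lfloor>x / real g\<rfloor> = M div g" for g
  proof -
    have "\<lfloor>x / real_of_int (int g)\<rfloor> = \<lfloor>x\<rfloor> div int g" by (rule floor_divide_real_eq_div) simp
    then show ?thesis using less.prems unfolding M_def by (simp add: nat_div_distrib)
  qed
  have xn: "x ^ n \<ge> 0" using less.prems by simp
  have "A M = (\<Sum>g=1..M. E (x / real g)) + I / z * x ^ (n + 1) * (\<Sum>g=1..M. 1 / real g ^ (n + 1))"
    unfolding A E_def fl by (simp add: sum_distrib_left sum_subtractf power_divide)
  also have "(\<Sum>g=1..M. E (x / real g)) = E x + (\<Sum>g=2..M. E (x / real g))"
  proof -
    have "{1..M} = insert 1 {2..M}" using M(1) by auto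
    then show ?thesis by simp
  qed
  finally have Ex: "E x = (A M - I * x ^ (n + 1)) + I / z * (x ^ (n + 1) * (z - (\<Sum>g=1..M. 1 / real g ^ (n + 1))))
     - (\<Sum>g=2..M. E (x / real g))"
    using z by (simp add: field_simps)
  have t1: "\<bar>A M - I * x ^ (n + 1)\<bar> \<le> C * (3 ^ n + real (n + 1) * 2 ^ n) * x ^ n"
  proof -
    have "\<bar>(real M + 1/2) ^ Suc n - x ^ Suc n\<bar> \<le> \<bar>(real M + 1/2) - x\<bar> * (real (Suc n) * (2 * x) ^ n)"
      using M less.prems by (intro power_diff_le) auto
    also have "\<dots> \<le> 1 * (real (Suc n) * (2 * x) ^ n)"
      using M less.prems by (intro mult_right_mono) auto
    finally have h: "\<bar>(real M + 1/2) ^ (n + 1) - x ^ (n + 1)\<bar> \<le> real (n + 1) * (2 * x) ^ n" by simp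
    have a: "\<bar>(real M + 1/2) ^ (n + 1) * I - I * x ^ (n + 1)\<bar> \<le> C * (real (n + 1) * (2 * x) ^ n)"
    proof -
      have "(real M + 1/2) ^ (n + 1) * I - I * x ^ (n + 1) = I * ((real M + 1/2) ^ (n + 1) - x ^ (n + 1))"
        by (simp only: right_diff_distrib mult.commute)
      then have "\<bar>(real M + 1/2) ^ (n + 1) * I - I * x ^ (n + 1)\<bar> = I * \<bar>(real M + 1/2) ^ (n + 1) - x ^ (n + 1)\<bar>"
        by (simp only: abs_mult abs_of_nonneg[OF I(1)])
      also have "\<dots> \<le> C * (real (n + 1) * (2 * x) ^ n)" using h I by (intro mult_mono) auto
      finally show ?thesis .
    qed
    have "(2 * real M + 1) ^ n \<le> (3 * x) ^ n" using M by (intro power_mono) auto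
    then have "C * (2 * real M + 1) ^ n \<le> C * (3 * x) ^ n" using C0 by (intro mult_left_mono)
    then have "\<bar>(real M + 1/2) ^ (n + 1) * I - A M\<bar> \<le> C * (3 * x) ^ n" using est[of M] by linarith
    with a have "\<bar>A M - I * x ^ (n + 1)\<bar> \<le> C * (3 * x) ^ n + C * (real (n + 1) * (2 * x) ^ n)" by linarith
    also have "\<dots> = C * (3 ^ n + real (n + 1) * 2 ^ n) * x ^ n"
      unfolding power_mult_distrib by (simp add: algebra_simps)
    finally show ?thesis .
  qed
  have t2: "\<bar>I / z * (x ^ (n + 1) * (z - (\<Sum>g=1..M. 1 / real g ^ (n + 1))))\<bar> \<le> 2 * C * x ^ n"
  proof -
    define w where "w = x ^ (n + 1) * (z - (\<Sum>g=1..M. 1 / real g ^ (n + 1)))"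
    have w: "0 \<le> w" "w \<le> 2 * x ^ 2"
      using zeta_nat_tail[OF n, of x M] M less.prems unfolding w_def z_def by (auto intro!: mult_nonneg_nonneg)
    have "x ^ 2 \<le> x ^ n" using less.prems n by (intro power_increasing) auto
    then have "w \<le> 2 * x ^ n" using w(2) by linarith
    moreover have "I / z \<le> C" using mult_mono[of I C 1 z] I z C0 by (simp add: divide_le_eq)
    moreover have "0 \<le> I / z" using I z by simp
    ultimately have "I / z * w \<le> C * (2 * x ^ n)" using w C0 by (intro mult_mono) auto
    moreover have "0 \<le> I / z * w" using w \<open>0 \<le> I / z\<close> by (intro mult_nonneg_nonneg) auto
    ultimately have "\<bar>I / z * w\<bar> \<le> C * (2 * x ^ n)" by (simp only: abs_of_nonneg)
    also have "\<dots> = 2 * C * x ^ n" by simp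
    finally show ?thesis unfolding w_def .
  qed
  have t3: "\<bar>\<Sum>g=2..M. E (x / real g)\<bar> \<le> 3 * B * x ^ n"
  proof -
    have "\<bar>\<Sum>g=2..M. E (x / real g)\<bar> \<le> (\<Sum>g=2..M. \<bar>E (x / real g)\<bar>)" by (rule sum_abs)
    also have "\<dots> \<le> (\<Sum>g=2..M. 4 * B * x ^ n * (1 / (real g)\<^sup>2))"
    proof (rule sum_mono)
      fix g assume g: "g \<in> {2..M}"
      have "nat \<lfloor>x / real g\<rfloor> < nat \<lfloor>x\<rfloor>" unfolding fl M_def[symmetric] using g by (intro div_less_dividend) auto
      moreover have "x / real g \<ge> 1" using g M by auto
      ultimately have "\<bar>E (x / real g)\<bar> \<le> 4 * B * (x / real g) ^ n"
        using less.hyps[of "x / real g"] unfolding E_def z_def B_def by (simp only: mult.assoc)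
      also have "\<dots> = 4 * B * x ^ n * (1 / real g ^ n)" by (simp add: power_divide)
      also have "\<dots> \<le> 4 * B * x ^ n * (1 / (real g)\<^sup>2)"
      proof (rule mult_left_mono)
        have "(real g)\<^sup>2 \<le> real g ^ n" using g n by (intro power_increasing) auto
        then show "1 / real g ^ n \<le> 1 / (real g)\<^sup>2" using g by (intro divide_left_mono) auto
      qed (use B0 xn in auto)
      finally show "\<bar>E (x / real g)\<bar> \<le> 4 * B * x ^ n * (1 / (real g)\<^sup>2)" .
    qed
    also have "\<dots> = 4 * B * x ^ n * (\<Sum>g=2..M. 1 / (real g)\<^sup>2)" by (simp add: sum_distrib_left)
    also have "\<dots> \<le> 4 * B * x ^ n * (3/4)" using B0 xn by (intro mult_left_mono sum_inverse_squares_le) auto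
    finally show ?thesis by simp
  qed
  \<comment> \<open>The inequality closes because \<open>B + (3/4) * (4 * B) = 4 * B\<close>; this
    is the origin of the factor 4 in the statement.\<close>
  have "\<bar>E x\<bar> \<le> C * (3 ^ n + real (n + 1) * 2 ^ n) * x ^ n + 2 * C * x ^ n + 3 * B * x ^ n"
    unfolding Ex using t1 t2 t3 by linarith
  also have "\<dots> = 4 * B * x ^ n" unfolding B_def by (simp add: algebra_simps)
  finally show ?case unfolding E_def z_def B_def by (simp only: mult.assoc)
qed

section \<open>Heights and reducible polynomials\<close>

definition polys_bounded :: "nat \<Rightarrow> nat \<Rightarrow> int poly set" where
  "polys_bounded n M = {p. degree p \<le> n \<and> (\<forall>i. \<bar>coeff p i\<bar> \<le> int M)}"

lemma poly_height_le_iff: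
  assumes "m \<ge> 0"
  shows "poly_height p \<le> m \<longleftrightarrow> (\<forall>i. \<bar>coeff p i\<bar> \<le> m)"
proof -
  have "poly_height p \<le> m \<longleftrightarrow> (\<forall>i\<le>degree p. \<bar>coeff p i\<bar> \<le> m)"
    unfolding poly_height_def by (subst Max_le_iff) auto
  also have "\<dots> \<longleftrightarrow> (\<forall>i. \<bar>coeff p i\<bar> \<le> m)"
  proof
    assume h: "\<forall>i\<le>degree p. \<bar>coeff p i\<bar> \<le> m"
    show "\<forall>i. \<bar>coeff p i\<bar> \<le> m"
    proof
      fix i show "\<bar>coeff p i\<bar> \<le> m" using h assms by (cases "i \<le> degree p") (auto simp: coeff_eq_0)
    qed
  qed auto
  finally show ?thesis .
qed

lemma poly_height_nonneg: "poly_height p \<ge> 0"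
  unfolding poly_height_def by (rule order.trans[OF abs_ge_zero[of "coeff p 0"] Max_ge]) auto

lemma abs_coeff_le_poly_height: "\<bar>coeff p i\<bar> \<le> poly_height p"
  using poly_height_le_iff[OF poly_height_nonneg, of p p] by simp

lemma poly_height_attained: "\<exists>i\<le>degree p. \<bar>coeff p i\<bar> = poly_height p"
proof -
  have "poly_height p \<in> (\<lambda>i. \<bar>coeff p i\<bar>) ` {..degree p}" unfolding poly_height_def by (rule Max_in) auto
  then show ?thesis by auto
qed

lemma poly_height_pos: "p \<noteq> 0 \<Longrightarrow> poly_height p \<ge> 1"
proof -
  assume "p \<noteq> 0"
  then have "lead_coeff p \<noteq> 0" by simp
  then have "\<bar>lead_coeff p\<bar> \<ge> 1" by linarith
  then show ?thesis using abs_coeff_le_poly_height[of p "degree p"] by linarith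
qed

lemma polys_bounded_iff_height: "p \<in> polys_bounded n M \<longleftrightarrow> degree p \<le> n \<and> poly_height p \<le> int M"
  by (simp add: polys_bounded_def poly_height_le_iff)

lemma bij_betw_polys_grid: "bij_betw (\<lambda>p. restrict (coeff p) {..n}) (polys_bounded n M) (int_grid {..n} M)"
proof (rule bij_betw_byWitness[where f' = "\<lambda>a. \<Sum>i\<le>n. monom (a i) i"])
  show "\<forall>p\<in>polys_bounded n M. (\<Sum>i\<le>n. monom (restrict (coeff p) {..n} i) i) = p"
  proof
    fix p assume p: "p \<in> polys_bounded n M"
    then have "degree p \<le> n" by (simp add: polys_bounded_def)
    then show "(\<Sum>i\<le>n. monom (restrict (coeff p) {..n} i) i) = p"
      by (auto simp: poly_eq_iff coeff_sum intro: coeff_eq_0)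
  qed
  show "\<forall>a\<in>int_grid {..n} M. restrict (coeff (\<Sum>i\<le>n. monom (a i) i)) {..n} = a"
  proof
    fix a assume a: "a \<in> int_grid {..n} M"
    show "restrict (coeff (\<Sum>i\<le>n. monom (a i) i)) {..n} = a"
    proof
      fix i
      show "restrict (coeff (\<Sum>i\<le>n. monom (a i) i)) {..n} i = a i"
        using PiE_arb[OF a, of i] by (cases "i \<le> n") (auto simp: coeff_sum)
    qed
  qed
  show "(\<lambda>p. restrict (coeff p) {..n}) ` polys_bounded n M \<subseteq> int_grid {..n} M"
  proof (rule image_subsetI)
    fix p assume p: "p \<in> polys_bounded n M"
    show "restrict (coeff p) {..n} \<in> int_grid {..n} M"
    proof (rule PiE_I)
      fix i assume "i \<in> {..n}"
      moreover have "\<bar>coeff p i\<bar> \<le> int M" using p by (simp add: polys_bounded_def)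
      ultimately show "restrict (coeff p) {..n} i \<in> {-int M..int M}" by (simp add: abs_le_iff)
    qed simp
  qed
  show "(\<lambda>a. \<Sum>i\<le>n. monom (a i) i) ` int_grid {..n} M \<subseteq> polys_bounded n M"
  proof
    fix p assume "p \<in> (\<lambda>a. \<Sum>i\<le>n. monom (a i) i) ` int_grid {..n} M"
    then obtain a where a: "a \<in> int_grid {..n} M" "p = (\<Sum>i\<le>n. monom (a i) i)" by blast
    have c: "coeff p i = (if i \<le> n then a i else 0)" for i by (simp add: a(2) coeff_sum)
    have "degree p \<le> n" by (rule degree_le) (simp add: c)
    moreover have "\<bar>coeff p i\<bar> \<le> int M" for i
      using PiE_mem[OF a(1), of i] by (auto simp: c abs_le_iff)
    ultimately show "p \<in> polys_bounded n M" by (simp add: polys_bounded_def)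
  qed
qed

lemma finite_polys_bounded: "finite (polys_bounded n M)"
  using bij_betw_finite[OF bij_betw_polys_grid, of n M] by (auto intro: finite_PiE)

lemma card_polys_bounded: "card (polys_bounded n M) = (2 * M + 1) ^ (n + 1)"
  using bij_betw_same_card[OF bij_betw_polys_grid, of n M] by (simp add: card_int_grid)

text \<open>A polynomial that attains height \<open>h\<close> has some coefficient equal to
  \<open>h\<close> or \<open>- h\<close>. Pinning that coefficient saves one power of
  \<open>h\<close> against the count of all polynomials of height at most \<open>h\<close>.\<close>

lemma card_polys_height_eq:
  "card {p. degree p \<le> v \<and> poly_height p = int h} \<le> 2 * (v + 1) * (2 * h + 1) ^ v"
proof -
  define S where "S i s = {p\<in>polys_bounded v h. coeff p i = s}" for i s
  have S: "card (S i s) \<le> (2 * h + 1) ^ v" "finite (S i s)" if "i \<le> v" for i s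
  proof -
    have "card (S i s) \<le> card {a\<in>int_grid {..v} h. real_of_int (a i) + (- real_of_int s) = 0}"
    proof (rule card_inj_on_le[of "\<lambda>p. restrict (coeff p) {..v}"])
      show "inj_on (\<lambda>p. restrict (coeff p) {..v}) (S i s)"
        by (rule inj_on_subset[OF bij_betw_imp_inj_on[OF bij_betw_polys_grid[of v h]]]) (auto simp: S_def)
      show "(\<lambda>p. restrict (coeff p) {..v}) ` S i s \<subseteq> {a\<in>int_grid {..v} h. real_of_int (a i) + (- real_of_int s) = 0}"
        using bij_betw_imp_surj_on[OF bij_betw_polys_grid[of v h]] that by (auto simp: S_def)
      have "finite (int_grid {..v} h)" by (intro finite_PiE) auto
      then show "finite {a\<in>int_grid {..v} h. real_of_int (a i) + (- real_of_int s) = 0}" by simp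
    qed
    also have "\<dots> \<le> (2 * h + 1) ^ v" by (rule card_grid_coordinate_fixed[OF that])
    finally show "card (S i s) \<le> (2 * h + 1) ^ v" .
    show "finite (S i s)" unfolding S_def using finite_polys_bounded by simp
  qed
  have "{p. degree p \<le> v \<and> poly_height p = int h} \<subseteq> (\<Union>i\<le>v. S i (int h) \<union> S i (- int h))"
  proof
    fix p assume p: "p \<in> {p. degree p \<le> v \<and> poly_height p = int h}"
    then have pb: "p \<in> polys_bounded v h" by (simp add: polys_bounded_iff_height)
    obtain i where i: "i \<le> degree p" "\<bar>coeff p i\<bar> = poly_height p" using poly_height_attained by blast
    then have "coeff p i = int h \<or> coeff p i = - int h" using p by auto
    then show "p \<in> (\<Union>i\<le>v. S i (int h) \<union> S i (- int h))"
      using pb i(1) p by (auto simp: S_def intro: order.trans)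
  qed
  then have "card {p. degree p \<le> v \<and> poly_height p = int h} \<le> card (\<Union>i\<le>v. S i (int h) \<union> S i (- int h))"
    using S(2) by (intro card_mono) auto
  also have "\<dots> \<le> (\<Sum>i\<le>v. card (S i (int h) \<union> S i (- int h)))" by (rule card_UN_le) auto
  also have "\<dots> \<le> (\<Sum>i\<le>v. (2 * h + 1) ^ v + (2 * h + 1) ^ v)"
  proof (rule sum_mono)
    fix i assume i: "i \<in> {..v}"
    have "card (S i (int h) \<union> S i (- int h)) \<le> card (S i (int h)) + card (S i (- int h))" by (rule card_Un_le)
    also have "\<dots> \<le> (2 * h + 1) ^ v + (2 * h + 1) ^ v" using i by (intro add_mono S(1)) auto
    finally show "card (S i (int h) \<union> S i (- int h)) \<le> (2 * h + 1) ^ v + (2 * h + 1) ^ v" .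
  qed
  also have "\<dots> = 2 * (v + 1) * (2 * h + 1) ^ v" by (simp add: algebra_simps)
  finally show ?thesis .
qed

text \<open>Lagrange interpolation at the points of \<open>S\<close>; \<open>c\<close> dominates
  every coefficient of every basis polynomial \<open>L x\<close>.\<close>

lemma coeff_le_values:
  fixes S :: "real set"
  assumes "finite S" "card S = Suc n"
  shows "\<exists>c\<ge>0. \<forall>q :: real poly. degree q \<le> n \<longrightarrow> (\<forall>i. \<bar>coeff q i\<bar> \<le> c * (\<Sum>x\<in>S. \<bar>poly q x\<bar>))"
proof -
  define L where "L x = (\<Prod>y\<in>S - {x}. smult (1 / (x - y)) [:- y, 1:])" for x
  have deg_L: "degree (L x) \<le> n" if "x \<in> S" for x
  proof -
    have "degree (L x) \<le> (\<Sum>y\<in>S - {x}. degree (smult (1 / (x - y)) [:- y, 1:]))"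
      unfolding L_def using degree_prod_sum_le[of "S - {x}" "\<lambda>y. smult (1 / (x - y)) [:- y, 1:]"] assms(1) by (simp add: o_def)
    also have "\<dots> \<le> (\<Sum>y\<in>S - {x}. 1)" by (intro sum_mono) simp
    also have "\<dots> = n" using assms that by simp
    finally show ?thesis .
  qed
  have L_val: "poly (L x) y = (if y = x then 1 else 0)" if "x \<in> S" "y \<in> S" for x y
  proof (cases "y = x")
    case True
    have "1 / (x - ya) * (x - ya) = 1" if "ya \<in> S - {x}" for ya using that by auto
    then have "poly (L x) x = 1" unfolding L_def poly_prod
      by (intro prod.neutral ballI) (simp only: poly_smult poly_pCons poly_0 mult_zero_right add_0_right mult_1_right, simp add: add.commute)
    then show ?thesis using True by simp
  next
    case False
    then have "poly (L x) y = 0" unfolding L_def poly_prod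
      using assms(1) that by (intro prod_zero) (auto intro!: bexI[of _ y])
    then show ?thesis using False by simp
  qed
  define c where "c = (\<Sum>x\<in>S. \<Sum>i\<le>n. \<bar>coeff (L x) i\<bar>)"
  have Lc: "\<bar>coeff (L x) i\<bar> \<le> c" if x: "x \<in> S" for x i
  proof (cases "i \<le> n")
    case True
    then have "\<bar>coeff (L x) i\<bar> \<le> (\<Sum>i\<le>n. \<bar>coeff (L x) i\<bar>)" by (intro member_le_sum) auto
    also have "\<dots> \<le> c" unfolding c_def
      by (rule member_le_sum[OF x _ assms(1), where f = "\<lambda>x. \<Sum>i\<le>n. \<bar>coeff (L x) i\<bar>"]) (simp add: sum_nonneg)
    finally show ?thesis .
  next
    case False
    then have "coeff (L x) i = 0" using deg_L[OF x] by (intro coeff_eq_0) auto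
    then show ?thesis by (simp add: c_def sum_nonneg)
  qed
  have "\<bar>coeff q i\<bar> \<le> c * (\<Sum>x\<in>S. \<bar>poly q x\<bar>)" if q: "degree q \<le> n" for q i
  proof -
    have "q = (\<Sum>x\<in>S. smult (poly q x) (L x))"
    proof (rule poly_eqI_degree[of S])
      fix y assume y: "y \<in> S"
      have "(\<Sum>x\<in>S. poly q x * poly (L x) y) = (\<Sum>x\<in>S. if y = x then poly q x else 0)"
        using y by (intro sum.cong refl) (simp add: L_val)
      then show "poly q y = poly (\<Sum>x\<in>S. smult (poly q x) (L x)) y"
        using y assms(1) by (simp add: poly_sum)
    next
      have "degree (\<Sum>x\<in>S. smult (poly q x) (L x)) \<le> n"
        by (rule degree_sum_le[OF assms(1)]) (blast intro: order.trans[OF degree_smult_le deg_L])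
      then show "card S > degree (\<Sum>x\<in>S. smult (poly q x) (L x))" using assms(2) by simp
    qed (use q assms(2) in simp)
    then have "coeff q i = (\<Sum>x\<in>S. poly q x * coeff (L x) i)" by (metis (no_types, lifting) coeff_smult coeff_sum sum.cong)
    also have "\<bar>\<dots>\<bar> \<le> (\<Sum>x\<in>S. \<bar>poly q x * coeff (L x) i\<bar>)" by (rule sum_abs)
    also have "\<dots> \<le> (\<Sum>x\<in>S. \<bar>poly q x\<bar> * c)" by (intro sum_mono) (simp add: abs_mult mult_left_mono Lc)
    finally show ?thesis by (simp add: sum_distrib_left mult.commute)
  qed
  moreover have "c \<ge> 0" unfolding c_def by (intro sum_nonneg) auto
  ultimately show ?thesis by blast
qed

lemma map_poly_of_int_mult:
  "map_poly of_int (p * q) = (map_poly of_int p * map_poly of_int q :: 'a :: comm_ring_1 poly)"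
  by (rule poly_eqI) (simp add: coeff_map_poly coeff_mult)

text \<open>If \<open>n + 1\<close> of the points gave small values, interpolation through them
  would make all coefficients smaller than the height. The constant is uniform because only finitely
  many sets of interpolation points occur.\<close>

lemma few_small_values:
  "\<exists>c\<ge>1. \<forall>q :: int poly. q \<noteq> 0 \<longrightarrow> degree q \<le> n \<longrightarrow>
     card {x\<in>{..2*n}. c * \<bar>poly (map_poly real_of_int q) (real x)\<bar> < real_of_int (poly_height q)} \<le> n"
proof -
  define \<S> where "\<S> = {S. S \<subseteq> {..2*n} \<and> card S = Suc n}"
  have fin: "finite \<S>" unfolding \<S>_def by (rule finite_subset[of _ "Pow {..2*n}"]) auto
  have "\<forall>S. \<exists>c. S \<in> \<S> \<longrightarrow> c \<ge> 0 \<and> (\<forall>q :: real poly. degree q \<le> n \<longrightarrow> (\<forall>i. \<bar>coeff q i\<bar> \<le> c * (\<Sum>x\<in>real ` S. \<bar>poly q x\<bar>)))"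
  proof (intro allI)
    fix S
    show "\<exists>c. S \<in> \<S> \<longrightarrow> c \<ge> 0 \<and> (\<forall>q :: real poly. degree q \<le> n \<longrightarrow> (\<forall>i. \<bar>coeff q i\<bar> \<le> c * (\<Sum>x\<in>real ` S. \<bar>poly q x\<bar>)))"
    proof (cases "S \<in> \<S>")
      case True
      then have "finite (real ` S)" "card (real ` S) = Suc n"
        by (auto simp: \<S>_def card_image intro: finite_subset)
      from coeff_le_values[OF this] show ?thesis by blast
    qed blast
  qed
  from choice[OF this] obtain c where c: "\<And>S. S \<in> \<S> \<Longrightarrow> c S \<ge> 0"
    "\<And>S q i. S \<in> \<S> \<Longrightarrow> degree q \<le> n \<Longrightarrow> \<bar>coeff q i\<bar> \<le> c S * (\<Sum>x\<in>real ` S. \<bar>poly q x\<bar>)"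
    by blast
  \<comment> \<open>The extra 1 makes the closing comparison \<open>(C - 1) * (H / C) < H\<close>
    strict and ensures \<open>C \<ge> 1\<close>.\<close>
  define C where "C = 1 + (\<Sum>S\<in>\<S>. c S) * real (Suc n)"
  have sum0: "(\<Sum>S\<in>\<S>. c S) \<ge> 0" using c(1) by (intro sum_nonneg)
  have "card {x\<in>{..2*n}. C * \<bar>poly (map_poly real_of_int q) (real x)\<bar> < real_of_int (poly_height q)} \<le> n"
    if q: "q \<noteq> 0" "degree q \<le> n" for q
  proof (rule ccontr)
    assume "\<not> ?thesis"
    then have "Suc n \<le> card {x\<in>{..2*n}. C * \<bar>poly (map_poly real_of_int q) (real x)\<bar> < real_of_int (poly_height q)}" by simp
    then obtain S where S: "S \<subseteq> {x\<in>{..2*n}. C * \<bar>poly (map_poly real_of_int q) (real x)\<bar> < real_of_int (poly_height q)}" "card S = Suc n"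
      by (rule obtain_subset_with_card_n)
    then have SS: "S \<in> \<S>" by (auto simp: \<S>_def)
    have cS: "c S \<le> (\<Sum>S\<in>\<S>. c S)" using c(1) by (intro member_le_sum fin SS) auto
    define H where "H = real_of_int (poly_height q)"
    have H: "H \<ge> 1" using poly_height_pos[OF q(1)] by (simp add: H_def)
    have C1: "C \<ge> 1" using sum0 by (simp add: C_def)
    obtain i where i: "\<bar>coeff q i\<bar> = poly_height q" using poly_height_attained by blast
    have "H = \<bar>coeff (map_poly real_of_int q) i\<bar>" unfolding H_def i[symmetric] by (simp add: coeff_map_poly)
    also have "\<dots> \<le> c S * (\<Sum>x\<in>real ` S. \<bar>poly (map_poly real_of_int q) x\<bar>)"
      using q(2) by (intro c(2)[OF SS]) (simp add: degree_map_poly)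
    also have "(\<Sum>x\<in>real ` S. \<bar>poly (map_poly real_of_int q) x\<bar>) = (\<Sum>x\<in>S. \<bar>poly (map_poly real_of_int q) (real x)\<bar>)"
      by (subst sum.reindex) auto
    also have "c S * \<dots> \<le> c S * (\<Sum>x\<in>S. H / C)"
    proof (intro mult_left_mono sum_mono c(1)[OF SS])
      fix x assume "x \<in> S"
      then have "C * \<bar>poly (map_poly real_of_int q) (real x)\<bar> < H" using S(1) by (auto simp: H_def)
      then show "\<bar>poly (map_poly real_of_int q) (real x)\<bar> \<le> H / C" using C1 by (simp add: field_simps)
    qed
    also have "\<dots> = c S * real (Suc n) * (H / C)" using S(2) by simp
    also have "\<dots> \<le> (C - 1) * (H / C)"
      unfolding C_def using cS H sum0 by (intro mult_right_mono) (auto intro!: mult_right_mono)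
    also have "\<dots> < H" using C1 H by (simp add: field_simps)
    finally show False by simp
  qed
  then show ?thesis using sum0 by (intro exI[of _ C]) (auto simp: C_def)
qed

text \<open>A substitute for Gelfond's inequality: both factors are large at a common one of the points \<open>0, \<dots>, 2n\<close>.\<close>

lemma poly_height_mult_le:
  "\<exists>K::nat. K \<ge> 1 \<and> (\<forall>q r. q * r \<noteq> 0 \<longrightarrow> degree (q * r) \<le> n \<longrightarrow> poly_height q * poly_height r \<le> int K * poly_height (q * r))"
proof -
  obtain c where c: "c \<ge> 1" "\<And>q :: int poly. q \<noteq> 0 \<Longrightarrow> degree q \<le> n \<Longrightarrow>
     card {x\<in>{..2*n}. c * \<bar>poly (map_poly real_of_int q) (real x)\<bar> < real_of_int (poly_height q)} \<le> n"
    using few_small_values[of n] by blast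
  \<comment> \<open>One \<open>c\<close> for each factor; the rest bounds the value of a polynomial
    of height 1 and degree at most \<open>n\<close> at a point up to \<open>2 * n\<close>. The base
    \<open>2 * n + 1\<close> is at least 1 even for \<open>n = 0\<close>, so its powers
    increase.\<close>
  define K0 where "K0 = c\<^sup>2 * (real (n + 1) * real (2 * n + 1) ^ n)"
  define K where "K = nat \<lceil>K0\<rceil> + 1"
  have "poly_height q * poly_height r \<le> int K * poly_height (q * r)" if qr: "q * r \<noteq> 0" "degree (q * r) \<le> n" for q r
  proof -
    define ev where "ev p x = poly (map_poly real_of_int p) (real x)" for p and x :: nat
    have nz: "q \<noteq> 0" "r \<noteq> 0" using qr(1) by auto
    then have deg: "degree q \<le> n" "degree r \<le> n" using qr(2) by (auto simp: degree_mult_eq)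
    define X where "X p = {x\<in>{..2*n}. c * \<bar>ev p x\<bar> < real_of_int (poly_height p)}" for p
    have "card (X q \<union> X r) \<le> card (X q) + card (X r)" by (rule card_Un_le)
    also have "\<dots> \<le> n + n" unfolding X_def ev_def using c(2) nz deg by (intro add_mono) auto
    also have "\<dots> < card {..2*n}" by simp
    finally have lt: "card (X q \<union> X r) < card {..2*n}" .
    have "X q \<union> X r \<subseteq> {..2*n}" by (auto simp: X_def)
    then obtain x where x: "x \<in> {..2*n}" "x \<notin> X q \<union> X r" using lt by (metis less_irrefl subsetI subset_antisym)
    then have big: "real_of_int (poly_height q) \<le> c * \<bar>ev q x\<bar>" "real_of_int (poly_height r) \<le> c * \<bar>ev r x\<bar>"
      by (auto simp: X_def)
    have ev_mult: "ev (q * r) x = ev q x * ev r x" by (simp add: ev_def map_poly_of_int_mult)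
    have "real_of_int (poly_height q) * real_of_int (poly_height r) \<le> (c * \<bar>ev q x\<bar>) * (c * \<bar>ev r x\<bar>)"
      using big poly_height_nonneg[of q] poly_height_nonneg[of r] c(1) by (intro mult_mono) auto
    also have "\<dots> = c\<^sup>2 * \<bar>ev (q * r) x\<bar>" by (simp add: ev_mult abs_mult power2_eq_square)
    also have "\<bar>ev (q * r) x\<bar> \<le> real (n + 1) * real (2 * n + 1) ^ n * real_of_int (poly_height (q * r))"
    proof -
      have "ev (q * r) x = (\<Sum>i\<le>degree (q * r). real_of_int (coeff (q * r) i) * real x ^ i)"
        unfolding ev_def poly_altdef by (simp add: coeff_map_poly degree_map_poly)
      also have "\<bar>\<dots>\<bar> \<le> (\<Sum>i\<le>degree (q * r). \<bar>real_of_int (coeff (q * r) i) * real x ^ i\<bar>)" by (rule sum_abs)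
      also have "\<dots> \<le> (\<Sum>i\<le>degree (q * r). real_of_int (poly_height (q * r)) * real (2 * n + 1) ^ n)"
      proof (rule sum_mono)
        fix i assume "i \<in> {..degree (q * r)}"
        then have "i \<le> n" using qr(2) by simp
        have "real x ^ i \<le> real (2 * n + 1) ^ i" using x(1) by (intro power_mono) auto
        also have "\<dots> \<le> real (2 * n + 1) ^ n" using \<open>i \<le> n\<close> by (intro power_increasing) auto
        finally have px: "real x ^ i \<le> real (2 * n + 1) ^ n" .
        have "\<bar>real_of_int (coeff (q * r) i) * real x ^ i\<bar> = real_of_int \<bar>coeff (q * r) i\<bar> * real x ^ i" by (simp add: abs_mult)
        also have "\<dots> \<le> real_of_int (poly_height (q * r)) * real (2 * n + 1) ^ n"
          using px abs_coeff_le_poly_height[of "q * r" i] poly_height_nonneg[of "q * r"] by (intro mult_mono of_int_le_iff[THEN iffD2]) auto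
        finally show "\<bar>real_of_int (coeff (q * r) i) * real x ^ i\<bar> \<le> real_of_int (poly_height (q * r)) * real (2 * n + 1) ^ n" .
      qed
      also have "\<dots> = real (degree (q * r) + 1) * (real_of_int (poly_height (q * r)) * real (2 * n + 1) ^ n)" by simp
      also have "\<dots> \<le> real (n + 1) * (real_of_int (poly_height (q * r)) * real (2 * n + 1) ^ n)"
        using qr(2) poly_height_nonneg[of "q * r"] by (intro mult_right_mono) auto
      finally show ?thesis by (simp only: mult_ac)
    qed
    then have "c\<^sup>2 * \<bar>ev (q * r) x\<bar> \<le> K0 * real_of_int (poly_height (q * r))"
      unfolding K0_def mult.assoc by (intro mult_left_mono) (auto simp: mult.assoc)
    also have "\<dots> \<le> real K * real_of_int (poly_height (q * r))"
    proof (rule mult_right_mono)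
      show "K0 \<le> real K" unfolding K_def by linarith
    qed (simp add: poly_height_nonneg)
    finally have "real_of_int (poly_height q * poly_height r) \<le> real_of_int (int K * poly_height (q * r))" by simp
    then show ?thesis by (simp only: of_int_le_iff)
  qed
  then show ?thesis by (intro exI[of _ K]) (simp add: K_def)
qed

section \<open>Counting products of two factors\<close>

lemma sum_inverse_squares_le_2: "(\<Sum>g=1..N. 1 / (real g)\<^sup>2) \<le> 2"
proof (cases "N \<ge> 1")
  case True
  then have "{1..N} = insert 1 {2..N}" by auto
  then show ?thesis using sum_inverse_squares_le[of N] by simp
qed auto

text \<open>About \<open>h ^ v\<close> polynomials have height exactly \<open>h\<close>, so grouping
  by height leaves a sum of inverse squares. The bound is free of \<open>L\<close>.\<close>

lemma sum_heights_le:
  "(\<Sum>b\<in>polys_bounded v L - {0}. 1 / real (nat (poly_height b)) ^ (v + 2)) \<le> 4 * real (v + 1) * 3 ^ v"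
proof -
  define B where "B = polys_bounded v L - {0}"
  have finB: "finite B" unfolding B_def using finite_polys_bounded by simp
  have img: "(\<lambda>b. nat (poly_height b)) ` B \<subseteq> {1..L}"
  proof
    fix h assume "h \<in> (\<lambda>b. nat (poly_height b)) ` B"
    then obtain b where b: "b \<in> B" "h = nat (poly_height b)" by blast
    then have "poly_height b \<ge> 1" "poly_height b \<le> int L"
      using poly_height_pos by (auto simp: B_def polys_bounded_iff_height)
    then show "h \<in> {1..L}" using b(2) by auto
  qed
  have "(\<Sum>b\<in>B. 1 / real (nat (poly_height b)) ^ (v + 2))
      = (\<Sum>h\<in>{1..L}. \<Sum>b\<in>{b\<in>B. nat (poly_height b) = h}. 1 / real (nat (poly_height b)) ^ (v + 2))"
    by (rule sum.group[symmetric, OF finB _ img]) simp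
  also have "\<dots> \<le> (\<Sum>h\<in>{1..L}. 2 * real (v + 1) * 3 ^ v * (1 / (real h)\<^sup>2))"
  proof (rule sum_mono)
    fix h assume h: "h \<in> {1..L}"
    have fin: "finite {p. degree p \<le> v \<and> poly_height p = int h}"
      by (rule finite_subset[OF _ finite_polys_bounded[of v h]]) (auto simp: polys_bounded_iff_height)
    have "card {b\<in>B. nat (poly_height b) = h} \<le> card {p. degree p \<le> v \<and> poly_height p = int h}"
      using h by (intro card_mono fin) (auto simp: B_def polys_bounded_iff_height)
    also have "\<dots> \<le> 2 * (v + 1) * (2 * h + 1) ^ v" by (rule card_polys_height_eq)
    also have "\<dots> \<le> 2 * (v + 1) * (3 * h) ^ v" using h by (intro mult_left_mono power_mono) auto
    finally have c: "real (card {b\<in>B. nat (poly_height b) = h}) \<le> real (2 * (v + 1) * (3 * h) ^ v)" by (rule of_nat_mono)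
    have "(\<Sum>b\<in>{b\<in>B. nat (poly_height b) = h}. 1 / real (nat (poly_height b)) ^ (v + 2))
      = real (card {b\<in>B. nat (poly_height b) = h}) * (1 / real h ^ (v + 2))" by simp
    also have "\<dots> \<le> real (2 * (v + 1) * (3 * h) ^ v) * (1 / real h ^ (v + 2))"
      using c by (intro mult_right_mono) auto
    also have "\<dots> = 2 * real (v + 1) * 3 ^ v * (1 / (real h)\<^sup>2)"
    proof -
      have "real (2 * (v + 1) * (3 * h) ^ v) = 2 * real (v + 1) * 3 ^ v * real h ^ v"
        by (simp add: power_mult_distrib algebra_simps)
      moreover have "real h ^ (v + 2) = real h ^ v * (real h)\<^sup>2" by (rule power_add)
      moreover have "real h ^ v \<noteq> 0" using h by simp
      ultimately show ?thesis by (simp only: times_divide_eq_right mult_1_right) simp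
    qed
    finally show "(\<Sum>b\<in>{b\<in>B. nat (poly_height b) = h}. 1 / real (nat (poly_height b)) ^ (v + 2))
      \<le> 2 * real (v + 1) * 3 ^ v * (1 / (real h)\<^sup>2)" .
  qed
  also have "\<dots> = 2 * real (v + 1) * 3 ^ v * (\<Sum>h=1..L. 1 / (real h)\<^sup>2)" by (simp only: sum_distrib_left)
  also have "\<dots> \<le> 2 * real (v + 1) * 3 ^ v * 2" by (intro mult_left_mono sum_inverse_squares_le_2) auto
  also have "\<dots> = 4 * real (v + 1) * 3 ^ v" by simp
  finally show ?thesis unfolding B_def .
qed

text \<open>If \<open>v < u\<close>, then \<open>u + 1 \<le> n\<close> and
  \<open>v + 2 \<le> u + 1\<close> suffice. If \<open>v = u\<close>, one power of \<open>h\<close>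
  is missing and is traded for \<open>K * M\<close>, which requires \<open>u + 2 \<le> n\<close>;
  this follows from \<open>2 * u \<le> n\<close> exactly because \<open>u \<ge> 2\<close>.\<close>

lemma product_count_exponents:
  fixes M h K :: real
  assumes "1 \<le> v" "v \<le> u" "2 \<le> u" "u + v \<le> n" "1 \<le> M" "1 \<le> h" "h \<le> K * M" "1 \<le> K"
  shows "M ^ (u + 1) / h ^ (u + 1) \<le> K * M ^ n * (1 / h ^ (v + 2))"
proof -
  have "M ^ (u + 1) * h ^ (v + 2) \<le> K * M ^ n * h ^ (u + 1)"
  proof (cases "v < u")
    case True
    have "M ^ (u + 1) * h ^ (v + 2) \<le> M ^ n * h ^ (u + 1)"
      using assms True by (intro mult_mono power_increasing) auto
    also have "\<dots> \<le> K * (M ^ n * h ^ (u + 1))"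
      using assms mult_right_mono[of 1 K "M ^ n * h ^ (u + 1)"] by simp
    finally show ?thesis by (simp only: mult.assoc)
  next
    case False
    then have v: "v = u" using assms by simp
    have "M ^ (u + 1) * h ^ (v + 2) = (M ^ (u + 1) * h ^ (u + 1)) * h" by (simp add: v)
    also have "\<dots> \<le> (M ^ (u + 1) * h ^ (u + 1)) * (K * M)" using assms by (intro mult_left_mono) auto
    also have "\<dots> = K * M ^ (u + 2) * h ^ (u + 1)" by simp
    also have "\<dots> \<le> K * M ^ n * h ^ (u + 1)"
      using assms v by (intro mult_right_mono mult_left_mono power_increasing) auto
    finally show ?thesis .
  qed
  then show ?thesis using assms by (simp add: field_simps)
qed

text \<open>Given the factor \<open>b\<close> of height \<open>h\<close>, the other factor has
  height at most \<open>K * M / h\<close>, which leaves of order \<open>(M / h) ^ (u + 1)\<close>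
  choices. The sum runs over the factor with the smaller degree bound, so that the power of
  \<open>h\<close> in the denominator outweighs the number of \<open>b\<close> of that
  height.\<close>

lemma card_products_le:
  assumes uv: "1 \<le> v" "v \<le> u" "2 \<le> u" "u + v \<le> n" and M: "1 \<le> M" and K: "1 \<le> K"
  shows "finite {a * b | a b. degree a \<le> u \<and> degree b \<le> v \<and> a \<noteq> 0 \<and> b \<noteq> 0 \<and> poly_height a * poly_height b \<le> int (K * M)}" (is ?fin)
    and "real (card {a * b | a b. degree a \<le> u \<and> degree b \<le> v \<and> a \<noteq> 0 \<and> b \<noteq> 0 \<and> poly_height a * poly_height b \<le> int (K * M)})
    \<le> (3 * real K) ^ (n + 1) * real K * (4 * real (n + 1) * 3 ^ n) * real M ^ n"
proof -
  define B where "B = polys_bounded v (K * M) - {0}"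
  define A where "A b = polys_bounded u (K * M div nat (poly_height b))" for b
  have finB: "finite B" unfolding B_def using finite_polys_bounded by simp
  have sub: "{a * b | a b. degree a \<le> u \<and> degree b \<le> v \<and> a \<noteq> 0 \<and> b \<noteq> 0 \<and> poly_height a * poly_height b \<le> int (K * M)}
    \<subseteq> (\<lambda>p. snd p * fst p) ` Sigma B A"
  proof
    fix p assume "p \<in> {a * b | a b. degree a \<le> u \<and> degree b \<le> v \<and> a \<noteq> 0 \<and> b \<noteq> 0 \<and> poly_height a * poly_height b \<le> int (K * M)}"
    then obtain a b where ab: "p = a * b" "degree a \<le> u" "degree b \<le> v" "a \<noteq> 0" "b \<noteq> 0"
      "poly_height a * poly_height b \<le> int (K * M)" by blast
    define x y where "x = nat (poly_height a)" and "y = nat (poly_height b)"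
    have xy: "poly_height a = int x" "poly_height b = int y" "x \<ge> 1" "y \<ge> 1"
      using poly_height_pos[OF ab(4)] poly_height_pos[OF ab(5)] by (auto simp: x_def y_def)
    have "int (x * y) \<le> int (K * M)" using ab(6) by (simp add: xy)
    then have le: "x * y \<le> K * M" by (simp only: of_nat_le_iff)
    then have "x \<le> K * M div y" using xy(4) by (simp add: less_eq_div_iff_mult_less_eq)
    then have "a \<in> A b" using ab(2) unfolding A_def polys_bounded_iff_height y_def[symmetric] by (simp add: xy(1))
    moreover have "y \<le> K * M" using le xy(3) by (metis One_nat_def mult_le_mono1 nat_mult_1 order_trans)
    then have "int y \<le> int (K * M)" by (simp only: of_nat_le_iff)
    then have "b \<in> B" using ab(3,5) by (simp add: B_def polys_bounded_iff_height xy(2) del: of_nat_mult)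
    ultimately show "p \<in> (\<lambda>p. snd p * fst p) ` Sigma B A" using ab(1) by force
  qed
  have finS: "finite (Sigma B A)" using finB finite_polys_bounded by (auto simp: A_def)
  show ?fin by (rule finite_subset[OF sub finite_imageI[OF finS]])
  have "card {a * b | a b. degree a \<le> u \<and> degree b \<le> v \<and> a \<noteq> 0 \<and> b \<noteq> 0 \<and> poly_height a * poly_height b \<le> int (K * M)}
    \<le> card ((\<lambda>p. snd p * fst p) ` Sigma B A)" by (rule card_mono[OF finite_imageI[OF finS] sub])
  also have "\<dots> \<le> card (Sigma B A)" by (rule card_image_le[OF finS])
  also have "\<dots> = (\<Sum>b\<in>B. card (A b))" using finB finite_polys_bounded by (intro card_SigmaI) (auto simp: A_def)
  finally have "real (card {a * b | a b. degree a \<le> u \<and> degree b \<le> v \<and> a \<noteq> 0 \<and> b \<noteq> 0 \<and> poly_height a * poly_height b \<le> int (K * M)})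
    \<le> real (\<Sum>b\<in>B. card (A b))" by (rule of_nat_mono)
  also have "\<dots> = (\<Sum>b\<in>B. real (card (A b)))" by simp
  also have "\<dots> \<le> (\<Sum>b\<in>B. ((3 * real K) ^ (n + 1) * real K * real M ^ n) * (1 / real (nat (poly_height b)) ^ (v + 2)))"
  proof (rule sum_mono)
    fix b assume b: "b \<in> B"
    define h where "h = nat (poly_height b)"
    have h: "1 \<le> h" "h \<le> K * M"
      using b poly_height_pos[of b] by (auto simp: h_def B_def polys_bounded_iff_height nat_le_iff simp del: of_nat_mult)
    have hr: "1 \<le> real h" "real h \<le> real K * real M" using h by (auto simp flip: of_nat_mult)
    have "real (K * M div h) \<le> real (K * M) / real h" by (rule of_nat_div_le_of_nat)
    then have "real (2 * (K * M div h) + 1) \<le> 2 * (real K * real M / real h) + 1" by simp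
    \<comment> \<open>The summand 1 is at most \<open>K * M / h\<close> because
      \<open>h \<le> K * M\<close>.\<close>
    also have "\<dots> \<le> 3 * real K * (real M / real h)" using hr by (simp add: field_simps)
    finally have base: "real (2 * (K * M div h) + 1) \<le> 3 * real K * (real M / real h)" .
    have "real (card (A b)) = real (2 * (K * M div h) + 1) ^ (u + 1)"
      unfolding A_def card_polys_bounded h_def by (rule of_nat_power)
    also have "\<dots> \<le> (3 * real K * (real M / real h)) ^ (u + 1)" using base by (intro power_mono) auto
    also have "\<dots> = (3 * real K) ^ (u + 1) * (real M ^ (u + 1) / real h ^ (u + 1))"
      by (simp only: power_mult_distrib power_divide)
    also have "\<dots> \<le> (3 * real K) ^ (n + 1) * (real K * real M ^ n * (1 / real h ^ (v + 2)))"
      using uv M K hr by (intro mult_mono power_increasing product_count_exponents) auto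
    finally show "real (card (A b)) \<le> ((3 * real K) ^ (n + 1) * real K * real M ^ n) * (1 / real (nat (poly_height b)) ^ (v + 2))"
      unfolding h_def by (simp only: mult.assoc)
  qed
  also have "\<dots> = ((3 * real K) ^ (n + 1) * real K * real M ^ n) * (\<Sum>b\<in>B. 1 / real (nat (poly_height b)) ^ (v + 2))"
    by (simp only: sum_distrib_left)
  also have "\<dots> \<le> ((3 * real K) ^ (n + 1) * real K * real M ^ n) * (4 * real (n + 1) * 3 ^ n)"
  proof (rule mult_left_mono)
    have "(\<Sum>b\<in>B. 1 / real (nat (poly_height b)) ^ (v + 2)) \<le> 4 * real (v + 1) * 3 ^ v" unfolding B_def by (rule sum_heights_le)
    also have "\<dots> \<le> 4 * real (n + 1) * 3 ^ n" using uv by (intro mult_mono power_increasing) auto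
    finally show "(\<Sum>b\<in>B. 1 / real (nat (poly_height b)) ^ (v + 2)) \<le> 4 * real (n + 1) * 3 ^ n" .
  qed simp
  finally show "real (card {a * b | a b. degree a \<le> u \<and> degree b \<le> v \<and> a \<noteq> 0 \<and> b \<noteq> 0 \<and> poly_height a * poly_height b \<le> int (K * M)})
    \<le> (3 * real K) ^ (n + 1) * real K * (4 * real (n + 1) * 3 ^ n) * real M ^ n" by (simp only: mult_ac)
qed

text \<open>The factor \<open>q\<close> stands for the minimal polynomial of a nonreal number, hence
  the bound 2 on its degree; \<open>r\<close> is the cofactor that keeps \<open>p\<close> from being
  minimal.\<close>

definition nontrivial_products :: "nat \<Rightarrow> nat \<Rightarrow> int poly set" where
  "nontrivial_products n M = {p \<in> polys_bounded n M. \<exists>q r. p = q * r \<and> 2 \<le> degree q \<and> 1 \<le> degree r}"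

lemma card_nontrivial_products_le:
  "\<exists>C\<ge>0. \<forall>M\<ge>1. real (card (nontrivial_products n M)) \<le> C * real M ^ n"
proof -
  obtain K where K: "1 \<le> K" and Kmult: "\<And>q r. q * r \<noteq> 0 \<Longrightarrow> degree (q * r) \<le> n \<Longrightarrow>
      poly_height q * poly_height r \<le> int K * poly_height (q * r)"
    using poly_height_mult_le[of n] by blast
  define C where "C = (3 * real K) ^ (n + 1) * real K * (4 * real (n + 1) * 3 ^ n)"
  define S where "S u v M = {a * b | a b. degree a \<le> u \<and> degree b \<le> v \<and> a \<noteq> 0 \<and> b \<noteq> 0 \<and> poly_height a * poly_height b \<le> int (K * M)}"
    for u v M
  \<comment> \<open>Pairs of degrees with the larger one first, whether it belongs to
    \<open>q\<close> or to \<open>r\<close>; either way it is at least 2.\<close>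
  define UV where "UV = {(u, v). 1 \<le> v \<and> v \<le> u \<and> 2 \<le> u \<and> u + v \<le> n}"
  have UVsub: "UV \<subseteq> {..n} \<times> {..n}" by (auto simp: UV_def)
  then have finUV: "finite UV" by (rule finite_subset) auto
  have cUV: "card UV \<le> (n + 1) ^ 2"
    using card_mono[OF _ UVsub] by (simp add: power2_eq_square)
  have C0: "C \<ge> 0" by (simp add: C_def)
  show ?thesis
  proof (intro exI[of _ "real ((n + 1) ^ 2) * C"] conjI allI impI)
    show "0 \<le> real ((n + 1) ^ 2) * C" using C0 by simp
    fix M :: nat assume M: "1 \<le> M"
    have sub: "nontrivial_products n M \<subseteq> (\<Union>(u, v)\<in>UV. S u v M \<inter> polys_bounded n M)"
    proof
      fix p assume "p \<in> nontrivial_products n M"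
      then obtain q r where p: "p \<in> polys_bounded n M" "p = q * r" "2 \<le> degree q" "1 \<le> degree r"
        by (auto simp: nontrivial_products_def)
      have nz: "q \<noteq> 0" "r \<noteq> 0" "q * r \<noteq> 0" using p(3,4) by auto
      have deg: "degree q + degree r \<le> n" using p(1,2) nz by (simp add: polys_bounded_def degree_mult_eq)
      have "poly_height q * poly_height r \<le> int K * poly_height (q * r)"
        using p(1,2) nz by (intro Kmult) (auto simp: polys_bounded_def)
      also have "\<dots> \<le> int K * int M" using p(1,2) by (intro mult_left_mono) (auto simp: polys_bounded_iff_height)
      finally have ht: "poly_height q * poly_height r \<le> int (K * M)" by simp
      show "p \<in> (\<Union>(u, v)\<in>UV. S u v M \<inter> polys_bounded n M)"
      proof (cases "degree r \<le> degree q")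
        case True
        then have "(degree q, degree r) \<in> UV" using p deg by (auto simp: UV_def)
        moreover have "p \<in> S (degree q) (degree r) M" unfolding S_def using p(2) nz ht by blast
        ultimately show ?thesis using p(1) by blast
      next
        case False
        then have "(degree r, degree q) \<in> UV" using p deg by (auto simp: UV_def)
        moreover have "p = r * q" "poly_height r * poly_height q \<le> int (K * M)" using p(2) ht by (simp_all add: mult.commute)
        then have "p \<in> S (degree r) (degree q) M" unfolding S_def using nz by blast
        ultimately show ?thesis using p(1) by blast
      qed
    qed
    have "card (nontrivial_products n M) \<le> card (\<Union>(u, v)\<in>UV. S u v M \<inter> polys_bounded n M)"
      using finUV finite_polys_bounded by (intro card_mono sub) auto
    also have "\<dots> \<le> (\<Sum>x\<in>UV. card (case x of (u, v) \<Rightarrow> S u v M \<inter> polys_bounded n M))"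
      by (rule card_UN_le[OF finUV])
    finally have "real (card (nontrivial_products n M)) \<le> real (\<Sum>x\<in>UV. card (case x of (u, v) \<Rightarrow> S u v M \<inter> polys_bounded n M))"
      by (rule of_nat_mono)
    also have "\<dots> = (\<Sum>x\<in>UV. real (card (case x of (u, v) \<Rightarrow> S u v M \<inter> polys_bounded n M)))" by simp
    also have "\<dots> \<le> (\<Sum>x\<in>UV. C * real M ^ n)"
    proof (rule sum_mono)
      fix x assume x: "x \<in> UV"
      obtain u v where xe: "x = (u, v)" by (cases x)
      have uv: "1 \<le> v" "v \<le> u" "2 \<le> u" "u + v \<le> n" using x by (auto simp: xe UV_def)
      show "real (card (case x of (u, v) \<Rightarrow> S u v M \<inter> polys_bounded n M)) \<le> C * real M ^ n"
      proof -
        have "card (S u v M \<inter> polys_bounded n M) \<le> card (S u v M)"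
          using card_products_le(1)[OF uv M K] unfolding S_def by (intro card_mono) auto
        also have "real (card (S u v M)) \<le> C * real M ^ n"
          unfolding S_def C_def by (rule card_products_le(2)[OF uv M K])
        finally show ?thesis by (simp add: xe)
      qed
    qed
    also have "\<dots> = real (card UV) * (C * real M ^ n)" by simp
    also have "\<dots> \<le> real ((n + 1) ^ 2) * (C * real M ^ n)" using cUV C0 by (intro mult_right_mono of_nat_mono) auto
    finally show "real (card (nontrivial_products n M)) \<le> real ((n + 1) ^ 2) * C * real M ^ n" by (simp only: mult.assoc)
  qed
qed

section \<open>Minimal polynomials\<close>

abbreviation int_roots :: "complex set \<Rightarrow> int poly \<Rightarrow> complex set" where
  "int_roots \<Omega> p \<equiv> {z\<in>\<Omega>. poly (map_poly of_int p) z = 0}"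

lemma map_poly_of_int_eq_0_iff: "(map_poly of_int p :: complex poly) = 0 \<longleftrightarrow> p = 0"
  by (auto simp: poly_eq_iff coeff_map_poly)

lemma poly_map_of_int_smult:
  "poly (map_poly of_int (smult c p)) (z :: complex) = of_int c * poly (map_poly of_int p) z"
proof -
  have "map_poly of_int (smult c p) = smult (of_int c :: complex) (map_poly of_int p)"
    by (rule poly_eqI) (simp add: coeff_map_poly)
  then show ?thesis by simp
qed

lemma finite_int_roots: "p \<noteq> 0 \<Longrightarrow> finite (int_roots \<Omega> p)"
  using poly_roots_finite[of "map_poly of_int p :: complex poly"] map_poly_of_int_eq_0_iff[of p]
  by (auto intro: finite_subset[rotated])

lemma card_int_roots_le: "p \<noteq> 0 \<Longrightarrow> card (int_roots \<Omega> p) \<le> degree p"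
proof -
  assume "p \<noteq> 0"
  then have nz: "(map_poly of_int p :: complex poly) \<noteq> 0" by (simp add: map_poly_of_int_eq_0_iff)
  have "card (int_roots \<Omega> p) \<le> card {z. poly (map_poly of_int p) (z::complex) = 0}"
    using poly_roots_finite[OF nz] by (intro card_mono) auto
  also have "\<dots> \<le> degree (map_poly of_int p :: complex poly)" by (rule card_poly_roots_bound[OF nz])
  also have "\<dots> = degree p" by (rule degree_map_poly) simp
  finally show ?thesis .
qed

lemma smult_left_cancel: "a \<noteq> 0 \<Longrightarrow> smult a p = smult a q \<Longrightarrow> p = q" for a :: int
  by (simp add: poly_eq_iff)

text \<open>Pseudo-division stays within integer polynomials. The remainder vanishes at
  \<open>z\<close> and has smaller degree, so minimality makes it 0; it remains to remove the
  multiplier \<open>a\<close>.\<close>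

lemma is_min_poly_dvd:
  assumes q: "is_min_poly z q" and p: "poly (map_poly of_int p) z = 0"
  shows "q dvd p"
proof -
  have q0: "q \<noteq> 0" and cq: "content q = 1" using q by (auto simp: is_min_poly_def)
  obtain a s where as: "a \<noteq> 0" "smult a p = q * s + pseudo_mod p q"
    "pseudo_mod p q = 0 \<or> degree (pseudo_mod p q) < degree q"
    using pseudo_mod[OF q0, of p] by blast
  have "pseudo_mod p q = smult a p + smult (-1) (q * s)" using as(2) by simp
  also have "map_poly of_int \<dots> = (map_poly of_int (smult a p) + map_poly of_int (smult (-1) (q * s)) :: complex poly)"
    by (rule poly_eqI) (simp add: coeff_map_poly)
  finally have "poly (map_poly of_int (pseudo_mod p q)) z = 0"
    using p q by (simp only: poly_add poly_map_of_int_smult map_poly_of_int_mult poly_mult is_min_poly_def) simp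
  then have "pseudo_mod p q = 0" using as(3) q unfolding is_min_poly_def by (metis not_less)
  then have eq: "smult a p = q * s" using as(2) by simp
  \<comment> \<open>Gauss's lemma: the content is multiplicative and that of \<open>q\<close> is 1,
    so \<open>a\<close> divides the content of \<open>s\<close> and cancels.\<close>
  then have "content (smult a p) = content s" using cq by (simp add: content_mult)
  then have "a dvd content s" by (metis content_smult dvd_triv_left normalize_dvd_iff dvd_mult2 dvd_refl)
  then have "[:a:] dvd s" by (simp add: const_poly_dvd_iff_dvd_content)
  then obtain t where "s = smult a t" by (auto simp: dvd_def)
  then have "smult a p = smult a (q * t)" using eq by simp
  then have "p = q * t" by (rule smult_left_cancel[OF as(1)])
  then show ?thesis by simp
qed

lemma is_min_poly_exists:
  assumes "p \<noteq> 0" "poly (map_poly of_int p) z = 0"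
  obtains q where "is_min_poly z q"
proof -
  define A where "A = (\<lambda>q. q \<noteq> 0 \<and> poly (map_poly of_int q) z = 0)"
  have "A p" using assms by (simp add: A_def)
  then obtain q where q: "A q" "\<And>r. A r \<Longrightarrow> degree q \<le> degree r"
    using ex_has_least_nat[of A p degree] by blast
  have qd: "q = smult (content q) (primitive_part q)" by simp
  have cq: "content q \<noteq> 0" using q(1) by (simp add: A_def)
  have "poly (map_poly of_int q) z = of_int (content q) * poly (map_poly of_int (primitive_part q)) z"
    by (subst qd) (rule poly_map_of_int_smult)
  then have "poly (map_poly of_int (primitive_part q)) z = 0" using q(1) cq unfolding A_def by (metis mult_eq_0_iff of_int_eq_0_iff)
  then have "is_min_poly z (primitive_part q)"
    using q by (auto simp: is_min_poly_def A_def content_primitive_part)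
  then show ?thesis by (rule that)
qed

lemma primitive_smult:
  assumes "content (p :: int poly) = 1" "content q = 1" "p = smult c q"
  shows "p = q \<or> p = - q"
proof -
  have "\<bar>c\<bar> = 1" using assms by (simp add: content_smult)
  then have "c = 1 \<or> c = -1" by linarith
  then show ?thesis using assms(3) by auto
qed

lemma is_min_poly_uminus: "is_min_poly z p \<Longrightarrow> is_min_poly z (- p)"
  using poly_map_of_int_smult[of "-1" p z] content_smult[of "-1" p] by (auto simp: is_min_poly_def)

lemma is_min_poly_unique:
  assumes p: "is_min_poly z p" and q: "is_min_poly z q"
  shows "p = q \<or> p = - q"
proof -
  have "q dvd p" using is_min_poly_dvd[OF q] p by (simp add: is_min_poly_def)
  then obtain u where u: "p = q * u" by (auto simp: dvd_def)
  have "p \<noteq> 0" "degree p \<le> degree q" using p q by (auto simp: is_min_poly_def)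
  then have "degree u = 0" using u by (auto simp: degree_mult_eq)
  then obtain c where "u = [:c:]" by (metis degree_eq_zeroE)
  then show ?thesis using p q u by (intro primitive_smult) (auto simp: is_min_poly_def)
qed

lemma two_le_degree_of_nonreal_root:
  fixes z :: complex
  assumes "p \<noteq> 0" "poly (map_poly of_int p) z = 0" "z \<notin> \<real>"
  shows "degree p \<ge> 2"
proof (rule ccontr)
  assume "\<not> ?thesis"
  then have "degree p \<le> 1" by simp
  then have "p = [:coeff p 0, coeff p 1:]"
    by (auto simp: poly_eq_iff coeff_pCons coeff_eq_0 split: nat.split)
  then obtain a b where p: "p = [:a, b:]" by blast
  have "of_int a + z * of_int b = 0" using assms(2) by (simp add: p map_poly_pCons)
  moreover have "b \<noteq> 0"
  proof
    assume "b = 0" then show False using calculation assms(1) by (simp add: p)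
  qed
  moreover have "z * of_int b = - of_int a" using calculation by (simp add: add_eq_0_iff)
  ultimately have "z = - of_int a / of_int b" by (intro nonzero_eq_divide_eq[THEN iffD2]) auto
  then have "z = of_real (- real_of_int a / real_of_int b)" by simp
  then show False using assms(3) by (metis Reals_of_real)
qed

section \<open>Roots of primitive polynomials\<close>

definition primitives_bounded :: "nat \<Rightarrow> nat \<Rightarrow> int poly set" where
  "primitives_bounded n M = {p\<in>polys_bounded n M. content p = 1}"

definition primitive_root_count :: "nat \<Rightarrow> complex set \<Rightarrow> nat \<Rightarrow> nat" where
  "primitive_root_count n \<Omega> M = (\<Sum>p\<in>primitives_bounded n M. card (int_roots \<Omega> p))"

lemma finite_primitives_bounded: "finite (primitives_bounded n M)"
  using finite_polys_bounded by (simp add: primitives_bounded_def)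

lemma nonzero_of_primitive: "p \<in> primitives_bounded n M \<Longrightarrow> p \<noteq> 0"
  by (auto simp: primitives_bounded_def)

text \<open>Pairs of a number and one of its minimal polynomials are counted in two ways;
  \<open>is_min_poly\<close> leaves the sign open, so every number occurs twice. This is the 2 in
  the denominator of the asymptotic formula.\<close>

lemma twice_Psi:
  assumes "Q \<ge> 0"
  shows "2 * Psi n Q \<Omega> = (\<Sum>p\<in>primitives_bounded n (nat \<lfloor>Q\<rfloor>). card {z\<in>\<Omega>. is_min_poly z p})"
proof -
  define M where "M = nat \<lfloor>Q\<rfloor>"
  define Z where "Z = {z\<in>\<Omega>. \<exists>p\<in>primitives_bounded n M. is_min_poly z p}"
  have "degree p \<le> n \<and> real_of_int (poly_height p) \<le> Q \<longleftrightarrow> p \<in> polys_bounded n M" for p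
    using assms by (simp add: polys_bounded_iff_height M_def le_floor_iff)
  then have "Psi n Q \<Omega> = card Z"
    unfolding Psi_def Z_def primitives_bounded_def by (intro arg_cong[where f = card]) (auto simp: is_min_poly_def)
  moreover have "(\<Sum>p\<in>primitives_bounded n M. card {z\<in>Z. is_min_poly z p}) = 2 * card Z"
  proof (rule sum_multicount[OF finite_primitives_bounded])
    show "finite Z"
    proof (rule finite_subset)
      show "Z \<subseteq> (\<Union>p\<in>primitives_bounded n M. int_roots \<Omega> p)" by (auto simp: Z_def is_min_poly_def)
      show "finite (\<Union>p\<in>primitives_bounded n M. int_roots \<Omega> p)"
        using finite_primitives_bounded nonzero_of_primitive by (intro finite_UN_I finite_int_roots) auto
    qed
    show "\<forall>z\<in>Z. card {p\<in>primitives_bounded n M. is_min_poly z p} = 2"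
    proof
      fix z assume "z \<in> Z"
      then obtain p where p: "p \<in> primitives_bounded n M" "is_min_poly z p" by (auto simp: Z_def)
      have "- p \<in> primitives_bounded n M"
        using p is_min_poly_uminus[OF p(2)] by (simp add: primitives_bounded_def polys_bounded_def is_min_poly_def)
      then have "{p\<in>primitives_bounded n M. is_min_poly z p} = {p, - p}"
        using p is_min_poly_uminus[OF p(2)] is_min_poly_unique[OF _ p(2)] by auto
      moreover have "p \<noteq> - p"
      proof
        assume "p = - p"
        then have "\<And>i. coeff p i = - coeff p i" by (metis coeff_minus)
        then have "\<And>i. coeff p i = 0" by (metis equal_neg_zero)
        then show False using nonzero_of_primitive[OF p(1)] by (auto simp: poly_eq_iff)
      qed
      ultimately show "card {p\<in>primitives_bounded n M. is_min_poly z p} = 2" by simp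
    qed
  qed
  moreover have "{z\<in>Z. is_min_poly z p} = {z\<in>\<Omega>. is_min_poly z p}" if "p \<in> primitives_bounded n M" for p
    using that by (auto simp: Z_def)
  ultimately show ?thesis by (simp add: M_def)
qed

text \<open>The minimal polynomial of a nonreal root divides \<open>p\<close> and has degree at
  least 2. Outside \<open>nontrivial_products\<close> the cofactor is constant, and as both
  polynomials are primitive it is a sign.\<close>

lemma int_roots_min_poly:
  assumes "\<Omega> \<inter> \<real> = {}" "p \<in> primitives_bounded n M" "p \<notin> nontrivial_products n M"
  shows "int_roots \<Omega> p = {z\<in>\<Omega>. is_min_poly z p}"
proof (intro equalityI subsetI)
  fix z assume z: "z \<in> int_roots \<Omega> p"
  have p0: "p \<noteq> 0" by (rule nonzero_of_primitive[OF assms(2)])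
  then obtain q where q: "is_min_poly z q" using z is_min_poly_exists[of p z] by blast
  then obtain r where r: "p = q * r" using is_min_poly_dvd[of z q p] z by (auto simp: dvd_def)
  have "degree q \<ge> 2" using q z assms(1) by (intro two_le_degree_of_nonreal_root[of q z]) (auto simp: is_min_poly_def)
  then have "\<not> 1 \<le> degree r" using assms(2,3) r by (auto simp: nontrivial_products_def primitives_bounded_def)
  then obtain c where "r = [:c:]" using degree_eq_zeroE[of r] by auto
  then have "p = q \<or> p = - q"
    using assms(2) q r by (intro primitive_smult[of p q c]) (auto simp: primitives_bounded_def is_min_poly_def)
  then show "z \<in> {z\<in>\<Omega>. is_min_poly z p}" using z q is_min_poly_uminus by auto
qed (auto simp: is_min_poly_def)

text \<open>Outside \<open>nontrivial_products\<close> the roots in \<Omega> of a primitive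
  polynomial are exactly the numbers having it as minimal polynomial. Each exceptional polynomial
  adds at most \<open>n\<close> roots.\<close>

lemma primitive_root_count_minus_Psi:
  assumes "\<Omega> \<inter> \<real> = {}" "Q \<ge> 0"
  shows "2 * Psi n Q \<Omega> \<le> primitive_root_count n \<Omega> (nat \<lfloor>Q\<rfloor>)"
    "primitive_root_count n \<Omega> (nat \<lfloor>Q\<rfloor>) \<le> 2 * Psi n Q \<Omega> + n * card (nontrivial_products n (nat \<lfloor>Q\<rfloor>))"
proof -
  define M where "M = nat \<lfloor>Q\<rfloor>"
  show "2 * Psi n Q \<Omega> \<le> primitive_root_count n \<Omega> (nat \<lfloor>Q\<rfloor>)"
    unfolding twice_Psi[OF assms(2)] primitive_root_count_def
    using nonzero_of_primitive by (intro sum_mono card_mono finite_int_roots) (auto simp: is_min_poly_def)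
  have fin: "finite (nontrivial_products n M)" using finite_polys_bounded by (simp add: nontrivial_products_def)
  have "primitive_root_count n \<Omega> M \<le> (\<Sum>p\<in>primitives_bounded n M. card {z\<in>\<Omega>. is_min_poly z p} + (if p \<in> nontrivial_products n M then n else 0))"
    unfolding primitive_root_count_def
  proof (rule sum_mono)
    fix p assume p: "p \<in> primitives_bounded n M"
    have "card (int_roots \<Omega> p) \<le> degree p" by (rule card_int_roots_le[OF nonzero_of_primitive[OF p]])
    also have "\<dots> \<le> n" using p by (simp add: primitives_bounded_def polys_bounded_def)
    finally have le: "card (int_roots \<Omega> p) \<le> n" .
    show "card (int_roots \<Omega> p) \<le> card {z\<in>\<Omega>. is_min_poly z p} + (if p \<in> nontrivial_products n M then n else 0)"
    proof (cases "p \<in> nontrivial_products n M")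
      case True then show ?thesis using le by simp
    next
      case False then show ?thesis using int_roots_min_poly[OF assms(1) p False] by simp
    qed
  qed
  also have "\<dots> = 2 * Psi n Q \<Omega> + (\<Sum>p\<in>primitives_bounded n M. if p \<in> nontrivial_products n M then n else 0)"
    unfolding twice_Psi[OF assms(2)] M_def by (rule sum.distrib)
  also have "(\<Sum>p\<in>primitives_bounded n M. if p \<in> nontrivial_products n M then n else 0)
    = n * card (primitives_bounded n M \<inter> nontrivial_products n M)"
    using finite_primitives_bounded by (subst sum.inter_restrict[symmetric]) auto
  also have "\<dots> \<le> n * card (nontrivial_products n M)" using fin by (intro mult_left_mono card_mono) auto
  finally show "primitive_root_count n \<Omega> (nat \<lfloor>Q\<rfloor>) \<le> 2 * Psi n Q \<Omega> + n * card (nontrivial_products n (nat \<lfloor>Q\<rfloor>))"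
    unfolding M_def by simp
qed

text \<open>Multiplying by \<open>g\<close> scales all coefficients, so height at most
  \<open>M\<close> for the multiple means height at most \<open>M div g\<close> for the primitive
  part. This supplies the dilations \<open>M div g\<close> of the convolution.\<close>

lemma bij_betw_primitives_content:
  assumes "g \<ge> 1"
  shows "bij_betw (smult (int g)) (primitives_bounded n (M div g)) {p\<in>polys_bounded n M - {0}. nat (content p) = g}"
proof (rule bij_betw_byWitness[where f' = primitive_part])
  have scale: "\<bar>int g * c\<bar> \<le> int M \<longleftrightarrow> \<bar>c\<bar> \<le> int (M div g)" for c
  proof -
    have "\<bar>int g * c\<bar> \<le> int M \<longleftrightarrow> int (nat \<bar>c\<bar> * g) \<le> int M" by (simp add: abs_mult mult.commute)
    also have "\<dots> \<longleftrightarrow> nat \<bar>c\<bar> \<le> M div g" using assms by (simp only: of_nat_le_iff less_eq_div_iff_mult_less_eq)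
    also have "\<dots> \<longleftrightarrow> \<bar>c\<bar> \<le> int (M div g)" by linarith
    finally show ?thesis .
  qed
  show "\<forall>p\<in>primitives_bounded n (M div g). primitive_part (smult (int g) p) = p"
  proof
    fix p assume "p \<in> primitives_bounded n (M div g)"
    then have "content p = 1" by (simp add: primitives_bounded_def)
    then have "smult (int g) (primitive_part (smult (int g) p)) = smult (int g) p"
      using content_times_primitive_part[of "smult (int g) p"] by (simp add: content_smult)
    then show "primitive_part (smult (int g) p) = p" using assms by (intro smult_left_cancel[of "int g" "primitive_part (smult (int g) p)" p]) simp_all
  qed
  show "smult (int g) ` primitives_bounded n (M div g) \<subseteq> {p\<in>polys_bounded n M - {0}. nat (content p) = g}"
  proof (rule image_subsetI)
    fix p assume p: "p \<in> primitives_bounded n (M div g)"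
    have "\<bar>coeff (smult (int g) p) i\<bar> \<le> int M" for i
      using p by (simp only: coeff_smult scale) (simp add: primitives_bounded_def polys_bounded_def)
    moreover have "content (smult (int g) p) = int g" using p by (simp add: primitives_bounded_def content_smult)
    moreover have "smult (int g) p \<noteq> 0" using assms nonzero_of_primitive[OF p] by simp
    moreover have "degree (smult (int g) p) \<le> n" using p by (simp add: primitives_bounded_def polys_bounded_def)
    ultimately show "smult (int g) p \<in> {p\<in>polys_bounded n M - {0}. nat (content p) = g}"
      unfolding polys_bounded_def by (simp del: coeff_smult degree_smult_eq)
  qed
  have sm: "smult (int g) (primitive_part p) = p" if "p \<in> polys_bounded n M - {0}" "nat (content p) = g" for p
  proof -
    have "content p = int g" using that(2) assms by linarith
    then show ?thesis using content_times_primitive_part[of p] by simp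
  qed
  then show "\<forall>p\<in>{p\<in>polys_bounded n M - {0}. nat (content p) = g}. smult (int g) (primitive_part p) = p" by blast
  show "primitive_part ` {p\<in>polys_bounded n M - {0}. nat (content p) = g} \<subseteq> primitives_bounded n (M div g)"
  proof
    fix q assume "q \<in> primitive_part ` {p\<in>polys_bounded n M - {0}. nat (content p) = g}"
    then obtain p where p: "p \<in> polys_bounded n M - {0}" "nat (content p) = g" "q = primitive_part p" by blast
    have "\<bar>int g * coeff q i\<bar> \<le> int M" for i
      using p(1) arg_cong[OF sm[OF p(1,2)], of "\<lambda>p. coeff p i"] by (simp add: p(3) polys_bounded_def)
    then show "q \<in> primitives_bounded n (M div g)"
      using p by (simp add: primitives_bounded_def polys_bounded_def scale content_primitive_part)
  qed
qed

lemma sum_roots_by_content: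
  assumes "open \<Omega>"
  shows "(\<Sum>p\<in>polys_bounded n M. card (int_roots \<Omega> p)) = (\<Sum>g=1..M. primitive_root_count n \<Omega> (M div g))"
proof -
  have img: "(\<lambda>p. nat (content p)) ` (polys_bounded n M - {0}) \<subseteq> {1..M}"
  proof (rule image_subsetI)
    fix p assume p: "p \<in> polys_bounded n M - {0}"
    then have c0: "content p \<noteq> 0" "content p \<ge> 0" using normalize_content[of p] by (auto simp: abs_if split: if_splits)
    then have "content p > 0" by linarith
    have "content p dvd lead_coeff p" by (rule content_dvd_coeff)
    then have "content p \<le> \<bar>lead_coeff p\<bar>" using p by (intro zdvd_imp_le) auto
    also have "\<dots> \<le> int M" using p by (simp add: polys_bounded_def)
    finally show "nat (content p) \<in> {1..M}" using \<open>content p > 0\<close> by (simp add: Suc_le_eq nat_le_iff)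
  qed
  have "(0 :: int poly) \<in> polys_bounded n M" by (simp add: polys_bounded_def)
  \<comment> \<open>The zero polynomial belongs to no content class \<open>g \<ge> 1\<close>. It
    contributes nothing: its root set is \<Omega>, empty or infinite.\<close>
  moreover have "card (int_roots \<Omega> 0) = 0" using finite_imp_not_open[of \<Omega>] assms by (cases "finite \<Omega>") auto
  ultimately have "(\<Sum>p\<in>polys_bounded n M. card (int_roots \<Omega> p)) = (\<Sum>p\<in>polys_bounded n M - {0}. card (int_roots \<Omega> p))"
    using sum.remove[OF finite_polys_bounded, of 0 n M "\<lambda>p. card (int_roots \<Omega> p)"] by simp
  also have "\<dots> = (\<Sum>g=1..M. \<Sum>p\<in>{p\<in>polys_bounded n M - {0}. nat (content p) = g}. card (int_roots \<Omega> p))"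
    using finite_polys_bounded by (intro sum.group[symmetric] img) auto
  also have "\<dots> = (\<Sum>g=1..M. primitive_root_count n \<Omega> (M div g))"
  proof (rule sum.cong[OF refl])
    fix g assume "g \<in> {1..M}"
    then have g: "g \<ge> 1" by simp
    have "(\<Sum>p\<in>{p\<in>polys_bounded n M - {0}. nat (content p) = g}. card (int_roots \<Omega> p))
      = (\<Sum>p\<in>primitives_bounded n (M div g). card (int_roots \<Omega> (smult (int g) p)))"
      by (rule sum.reindex_bij_betw[OF bij_betw_primitives_content[OF g], symmetric])
    also have "\<dots> = primitive_root_count n \<Omega> (M div g)"
      using g by (simp add: primitive_root_count_def poly_map_of_int_smult)
    finally show "(\<Sum>p\<in>{p\<in>polys_bounded n M - {0}. nat (content p) = g}. card (int_roots \<Omega> p))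
      = primitive_root_count n \<Omega> (M div g)" .
  qed
  finally show ?thesis .
qed

lemma real_cpoly_int_coeffs:
  assumes "degree p \<le> n"
  shows "real_cpoly n (\<lambda>l. real_of_int (restrict (coeff p) {..n} l)) = map_poly of_int p"
  using assms by (auto simp: poly_eq_iff coeff_real_cpoly coeff_map_poly coeff_eq_0)

lemma grid_root_count_eq:
  assumes "open \<Omega>"
  shows "grid_root_count n \<Omega> M = (\<Sum>g=1..M. real (primitive_root_count n \<Omega> (M div g)))"
proof -
  have "grid_root_count n \<Omega> M
    = (\<Sum>p\<in>polys_bounded n M. real (root_count n \<Omega> (\<lambda>l. of_int (restrict (coeff p) {..n} l))))"
    unfolding grid_root_count_def by (rule sum.reindex_bij_betw[OF bij_betw_polys_grid, symmetric])
  also have "\<dots> = (\<Sum>p\<in>polys_bounded n M. real (card (int_roots \<Omega> p)))"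
  proof (rule sum.cong[OF refl])
    fix p assume "p \<in> polys_bounded n M"
    then have "degree p \<le> n" by (simp add: polys_bounded_def)
    then show "real (root_count n \<Omega> (\<lambda>l. of_int (restrict (coeff p) {..n} l))) = real (card (int_roots \<Omega> p))"
      by (simp only: root_count_def real_cpoly_int_coeffs)
  qed
  also have "\<dots> = real (\<Sum>p\<in>polys_bounded n M. card (int_roots \<Omega> p))" by simp
  also have "\<dots> = (\<Sum>g=1..M. real (primitive_root_count n \<Omega> (M div g)))"
    unfolding sum_roots_by_content[OF assms] by simp
  finally show ?thesis .
qed

theorem theorem1:
  fixes n k d :: nat
  assumes "n \<ge> 2"
  shows "\<exists>C Q0. \<forall>(\<Omega> :: complex set) (c :: nat \<Rightarrow> nat \<Rightarrow> nat \<Rightarrow> real) (Q :: real).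
           open \<Omega> \<and> connected \<Omega> \<and> \<Omega> \<inter> \<real> = {} \<and>
           (\<forall>i<k. bipoly_nonzero (c i) d) \<and>
           frontier \<Omega> \<subseteq> (\<Union>i<k. alg_curve (c i) d) \<and> Q \<ge> Q0 \<longrightarrow>
           \<bar>real (Psi n Q \<Omega>) - Q ^ (n+1) / (2 * zeta_nat (n+1)) * (LINT z : \<Omega> | lborel. psi n z)\<bar>
             \<le> C * Q ^ n"
proof -
  obtain C where C: "C \<ge> 0" and est: "\<forall>(\<Omega> :: complex set) (c :: nat \<Rightarrow> nat \<Rightarrow> nat \<Rightarrow> real).
    open \<Omega> \<and> \<Omega> \<inter> \<real> = {} \<and> (\<forall>i<k. bipoly_nonzero (c i) d) \<and> frontier \<Omega> \<subseteq> (\<Union>i<k. alg_curve (c i) d) \<longrightarrow>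
    0 \<le> (LINT z : \<Omega> | lborel. psi n z) \<and> (LINT z : \<Omega> | lborel. psi n z) \<le> C \<and>
    (\<forall>M. \<bar>(real M + 1/2) ^ (n + 1) * (LINT z : \<Omega> | lborel. psi n z) - grid_root_count n \<Omega> M\<bar> \<le> C * (2 * real M + 1) ^ n)"
    using grid_root_count_estimate[OF assms, of k d] by (elim exE conjE) (rule that)
  obtain C' where C': "C' \<ge> 0" "\<And>M. M \<ge> 1 \<Longrightarrow> real (card (nontrivial_products n M)) \<le> C' * real M ^ n"
    using card_nontrivial_products_le[of n] by blast
  \<comment> \<open>The first summand is the error of \<open>dilation_inversion\<close>, the second
    pays for the roots of \<open>nontrivial_products\<close>. Together they bound the error for
    twice \<open>Psi\<close>; the halving at the end is not exploited.\<close>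
  define E where "E = 4 * C * (3 ^ n + real (n + 1) * 2 ^ n + 2) + real n * C'"
  have main: "\<bar>real (Psi n Q \<Omega>) - Q ^ (n+1) / (2 * zeta_nat (n+1)) * (LINT z : \<Omega> | lborel. psi n z)\<bar> \<le> E * Q ^ n"
    if \<Omega>: "open \<Omega>" "\<Omega> \<inter> \<real> = {}" "\<forall>i<k. bipoly_nonzero (c i) d" "frontier \<Omega> \<subseteq> (\<Union>i<k. alg_curve (c i) d)" "Q \<ge> 1"
    for \<Omega> c Q
  proof -
    define I where "I = (LINT z : \<Omega> | lborel. psi n z)"
    define M where "M = nat \<lfloor>Q\<rfloor>"
    define P where "P = real (primitive_root_count n \<Omega> M)"
    define X where "X = I / zeta_nat (n + 1) * Q ^ (n + 1)"
    from est[THEN spec[of _ \<Omega>], THEN spec[of _ c]]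
    have "0 \<le> I \<and> I \<le> C \<and> (\<forall>M. \<bar>(real M + 1/2) ^ (n + 1) * I - grid_root_count n \<Omega> M\<bar> \<le> C * (2 * real M + 1) ^ n)"
      unfolding I_def by (rule mp) (intro conjI \<Omega>(1-4))
    then have I: "0 \<le> I" "I \<le> C" "\<And>M. \<bar>(real M + 1/2) ^ (n + 1) * I - grid_root_count n \<Omega> M\<bar> \<le> C * (2 * real M + 1) ^ n"
      by auto
    have 1: "\<bar>P - X\<bar> \<le> 4 * C * (3 ^ n + real (n + 1) * 2 ^ n + 2) * Q ^ n"
      unfolding P_def M_def X_def
      by (rule dilation_inversion[OF assms grid_root_count_eq[OF \<Omega>(1)] I(3) I(1,2) \<Omega>(5)])
    have M: "M \<ge> 1" "real M \<le> Q" using \<Omega>(5) by (auto simp: M_def le_nat_iff le_floor_iff)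
    have "real (card (nontrivial_products n M)) \<le> C' * real M ^ n" by (rule C'(2)[OF M(1)])
    also have "\<dots> \<le> C' * Q ^ n" using M C'(1) by (intro mult_left_mono power_mono) auto
    finally have "real n * real (card (nontrivial_products n M)) \<le> real n * (C' * Q ^ n)" by (rule mult_left_mono) simp
    moreover have "2 * real (Psi n Q \<Omega>) \<le> P" "P \<le> 2 * real (Psi n Q \<Omega>) + real n * real (card (nontrivial_products n M))"
      using of_nat_mono[OF primitive_root_count_minus_Psi(1)[OF \<Omega>(2), of Q n], where ?'a = real]
        of_nat_mono[OF primitive_root_count_minus_Psi(2)[OF \<Omega>(2), of Q n], where ?'a = real] \<Omega>(5)
      unfolding P_def M_def by simp_all
    ultimately have "\<bar>2 * real (Psi n Q \<Omega>) - P\<bar> \<le> real n * (C' * Q ^ n)" by linarith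
    with 1 have "\<bar>2 * real (Psi n Q \<Omega>) - X\<bar> \<le> E * Q ^ n" unfolding E_def distrib_right mult.assoc by linarith
    moreover have "Q ^ (n+1) / (2 * zeta_nat (n+1)) * I = X / 2" by (simp add: X_def mult_ac)
    ultimately show ?thesis unfolding I_def[symmetric] by linarith
  qed
  show ?thesis
    by (intro exI[of _ E] exI[of _ 1] allI impI, elim conjE, rule main)
qed

end
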